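(* Let $F$ be a field, $A$ a free abelian group with basis $\{x_1,\dots,x_n\}$, $F * A$ a twisted group algebra, and $M$ a finitely generated $F * A$-module with $\mathrm{gk}(M)=r$, where $0<r\le n-1$. Suppose $M$ is not torsion as an $F * \langle x_1,\dots,x_r\rangle$-module. Then there exist $l_{r+1},\dots,l_n\in\langle x_1,\dots,x_r\rangle$ and nonzero integers $s_{r+1},\dots,s_n$ such that the elements $\bar l_j\bar x_j^{s_j}$ and $\bar l_k\bar x_k^{s_k}$ of $F * A$ commute for all $j,k\in\{r+1,\dots,n\}$.
   Context: A twisted group algebra $F * A$ is an $F$-algebra with $F$-basis $\{\bar a: a\in A\}$ and multiplication $\bar a_1\bar a_2=\tau(a_1,a_2)\overline{a_1a_2}$, $\tau$ a 2-cocycle with values in $F\setminus\{0\}$; $F * B$ is the subalgebra spanned by $\bar b$, $b\in B$. A module is torsion over $F * B$ if every element is annihilated by a nonzero element of $F * B$. $\mathrm{gk}$ denotes Gelfand–Kirillov dimension over $F$. *)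

theory Defs
  imports Complex_Main "HOL-Library.Extended_Real" "HOL-Library.Liminf_Limsup" "HOL-Library.Function_Algebras"
begin

text \<open>The free abelian group A with basis x_1,...,x_n is modelled as
  the functions a :: nat => int vanishing outside {0..<n}; the coordinate i
  corresponds to the basis element x_(i+1).  The group is written additively.\<close>

definition grp :: "nat \<Rightarrow> (nat \<Rightarrow> int) set" where
  "grp n = {a. \<forall>i\<ge>n. a i = 0}"

definition gen :: "nat \<Rightarrow> (nat \<Rightarrow> int)" where
  "gen i = (\<lambda>j. if j = i then 1 else 0)"

definition cocycle :: "nat \<Rightarrow> ((nat \<Rightarrow> int) \<Rightarrow> (nat \<Rightarrow> int) \<Rightarrow> 'f::field) \<Rightarrow> bool" where
  "cocycle n \<tau> \<longleftrightarrow>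
     (\<forall>a\<in>grp n. \<forall>b\<in>grp n. \<tau> a b \<noteq> 0) \<and>
     (\<forall>a\<in>grp n. \<forall>b\<in>grp n. \<forall>c\<in>grp n. \<tau> a b * \<tau> (a + b) c = \<tau> a (b + c) * \<tau> b c)"

text \<open>Underlying set of F * A (finitely supported coefficient functions on A);
  F * <x_1,...,x_r> is tga r.\<close>
definition tga :: "nat \<Rightarrow> ((nat \<Rightarrow> int) \<Rightarrow> 'f::field) set" where
  "tga n = {u. finite {a. u a \<noteq> 0} \<and> {a. u a \<noteq> 0} \<subseteq> grp n}"

text \<open>Twisted multiplication: bar a1 * bar a2 = tau(a1,a2) bar(a1 a2), extended bilinearly.\<close>
definition tmul :: "((nat \<Rightarrow> int) \<Rightarrow> (nat \<Rightarrow> int) \<Rightarrow> 'f::field)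
    \<Rightarrow> ((nat \<Rightarrow> int) \<Rightarrow> 'f) \<Rightarrow> ((nat \<Rightarrow> int) \<Rightarrow> 'f) \<Rightarrow> ((nat \<Rightarrow> int) \<Rightarrow> 'f)" where
  "tmul \<tau> u v = (\<lambda>c. \<Sum>a\<in>{a. u a \<noteq> 0}. \<Sum>b\<in>{b. v b \<noteq> 0}.
        if a + b = c then \<tau> a b * u a * v b else 0)"

definition bar :: "(nat \<Rightarrow> int) \<Rightarrow> ((nat \<Rightarrow> int) \<Rightarrow> 'f::field)" where
  "bar a = (\<lambda>b. if b = a then 1 else 0)"

definition tunit :: "((nat \<Rightarrow> int) \<Rightarrow> (nat \<Rightarrow> int) \<Rightarrow> 'f::field) \<Rightarrow> ((nat \<Rightarrow> int) \<Rightarrow> 'f)" where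
  "tunit \<tau> = (\<lambda>b. if b = 0 then inverse (\<tau> 0 0) else 0)"

definition tinv :: "nat \<Rightarrow> ((nat \<Rightarrow> int) \<Rightarrow> (nat \<Rightarrow> int) \<Rightarrow> 'f::field)
    \<Rightarrow> ((nat \<Rightarrow> int) \<Rightarrow> 'f) \<Rightarrow> ((nat \<Rightarrow> int) \<Rightarrow> 'f)" where
  "tinv n \<tau> u = (THE v. v \<in> tga n \<and> tmul \<tau> u v = tunit \<tau> \<and> tmul \<tau> v u = tunit \<tau>)"

primrec tpow_nat :: "((nat \<Rightarrow> int) \<Rightarrow> (nat \<Rightarrow> int) \<Rightarrow> 'f::field)
    \<Rightarrow> ((nat \<Rightarrow> int) \<Rightarrow> 'f) \<Rightarrow> nat \<Rightarrow> ((nat \<Rightarrow> int) \<Rightarrow> 'f)" where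
  "tpow_nat \<tau> u 0 = tunit \<tau>"
| "tpow_nat \<tau> u (Suc k) = tmul \<tau> u (tpow_nat \<tau> u k)"

definition tpow :: "nat \<Rightarrow> ((nat \<Rightarrow> int) \<Rightarrow> (nat \<Rightarrow> int) \<Rightarrow> 'f::field)
    \<Rightarrow> ((nat \<Rightarrow> int) \<Rightarrow> 'f) \<Rightarrow> int \<Rightarrow> ((nat \<Rightarrow> int) \<Rightarrow> 'f)" where
  "tpow n \<tau> u s = (if 0 \<le> s then tpow_nat \<tau> u (nat s) else tpow_nat \<tau> (tinv n \<tau> u) (nat (- s)))"

definition tga_module :: "nat \<Rightarrow> ((nat \<Rightarrow> int) \<Rightarrow> (nat \<Rightarrow> int) \<Rightarrow> 'f::field)
    \<Rightarrow> ('f \<Rightarrow> 'm::ab_group_add \<Rightarrow> 'm) \<Rightarrow> (((nat \<Rightarrow> int) \<Rightarrow> 'f) \<Rightarrow> 'm \<Rightarrow> 'm) \<Rightarrow> bool" where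
  "tga_module n \<tau> scale act \<longleftrightarrow>
     vector_space scale \<and>
     (\<forall>u\<in>tga n. \<forall>v\<in>tga n. \<forall>m. act (\<lambda>a. u a + v a) m = act u m + act v m) \<and>
     (\<forall>u\<in>tga n. \<forall>c m. act (\<lambda>a. c * u a) m = scale c (act u m)) \<and>
     (\<forall>u\<in>tga n. \<forall>m m'. act u (m + m') = act u m + act u m') \<and>
     (\<forall>u\<in>tga n. \<forall>c m. act u (scale c m) = scale c (act u m)) \<and>
     (\<forall>u\<in>tga n. \<forall>v\<in>tga n. \<forall>m. act (tmul \<tau> u v) m = act u (act v m)) \<and>
     (\<forall>m. act (tunit \<tau>) m = m)"

definition fin_gen :: "nat \<Rightarrow> (((nat \<Rightarrow> int) \<Rightarrow> 'f::field) \<Rightarrow> 'm::ab_group_add \<Rightarrow> 'm) \<Rightarrow> bool" where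
  "fin_gen n act \<longleftrightarrow> (\<exists>G. finite G \<and>
     (\<forall>m. \<exists>u. (\<forall>g\<in>G. u g \<in> tga n) \<and> m = (\<Sum>g\<in>G. act (u g) g)))"

definition torsion_over :: "nat \<Rightarrow> (((nat \<Rightarrow> int) \<Rightarrow> 'f::field) \<Rightarrow> 'm::ab_group_add \<Rightarrow> 'm) \<Rightarrow> bool" where
  "torsion_over r act \<longleftrightarrow> (\<forall>m. \<exists>u\<in>tga r. u \<noteq> (\<lambda>_. 0) \<and> act u m = 0)"

text \<open>Products of k elements of S (these span V^k when V = span S).\<close>
primrec words :: "((nat \<Rightarrow> int) \<Rightarrow> (nat \<Rightarrow> int) \<Rightarrow> 'f::field)
    \<Rightarrow> ((nat \<Rightarrow> int) \<Rightarrow> 'f) set \<Rightarrow> nat \<Rightarrow> ((nat \<Rightarrow> int) \<Rightarrow> 'f) set" where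
  "words \<tau> S 0 = {tunit \<tau>}"
| "words \<tau> S (Suc k) = {tmul \<tau> s p | s p. s \<in> S \<and> p \<in> words \<tau> S k}"

text \<open>Gelfand--Kirillov dimension of the module:
  sup over finite-dimensional subspaces V = span S of F * A containing 1 and
  W = span T of M of limsup_k log dim(V^k W) / log k.\<close>
definition gkdim :: "nat \<Rightarrow> ((nat \<Rightarrow> int) \<Rightarrow> (nat \<Rightarrow> int) \<Rightarrow> 'f::field)
    \<Rightarrow> ('f \<Rightarrow> 'm::ab_group_add \<Rightarrow> 'm) \<Rightarrow> (((nat \<Rightarrow> int) \<Rightarrow> 'f) \<Rightarrow> 'm \<Rightarrow> 'm) \<Rightarrow> ereal" where
  "gkdim n \<tau> scale act = Sup {limsup (\<lambda>k. ereal (ln (real (vector_space.dim scale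
        {act p t | p t. p \<in> words \<tau> S k \<and> t \<in> T})) / ln (real k)))
      | S T. finite S \<and> S \<subseteq> tga n \<and> tunit \<tau> \<in> S \<and> finite T}"

end

theory Submission
  imports Defs "HOL-Computational_Algebra.Primes"
begin

text \<open>
  Write \<open>B = \<langle>x\<^sub>1,\<dots>,x\<^sub>r\<rangle>\<close>, choose an injective homomorphism \<open>\<theta> : B \<rightarrow> \<real>\<close>, and let \<open>m \<in> M\<close> generate a free
  \<open>F * B\<close>-module. The growth bound makes \<open>x\<^sub>j\<close> algebraic over \<open>F * B\<close> on every vector, so the \<open>A\<close>-translates of
  \<open>m\<close> have finite rank over \<open>F * B\<close>, with a finite \<open>F * B\<close>-independent set \<open>G\<close> of translates of full rank. The
  \<open>\<theta>\<close>-adic lattice spanned by \<open>G\<close> gives a non-archimedean norm, and the spectral radii \<open>\<rho>(a)\<close> of the translations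
  form a superadditive homogeneous function on \<open>A\<close>. Iterated directional derivatives of \<open>\<rho>\<close> give a homomorphism
  \<open>\<phi> : A \<rightarrow> \<real>\<close> extending \<open>\<theta>\<close> for which some \<open>w \<in> G\<close> is not a combination of translates \<open>a w\<close> with \<open>\<phi>(a) > 0\<close>;
  that is, the initial degeneration of \<open>F * A w\<close> along \<open>\<phi>\<close> is nonzero.

  The lowest \<open>\<phi>\<close>-part of an algebraic relation of \<open>x\<^sub>j\<close> on \<open>w\<close> has at least two terms. So the kernel of \<open>\<phi>\<close> contains
  an element \<open>c\<^sub>j = l\<^sub>j x\<^sub>j\<^sup>s\<close> with \<open>s \<noteq> 0\<close>, and \<open>c\<^sub>j\<close> is algebraic over \<open>F\<close> modulo the vectors of positive \<open>\<phi>\<close>.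
  A shortest polynomial in \<open>c\<^sub>j\<close> killing all \<open>c\<^sub>k\<close>-translates of \<open>w\<close> is, up to a scalar, fixed under conjugation by
  \<open>c\<^sub>k\<close>, which forces the commutator of \<open>c\<^sub>j\<close> and \<open>c\<^sub>k\<close> to be a root of unity. A common power of all \<open>c\<^sub>j\<close> then
  commutes.
\<close>

section \<open>Twisted group algebras\<close>

text \<open>As the group is written additively, this is the power \<open>a^k\<close>.\<close>

definition zmul :: "int \<Rightarrow> (nat \<Rightarrow> int) \<Rightarrow> (nat \<Rightarrow> int)" where
  "zmul k a = (\<lambda>i. k * a i)"

lemma zmul_simps [simp]:
  "zmul 0 a = 0" "zmul 1 a = a" "zmul k 0 = 0"
  by (auto simp: zmul_def fun_eq_iff)

lemma zmul_apply: "zmul k a i = k * a i"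
  by (simp add: zmul_def)

lemma zmul_add_left: "zmul (k + l) a = zmul k a + zmul l a"
  by (auto simp: zmul_def fun_eq_iff algebra_simps)

lemma zmul_add_right: "zmul k (a + b) = zmul k a + zmul k b"
  by (auto simp: zmul_def fun_eq_iff algebra_simps)

lemma zmul_uminus_left: "zmul (- k) a = - zmul k a"
  by (auto simp: zmul_def fun_eq_iff)

lemma zmul_diff_left: "zmul (k - l) a = zmul k a - zmul l a"
  by (auto simp: zmul_def fun_eq_iff algebra_simps)

lemma zmul_zmul: "zmul k (zmul l a) = zmul (k * l) a"
  by (auto simp: zmul_def fun_eq_iff)

lemma zmul_eq_0_iff: "zmul k a = 0 \<longleftrightarrow> k = 0 \<or> a = 0"
  by (auto simp: zmul_def fun_eq_iff)

lemma grp_0 [simp, intro]: "0 \<in> grp n"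
  and grp_add [simp, intro]: "a \<in> grp n \<Longrightarrow> b \<in> grp n \<Longrightarrow> a + b \<in> grp n"
  and grp_uminus [simp, intro]: "a \<in> grp n \<Longrightarrow> - a \<in> grp n"
  and grp_diff [simp, intro]: "a \<in> grp n \<Longrightarrow> b \<in> grp n \<Longrightarrow> a - b \<in> grp n"
  and grp_zmul [simp, intro]: "a \<in> grp n \<Longrightarrow> zmul k a \<in> grp n"
  and grp_gen [simp, intro]: "i < n \<Longrightarrow> gen i \<in> grp n"
  by (auto simp: grp_def gen_def zmul_apply)

lemma grp_sum [intro]: "(\<And>i. i \<in> I \<Longrightarrow> f i \<in> grp n) \<Longrightarrow> sum f I \<in> grp n"
  by (induction I rule: infinite_finite_induct) auto

lemma grp_mono: "r \<le> n \<Longrightarrow> a \<in> grp r \<Longrightarrow> a \<in> grp n"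
  by (auto simp: grp_def)

section \<open>Supports and the twisted convolution product\<close>

abbreviation supp :: "((nat \<Rightarrow> int) \<Rightarrow> 'f::zero) \<Rightarrow> (nat \<Rightarrow> int) set" where
  "supp u \<equiv> {a. u a \<noteq> 0}"

lemma tga_iff: "u \<in> tga n \<longleftrightarrow> finite (supp u) \<and> supp u \<subseteq> grp n"
  by (simp add: tga_def)

lemma tga_mono: "r \<le> n \<Longrightarrow> u \<in> tga r \<Longrightarrow> u \<in> tga n"
  by (auto simp: tga_iff dest: grp_mono)

lemma supp_bar [simp]: "supp (bar a :: _ \<Rightarrow> 'f::field) = {a}"
  by (auto simp: bar_def)

lemma bar_in_tga [simp, intro]: "a \<in> grp n \<Longrightarrow> bar a \<in> tga n"
  by (simp add: tga_iff)

lemma tga_finite_supp: "u \<in> tga n \<Longrightarrow> finite (supp u)"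
  by (simp add: tga_iff)

lemma tga_supp: "u \<in> tga n \<Longrightarrow> u a \<noteq> 0 \<Longrightarrow> a \<in> grp n"
  by (auto simp: tga_iff)

lemma tga_restrict:
  assumes "finite X" "X \<subseteq> grp n" "\<And>a. u a \<noteq> 0 \<Longrightarrow> a \<in> X"
  shows "u \<in> tga n"
  using assms by (auto simp: tga_iff intro: finite_subset)

lemma tga_same_supp: "u \<in> tga n \<Longrightarrow> (\<And>a. v a \<noteq> 0 \<Longrightarrow> u a \<noteq> 0) \<Longrightarrow> v \<in> tga n"
  by (rule tga_restrict[of "supp u"]) (auto simp: tga_iff)

lemma tga_0 [simp, intro]: "(\<lambda>_. 0) \<in> tga n"
  by (simp add: tga_iff)

lemma tga_add: "u \<in> tga n \<Longrightarrow> v \<in> tga n \<Longrightarrow> (\<lambda>a. u a + v a) \<in> tga n"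
  by (rule tga_restrict[of "supp u \<union> supp v"]) (auto simp: tga_iff)

lemma tga_scale: "u \<in> tga n \<Longrightarrow> (\<lambda>a. c * u a) \<in> tga n"
  by (erule tga_same_supp) auto

text \<open>For fixed \<open>a\<close> only \<open>b = c - a\<close> contributes to the coefficient
  at \<open>c\<close>, so the double sum collapses. Any finite \<open>X\<close> containing the
  support may index it, which leaves later proofs free to choose a convenient index set.\<close>

lemma tmul_eq:
  assumes "finite (supp v)" "finite X" "supp u \<subseteq> X"
  shows "tmul \<tau> u v c = (\<Sum>a\<in>X. \<tau> a (c - a) * u a * v (c - a))"
proof -
  have "(\<Sum>b\<in>supp v. if a + b = c then \<tau> a b * u a * v b else 0) = \<tau> a (c - a) * u a * v (c - a)" for a
  proof -
    have "(\<Sum>b\<in>supp v. if a + b = c then \<tau> a b * u a * v b else 0)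
        = (\<Sum>b\<in>supp v. if b = c - a then \<tau> a b * u a * v b else 0)"
      by (rule sum.cong) (auto simp: algebra_simps)
    also have "\<dots> = \<tau> a (c - a) * u a * v (c - a)"
      using assms(1) by (subst sum.delta) auto
    finally show ?thesis .
  qed
  then have "tmul \<tau> u v c = (\<Sum>a\<in>supp u. \<tau> a (c - a) * u a * v (c - a))"
    by (simp add: tmul_def)
  also have "\<dots> = (\<Sum>a\<in>X. \<tau> a (c - a) * u a * v (c - a))"
    by (rule sum.mono_neutral_left) (use assms in auto)
  finally show ?thesis .
qed

lemma tmul_supp:
  assumes "finite (supp u)" "finite (supp v)" "tmul \<tau> u v c \<noteq> 0"
  obtains a b where "u a \<noteq> 0" "v b \<noteq> 0" "c = a + b"
proof -
  have "(\<Sum>a\<in>supp u. \<tau> a (c - a) * u a * v (c - a)) \<noteq> 0"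
    using assms tmul_eq[of v "supp u" u \<tau> c] by simp
  then obtain a where "a \<in> supp u" "\<tau> a (c - a) * u a * v (c - a) \<noteq> 0"
    by (rule sum.not_neutral_contains_not_neutral)
  then show ?thesis
    by (intro that[of a "c - a"]) auto
qed

lemma tmul_in_tga:
  assumes "u \<in> tga n" "v \<in> tga n"
  shows "tmul \<tau> u v \<in> tga n"
proof (rule tga_restrict[of "(\<lambda>(a, b). a + b) ` (supp u \<times> supp v)"])
  show "finite ((\<lambda>(a, b). a + b) ` (supp u \<times> supp v))"
    using assms by (auto simp: tga_iff)
  show "(\<lambda>(a, b). a + b) ` (supp u \<times> supp v) \<subseteq> grp n"
    using assms by (auto simp: tga_iff)
  show "c \<in> (\<lambda>(a, b). a + b) ` (supp u \<times> supp v)" if "tmul \<tau> u v c \<noteq> 0" for c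
    using tmul_supp[OF _ _ that] assms
    by (metis (mono_tags, lifting) case_prod_conv image_eqI mem_Collect_eq mem_Sigma_iff tga_finite_supp)
qed

lemma tmul_monomials:
  "tmul \<tau> (\<lambda>x. \<alpha> * bar a x) (\<lambda>x. \<beta> * bar b x) = (\<lambda>x. \<alpha> * \<beta> * \<tau> a b * (bar (a + b) x :: 'f::field))"
proof
  fix c
  have fin: "finite (supp (\<lambda>x. \<beta> * (bar b x :: 'f)))"
    by (rule finite_subset[of _ "{b}"]) (auto simp: bar_def)
  have "tmul \<tau> (\<lambda>x. \<alpha> * bar a x) (\<lambda>x. \<beta> * bar b x) c
      = (\<Sum>a'\<in>{a}. \<tau> a' (c - a') * (\<alpha> * bar a a') * (\<beta> * bar b (c - a')))"
    by (rule tmul_eq[OF fin]) (auto simp: bar_def)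
  also have "\<dots> = \<alpha> * \<beta> * \<tau> a b * bar (a + b) c"
    by (auto simp: bar_def algebra_simps)
  finally show "tmul \<tau> (\<lambda>x. \<alpha> * bar a x) (\<lambda>x. \<beta> * bar b x) c = \<alpha> * \<beta> * \<tau> a b * bar (a + b) c" .
qed

lemma tmul_bar: "tmul \<tau> (bar a) (bar b) = (\<lambda>x. \<tau> a b * bar (a + b) x)"
  using tmul_monomials[of \<tau> 1 a 1 b] by simp

lemma tunit_eq: "tunit \<tau> = (\<lambda>x. inverse (\<tau> 0 0) * bar 0 x)"
  by (auto simp: tunit_def bar_def)

section \<open>Counting exponents in cubes\<close>

definition box :: "nat \<Rightarrow> nat \<Rightarrow> (nat \<Rightarrow> int) set" where
  "box n k = {a \<in> grp n. \<forall>i<n. \<bar>a i\<bar> \<le> int k}"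

lemma box_Suc: "box (Suc n) k = (\<lambda>(a, x). a(n := x)) ` (box n k \<times> {- int k..int k})"
proof (intro equalityI subsetI)
  fix a assume "a \<in> box (Suc n) k"
  then have "a(n := 0) \<in> box n k" "a n \<in> {- int k..int k}"
    by (auto simp: box_def grp_def abs_le_iff minus_le_iff)
  moreover have "a = (a(n := 0))(n := a n)"
    by simp
  ultimately show "a \<in> (\<lambda>(a, x). a(n := x)) ` (box n k \<times> {- int k..int k})"
    by (intro image_eqI[where x = "(a(n := 0), a n)"]) auto
next
  fix a assume "a \<in> (\<lambda>(a, x). a(n := x)) ` (box n k \<times> {- int k..int k})"
  then show "a \<in> box (Suc n) k"
    by (auto simp: box_def grp_def abs_le_iff less_Suc_eq)
qed

lemma card_box: "finite (box n k) \<and> card (box n k) = (2 * k + 1) ^ n"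
proof (induction n)
  case 0
  have "box 0 k = {0}"
    by (auto simp: box_def grp_def)
  then show ?case by simp
next
  case (Suc n)
  have "inj_on (\<lambda>(a, x). a(n := x)) (box n k \<times> {- int k..int k})"
  proof (rule inj_onI, clarify)
    fix a b :: "nat \<Rightarrow> int" and x y :: int
    assume *: "a \<in> box n k" "b \<in> box n k" "a(n := x) = b(n := y)"
    then have "a i = b i" for i
      by (cases "i = n") (auto simp: box_def grp_def fun_eq_iff split: if_splits)
    moreover have "x = y"
      using fun_cong[OF *(3), of n] by simp
    ultimately show "a = b \<and> x = y" by auto
  qed
  then have "card (box (Suc n) k) = card (box n k \<times> {- int k..int k})"
    unfolding box_Suc by (rule card_image)
  moreover have "card {- int k..int k} = 2 * k + 1"
    by simp
  ultimately show ?case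
    using Suc by (auto simp: card_cartesian_product box_Suc simp del: card_atLeastAtMost_int)
qed

lemma finite_box [simp, intro]: "finite (box n k)"
  using card_box by blast

lemma box_grp: "box n k \<subseteq> grp n"
  by (auto simp: box_def)

lemma finite_subset_box:
  assumes "finite X" "X \<subseteq> grp n"
  shows "\<exists>k. X \<subseteq> box n k"
proof -
  have "\<exists>k. \<forall>a\<in>X. \<forall>i<n. \<bar>a i\<bar> \<le> int k"
  proof (intro exI ballI allI impI)
    fix a i assume "a \<in> X" "i < n"
    then have "nat \<bar>a i\<bar> \<le> Max ((\<lambda>(a, i). nat \<bar>a i\<bar>) ` (X \<times> {..<n}))"
      using assms by (intro Max_ge) (auto intro!: image_eqI[where x = "(a, i)"])
    then show "\<bar>a i\<bar> \<le> int (Max ((\<lambda>(a, i). nat \<bar>a i\<bar>) ` (X \<times> {..<n})))"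
      by linarith
  qed
  then show ?thesis
    using assms by (auto simp: box_def)
qed

lemma box_add: "a \<in> box n k \<Longrightarrow> b \<in> box n l \<Longrightarrow> a + b \<in> box n (k + l)"
  by (auto simp: box_def intro: order_trans[OF abs_triangle_ineq] add_mono)

text \<open>The usual dimension bound, for families rather than sets: a repeated vector already
  gives a relation with coefficients \<open>1\<close> and \<open>- 1\<close>, and an injective
  family reduces to its image.\<close>

lemma (in vector_space) dependent_family:
  assumes "finite I" "finite T" "f ` I \<subseteq> span T" "card T < card I"
  shows "\<exists>c. (\<exists>i\<in>I. c i \<noteq> 0) \<and> (\<Sum>i\<in>I. c i *s f i) = 0"
proof (cases "inj_on f I")
  case True
  have "dependent (f ` I)"
    using independent_span_bound[OF assms(2) _ assms(3)] card_image[OF True] assms(4) by auto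
  then obtain u where "\<exists>v\<in>f ` I. u v \<noteq> 0" "(\<Sum>v\<in>f ` I. u v *s v) = 0"
    using dependent_finite[of "f ` I"] assms(1) by blast
  then show ?thesis
    using True by (intro exI[of _ "\<lambda>i. u (f i)"]) (auto simp: sum.reindex)
next
  case False
  then obtain i j where ij: "i \<in> I" "j \<in> I" "i \<noteq> j" "f i = f j"
    by (auto simp: inj_on_def)
  let ?c = "\<lambda>k. if k = i then 1 else if k = j then - 1 else 0"
  have "(\<Sum>k\<in>I. ?c k *s f k) = (\<Sum>k\<in>{i, j}. ?c k *s f k)"
    by (rule sum.mono_neutral_right) (use ij assms in auto)
  also have "\<dots> = 0" using ij by simp
  finally show ?thesis
    using ij by (intro exI[of _ ?c]) auto
qed

lemma vector_space_functions: "vector_space (\<lambda>c (u :: 'a \<Rightarrow> 'f::field) a. c * u a)"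
  by unfold_locales (auto simp: fun_eq_iff algebra_simps)

section \<open>Monomial operators on a module\<close>

locale twisted_module =
  fixes n :: nat
    and \<tau> :: "(nat \<Rightarrow> int) \<Rightarrow> (nat \<Rightarrow> int) \<Rightarrow> 'f::field"
    and scale :: "'f \<Rightarrow> 'm::ab_group_add \<Rightarrow> 'm"
    and act :: "((nat \<Rightarrow> int) \<Rightarrow> 'f) \<Rightarrow> 'm \<Rightarrow> 'm"
  assumes cocycle: "cocycle n \<tau>" and tga_module: "tga_module n \<tau> scale act"
begin

sublocale vector_space scale
  using tga_module by (simp add: tga_module_def)

lemma tau_nonzero: "a \<in> grp n \<Longrightarrow> b \<in> grp n \<Longrightarrow> \<tau> a b \<noteq> 0"
  using cocycle by (simp add: cocycle_def)

lemma tau_cocycle: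
  "a \<in> grp n \<Longrightarrow> b \<in> grp n \<Longrightarrow> c \<in> grp n \<Longrightarrow> \<tau> a b * \<tau> (a + b) c = \<tau> a (b + c) * \<tau> b c"
  using cocycle by (simp add: cocycle_def)

lemma act_plus: "u \<in> tga n \<Longrightarrow> v \<in> tga n \<Longrightarrow> act (\<lambda>a. u a + v a) m = act u m + act v m"
  and act_times: "u \<in> tga n \<Longrightarrow> act (\<lambda>a. c * u a) m = scale c (act u m)"
  and act_add: "u \<in> tga n \<Longrightarrow> act u (m + m') = act u m + act u m'"
  and act_scale: "u \<in> tga n \<Longrightarrow> act u (scale c m) = scale c (act u m)"
  and act_tmul: "u \<in> tga n \<Longrightarrow> v \<in> tga n \<Longrightarrow> act (tmul \<tau> u v) m = act u (act v m)"
  and act_tunit: "act (tunit \<tau>) m = m"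
  using tga_module by (simp_all add: tga_module_def)

lemma act_zero: "act (\<lambda>_. 0) m = 0"
  using act_times[of "\<lambda>_. 0" 0 m] by simp

lemma act_zero_right: "u \<in> tga n \<Longrightarrow> act u 0 = 0"
  using act_scale[of u 0 0] by simp

lemma act_sum_right: "u \<in> tga n \<Longrightarrow> act u (\<Sum>i\<in>I. f i) = (\<Sum>i\<in>I. act u (f i))"
  by (induction I rule: infinite_finite_induct) (auto simp: act_zero_right act_add)

definition T :: "(nat \<Rightarrow> int) \<Rightarrow> 'm \<Rightarrow> 'm" where "T a = act (bar a)"

lemma T_add: "a \<in> grp n \<Longrightarrow> T a (m + m') = T a m + T a m'"
  and T_scale: "a \<in> grp n \<Longrightarrow> T a (scale c m) = scale c (T a m)"
  and T_zero: "a \<in> grp n \<Longrightarrow> T a 0 = 0"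
  and T_sum: "a \<in> grp n \<Longrightarrow> T a (\<Sum>i\<in>I. f i) = (\<Sum>i\<in>I. T a (f i))"
  by (auto simp: T_def act_add act_scale act_zero_right act_sum_right)

text \<open>Linearity of the action in \<open>u\<close>, applied while splitting off one monomial at
  a time. \<open>X\<close> may exceed the support, so an element defined by a table of coefficients
  can be expanded over the whole table.\<close>

lemma act_expand:
  assumes "finite X" "X \<subseteq> grp n" "\<And>a. u a \<noteq> 0 \<Longrightarrow> a \<in> X"
  shows "act u m = (\<Sum>a\<in>X. scale (u a) (T a m))"
  using assms
proof (induction X arbitrary: u rule: finite_induct)
  case empty
  then have "u = (\<lambda>_. 0)" by auto
  then show ?case by (simp add: act_zero)
next
  case (insert x X)
  let ?v = "\<lambda>a. if a = x then 0 else u a"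
  have v: "?v \<in> tga n"
    using insert by (intro tga_restrict[of X]) (auto split: if_splits)
  have "u = (\<lambda>a. u x * bar x a + ?v a)"
    by (auto simp: bar_def)
  then have "act u m = act (\<lambda>a. u x * bar x a + ?v a) m"
    by simp
  also have "\<dots> = scale (u x) (T x m) + act ?v m"
    using insert v by (simp add: act_plus act_times tga_scale T_def)
  also have "act ?v m = (\<Sum>a\<in>X. scale (?v a) (T a m))"
    by (rule insert.IH) (use insert in \<open>auto split: if_splits\<close>)
  also have "\<dots> = (\<Sum>a\<in>X. scale (u a) (T a m))"
    by (rule sum.cong) (use insert in auto)
  finally show ?case
    using insert by simp
qed

lemma act_expand_supp: "u \<in> tga n \<Longrightarrow> act u m = (\<Sum>a\<in>supp u. scale (u a) (T a m))"
  by (rule act_expand) (auto simp: tga_iff)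

lemma act_in_span: "u \<in> tga n \<Longrightarrow> (\<And>a. u a \<noteq> 0 \<Longrightarrow> a \<in> X) \<Longrightarrow> act u m \<in> span ((\<lambda>a. T a m) ` X)"
  unfolding act_expand_supp by (intro span_sum span_scale span_base) auto

text \<open>Converse of \<open>act_in_span\<close>: a combination of translates comes from a single
  algebra element, with control of its support.\<close>

lemma span_imp_act:
  assumes "x \<in> span ((\<lambda>a. T a m) ` X)" "X \<subseteq> grp n"
  shows "\<exists>u\<in>tga n. supp u \<subseteq> X \<and> x = act u m"
  using assms(1)
proof (induction rule: span_induct_alt)
  case base
  show ?case
    by (intro bexI[of _ "\<lambda>_. 0"]) (auto simp: act_zero)
next
  case (step c x y)
  then obtain u a where u: "u \<in> tga n" "supp u \<subseteq> X" "y = act u m" and a: "a \<in> X" "x = T a m"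
    by auto
  have bar: "bar a \<in> tga n" using a assms by auto
  have "(\<lambda>x. c * bar a x + u x) \<in> tga n"
    using u bar by (intro tga_add tga_scale)
  moreover have "supp (\<lambda>x. c * bar a x + u x) \<subseteq> X"
    using u a by (auto simp: bar_def split: if_splits)
  moreover have "act (\<lambda>x. c * bar a x + u x) m = scale c x + y"
    unfolding act_plus[OF tga_scale[OF bar] u(1)] act_times[OF bar] u a T_def ..
  ultimately show ?case by metis
qed

lemma T_T: "a \<in> grp n \<Longrightarrow> b \<in> grp n \<Longrightarrow> T a (T b m) = scale (\<tau> a b) (T (a + b) m)"
  by (simp add: T_def flip: act_tmul act_times) (simp add: tmul_bar)

lemma T_plus: "a \<in> grp n \<Longrightarrow> b \<in> grp n \<Longrightarrow> T (a + b) m = scale (inverse (\<tau> a b)) (T a (T b m))"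
  using tau_nonzero[of a b] by (simp add: T_T)

text \<open>The cocycle is not assumed normalised, so \<open>bar 0\<close> acts as a nonzero scalar
  that need not be \<open>1\<close>; the identity operator belongs to
  \<open>tunit \<tau>\<close>.\<close>

lemma T_0: "T 0 m = scale (\<tau> 0 0) m"
proof -
  have "m = scale (inverse (\<tau> 0 0)) (T 0 m)"
    using act_tunit[of m] by (simp add: tunit_eq act_times T_def)
  then show ?thesis
    using tau_nonzero[of 0 0] by (metis grp_0 left_inverse scale_one scale_scale right_inverse)
qed

lemma T_uminus_T:
  assumes "a \<in> grp n"
  shows "T (- a) (T a m) = scale (\<tau> (- a) a * \<tau> 0 0) m" "\<tau> (- a) a * \<tau> 0 0 \<noteq> 0"
  using assms by (auto simp: T_T T_0 tau_nonzero)

text \<open>The commutator scalar: on \<open>grp n\<close>, \<open>bar a\<close> times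
  \<open>bar b\<close> equals \<open>lam a b\<close> times \<open>bar b\<close> times
  \<open>bar a\<close>. It is the alternating bicharacter attached to the cocycle.\<close>

definition lam :: "(nat \<Rightarrow> int) \<Rightarrow> (nat \<Rightarrow> int) \<Rightarrow> 'f" where
  "lam a b = \<tau> a b / \<tau> b a"

lemma lam_nonzero: "a \<in> grp n \<Longrightarrow> b \<in> grp n \<Longrightarrow> lam a b \<noteq> 0"
  by (simp add: lam_def tau_nonzero)

lemma lam_inverse: "lam a b = inverse (lam b a)"
  by (simp add: lam_def)

lemma lam_self: "a \<in> grp n \<Longrightarrow> lam a a = 1"
  by (simp add: lam_def tau_nonzero)

text \<open>Three instances of the cocycle identity, for the orders \<open>a, b, c\<close>, then
  \<open>b, c, a\<close>, then \<open>b, a, c\<close>, express the mixed values of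
  \<open>\<tau>\<close> through each other; everything but the two commutators cancels.\<close>

lemma lam_add_right:
  assumes "a \<in> grp n" "b \<in> grp n" "c \<in> grp n"
  shows "lam a (b + c) = lam a b * lam a c"
proof -
  have 1: "\<tau> a b * \<tau> (a + b) c = \<tau> a (b + c) * \<tau> b c"
    and 2: "\<tau> b c * \<tau> (b + c) a = \<tau> b (a + c) * \<tau> c a"
    and 3: "\<tau> b a * \<tau> (a + b) c = \<tau> b (a + c) * \<tau> a c"
    using tau_cocycle[of a b c] tau_cocycle[of b c a] tau_cocycle[of b a c] assms
    by (simp_all add: add.commute)
  have nz: "\<tau> a b \<noteq> 0" "\<tau> b a \<noteq> 0" "\<tau> b c \<noteq> 0" "\<tau> c a \<noteq> 0" "\<tau> a c \<noteq> 0" "\<tau> b (a + c) \<noteq> 0" "\<tau> (b + c) a \<noteq> 0"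
    using assms by (simp_all add: tau_nonzero)
  have "\<tau> a (b + c) = \<tau> a b * \<tau> (a + b) c / \<tau> b c"
    using 1 nz by (simp add: field_simps)
  moreover have "\<tau> (a + b) c = \<tau> b (a + c) * \<tau> a c / \<tau> b a"
    using 3 nz by (simp add: field_simps)
  moreover have "\<tau> (b + c) a = \<tau> b (a + c) * \<tau> c a / \<tau> b c"
    using 2 nz by (simp add: field_simps)
  ultimately show ?thesis
    using nz by (simp add: lam_def)
qed

lemma lam_0_right: "a \<in> grp n \<Longrightarrow> lam a 0 = 1"
  using lam_add_right[of a 0 0] lam_nonzero[of a 0] by simp

lemma lam_zmul_right:
  assumes "a \<in> grp n" "b \<in> grp n"
  shows "lam a (zmul k b) = lam a b powi k"
proof -
  have nat: "lam a (zmul (int k) b) = lam a b ^ k" for k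
  proof (induction k)
    case (Suc k)
    have "zmul (int (Suc k)) b = b + zmul (int k) b"
      using zmul_add_left[of 1 "int k" b] by simp
    then show ?case
      using Suc assms by (simp only: lam_add_right grp_zmul power_Suc)
  qed (use assms lam_0_right in \<open>simp only: zmul_simps of_nat_0 power_0\<close>)
  have "lam a (zmul (int k) b) * lam a (zmul (- int k) b) = 1" for k
    using assms lam_add_right[of a "zmul (int k) b" "zmul (- int k) b"]
    by (simp only: zmul_uminus_left grp_zmul grp_uminus right_minus lam_0_right)
  then have "lam a (zmul (- int k) b) = inverse (lam a b ^ k)" for k
    using nat by (metis inverse_unique)
  then show ?thesis
    using nat by (cases k rule: int_cases2) (auto simp: power_int_minus)
qed

lemma lam_zmul_left: "a \<in> grp n \<Longrightarrow> b \<in> grp n \<Longrightarrow> lam (zmul k a) b = lam a b powi k"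
  using lam_zmul_right[of b a k] by (metis lam_inverse power_int_inverse)

lemma T_commute: "a \<in> grp n \<Longrightarrow> b \<in> grp n \<Longrightarrow> T a (T b m) = scale (lam a b) (T b (T a m))"
  by (simp add: T_T lam_def tau_nonzero add.commute)

text \<open>Conjugation by the unit \<open>bar a\<close>: each monomial is rescaled by a commutator
  scalar, so supports are kept. \<open>T_act\<close> is the resulting rule for moving
  \<open>T a\<close> past an algebra element.\<close>

definition conj :: "(nat \<Rightarrow> int) \<Rightarrow> ((nat \<Rightarrow> int) \<Rightarrow> 'f) \<Rightarrow> ((nat \<Rightarrow> int) \<Rightarrow> 'f)" where
  "conj a u = (\<lambda>b. lam a b * u b)"

lemma conj_supp: "a \<in> grp n \<Longrightarrow> u \<in> tga n \<Longrightarrow> conj a u b \<noteq> 0 \<longleftrightarrow> u b \<noteq> 0"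
  by (auto simp: conj_def lam_nonzero dest: tga_supp)

lemma conj_tga: "u \<in> tga r \<Longrightarrow> conj a u \<in> tga r"
  by (erule tga_same_supp) (auto simp: conj_def)

lemma T_act:
  assumes "a \<in> grp n" "u \<in> tga n"
  shows "T a (act u m) = act (conj a u) (T a m)"
proof -
  have "T a (act u m) = (\<Sum>b\<in>supp u. scale (u b) (T a (T b m)))"
    using assms by (simp add: act_expand_supp T_sum T_scale)
  also have "\<dots> = (\<Sum>b\<in>supp u. scale (conj a u b) (T b (T a m)))"
    by (rule sum.cong) (use assms in \<open>auto simp: T_commute[of a] conj_def mult.commute dest: tga_supp\<close>)
  also have "\<dots> = act (conj a u) (T a m)"
    by (rule act_expand[symmetric]) (use assms in \<open>auto simp: tga_iff conj_def\<close>)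
  finally show ?thesis .
qed

lemma T_span: "a \<in> grp n \<Longrightarrow> (\<And>x. x \<in> S \<Longrightarrow> T a x \<in> W) \<Longrightarrow> subspace W \<Longrightarrow> x \<in> span S \<Longrightarrow> T a x \<in> W"
proof -
  assume *: "a \<in> grp n" "\<And>x. x \<in> S \<Longrightarrow> T a x \<in> W" "subspace W" "x \<in> span S"
  from *(4) show "T a x \<in> W"
    by (induction rule: span_induct_alt)
      (use * in \<open>auto simp: T_zero T_add T_scale subspace_0 intro: subspace_add subspace_scale\<close>)
qed

lemma act_subspace:
  assumes "u \<in> tga n" "subspace W" "\<And>a. u a \<noteq> 0 \<Longrightarrow> T a m \<in> W"
  shows "act u m \<in> W"
  unfolding act_expand_supp[OF assms(1)]
  using assms by (intro subspace_sum subspace_scale) auto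

text \<open>\<open>T (- a)\<close> inverts \<open>T a\<close> up to a nonzero scalar, so membership
  of \<open>T a x\<close> can be pulled back to \<open>x\<close>.\<close>

lemma T_subspace_iff:
  assumes "subspace W" "a \<in> grp n" "\<And>x. x \<in> W \<Longrightarrow> T (- a) x \<in> W'" "subspace W'" "T a x \<in> W"
  shows "x \<in> W'"
proof -
  let ?k = "\<tau> (- a) a * \<tau> 0 0"
  have "scale ?k x \<in> W'"
    using assms(3)[OF assms(5)] T_uminus_T[OF assms(2)] by metis
  then have "scale (inverse ?k) (scale ?k x) \<in> W'"
    using assms(4) by (rule subspace_scale[rotated])
  then show ?thesis
    using T_uminus_T(2)[OF assms(2)] by (metis left_inverse scale_one scale_scale)
qed

end

section \<open>Leading terms and the Ore condition\<close>

lemma sum_fun_apply: "(\<Sum>i\<in>I. f i) x = (\<Sum>i\<in>I. f i x)"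
  by (induction I rule: infinite_finite_induct) auto

text \<open>The map \<open>\<theta>\<close> gives each monomial a real weight. Injectivity on
  \<open>grp r\<close> makes the term of least weight of a nonzero element of \<open>tga r\<close>
  unique, so \<open>\<theta>\<close> acts as a rank-one valuation on F * B.\<close>

locale valued_module = twisted_module n \<tau> scale act
  for n \<tau> and scale :: "'f::field \<Rightarrow> 'm::ab_group_add \<Rightarrow> 'm" and act +
  fixes r :: nat and \<theta> :: "(nat \<Rightarrow> int) \<Rightarrow> real"
  assumes r_le_n: "r \<le> n"
    and theta_add: "\<theta> (a + b) = \<theta> a + \<theta> b"
    and theta_inj: "a \<in> grp r \<Longrightarrow> \<theta> a = 0 \<Longrightarrow> a = 0"
begin

lemma theta_0 [simp]: "\<theta> 0 = 0"
  using theta_add[of 0 0] by simp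

lemma theta_uminus [simp]: "\<theta> (- a) = - \<theta> a"
  using theta_add[of a "- a"] by simp

lemma grp_r_n [simp, intro]: "a \<in> grp r \<Longrightarrow> a \<in> grp n"
  using r_le_n by (rule grp_mono)

lemma tga_r_n [simp, intro]: "u \<in> tga r \<Longrightarrow> u \<in> tga n"
  using r_le_n by (rule tga_mono)

lemma theta_eq: "a \<in> grp r \<Longrightarrow> b \<in> grp r \<Longrightarrow> \<theta> a = \<theta> b \<Longrightarrow> a = b"
  using theta_inj[of "a - b"] theta_add[of a "- b"] by simp

text \<open>\<open>LT u a\<close>: the monomial \<open>a\<close> is the unique one of least \<open>\<theta>\<close> in \<open>u\<close>. The elements with leading monomial \<open>0\<close> act as
  the units of the valuation ring of \<open>\<theta>\<close>.\<close>

definition LT :: "((nat \<Rightarrow> int) \<Rightarrow> 'f) \<Rightarrow> (nat \<Rightarrow> int) \<Rightarrow> bool" where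
  "LT u a \<longleftrightarrow> u \<in> tga r \<and> u a \<noteq> 0 \<and> (\<forall>b. u b \<noteq> 0 \<longrightarrow> b \<noteq> a \<longrightarrow> \<theta> a < \<theta> b)"

lemma LT_exists:
  assumes "u \<in> tga r" "u \<noteq> (\<lambda>_. 0)"
  obtains a where "LT u a" "a \<in> grp r"
proof -
  have "finite (supp u)" "supp u \<noteq> {}"
    using assms by (auto simp: tga_iff)
  then obtain a where a: "a \<in> supp u" "\<And>b. b \<in> supp u \<Longrightarrow> \<theta> a \<le> \<theta> b"
    using arg_min_if_finite(1)[of "supp u" \<theta>] arg_min_least[of "supp u" _ \<theta>] by blast
  have "\<theta> a < \<theta> b" if "u b \<noteq> 0" "b \<noteq> a" for b
    using a that theta_eq[of a b] assms by (force simp: tga_iff)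
  then show ?thesis
    using a assms by (intro that[of a]) (auto simp: LT_def tga_iff)
qed

lemma LT_unique: "LT u a \<Longrightarrow> LT u b \<Longrightarrow> a = b"
  unfolding LT_def by (metis less_asym)

lemma LT_grp: "LT u a \<Longrightarrow> a \<in> grp r"
  by (auto simp: LT_def dest: tga_supp)

lemma LT_nonzero: "LT u a \<Longrightarrow> u \<noteq> (\<lambda>_. 0)"
  by (auto simp: LT_def)

lemma LT_bar: "a \<in> grp r \<Longrightarrow> LT (bar a) a"
  by (auto simp: LT_def) (auto simp: bar_def split: if_splits)

text \<open>Weights add, so a pair of monomials with product \<open>a + b\<close> other than
  \<open>(a, b)\<close> would need a factor below its leading weight. The coefficient at
  \<open>a + b\<close> is thus one nonzero product; in particular F * B has no zero
  divisors.\<close>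

lemma LT_tmul:
  assumes "LT u a" "LT v b"
  shows "LT (tmul \<tau> u v) (a + b)"
proof -
  have u: "u \<in> tga r" and v: "v \<in> tga r"
    using assms by (auto simp: LT_def)
  have ab: "a \<in> grp r" "b \<in> grp r"
    using assms LT_grp by auto
  have fin: "finite (supp u)" "finite (supp v)"
    using u v by (auto simp: tga_iff)
  have le: "\<theta> a \<le> \<theta> a'" if "u a' \<noteq> 0" for a'
    using assms(1) that by (cases "a' = a") (auto simp: LT_def intro: less_imp_le)
  have le': "\<theta> b \<le> \<theta> b'" if "v b' \<noteq> 0" for b'
    using assms(2) that by (cases "b' = b") (auto simp: LT_def intro: less_imp_le)
  have "tmul \<tau> u v (a + b) = (\<Sum>a'\<in>supp u. \<tau> a' (a + b - a') * u a' * v (a + b - a'))"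
    using fin by (intro tmul_eq) auto
  also have "\<dots> = (\<Sum>a'\<in>{a}. \<tau> a' (a + b - a') * u a' * v (a + b - a'))"
  proof (rule sum.mono_neutral_right)
    show "\<forall>a'\<in>supp u - {a}. \<tau> a' (a + b - a') * u a' * v (a + b - a') = 0"
    proof
      fix a' assume a': "a' \<in> supp u - {a}"
      then have "\<theta> a < \<theta> a'"
        using assms by (auto simp: LT_def)
      moreover have "\<theta> (a + b - a') = \<theta> a + \<theta> b - \<theta> a'"
        using theta_add[of "a + b" "- a'"] theta_add[of a b] by simp
      ultimately have "v (a + b - a') = 0"
        using le'[of "a + b - a'"] by fastforce
      then show "\<tau> a' (a + b - a') * u a' * v (a + b - a') = 0"
        by simp
    qed
  qed (use fin assms in \<open>auto simp: LT_def\<close>)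
  finally have "tmul \<tau> u v (a + b) \<noteq> 0"
    using assms ab by (auto simp: LT_def tau_nonzero)
  moreover have "\<theta> (a + b) < \<theta> c" if c: "tmul \<tau> u v c \<noteq> 0" "c \<noteq> a + b" for c
  proof -
    obtain a' b' where *: "u a' \<noteq> 0" "v b' \<noteq> 0" "c = a' + b'"
      using tmul_supp[OF fin c(1)] .
    then have "a' \<noteq> a \<or> b' \<noteq> b"
      using c by auto
    then have "\<theta> a < \<theta> a' \<or> \<theta> b < \<theta> b'"
      using * assms by (auto simp: LT_def)
    then show ?thesis
      using le[OF *(1)] le'[OF *(2)] * by (auto simp: theta_add)
  qed
  ultimately show ?thesis
    using u v by (auto simp: LT_def tmul_in_tga)
qed

lemma LT_conj: "a \<in> grp n \<Longrightarrow> LT u b \<Longrightarrow> LT (conj a u) b"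
  by (auto simp: LT_def conj_tga conj_supp[OF _ tga_r_n])

text \<open>The left Ore condition: both left multiples of \<open>u\<close> and \<open>u'\<close> with coefficients in a large box live in
  a slightly larger box, which has less than twice as many elements.\<close>

lemma Ore:
  assumes u: "u \<in> tga r" "u \<noteq> (\<lambda>_. 0)" and u': "u' \<in> tga r" "u' \<noteq> (\<lambda>_. 0)"
  obtains v v' where "v \<in> tga r" "v \<noteq> (\<lambda>_. 0)" "v' \<in> tga r" "v' \<noteq> (\<lambda>_. 0)" "tmul \<tau> v u = tmul \<tau> v' u'"
proof -
  interpret fs: vector_space "\<lambda>c (u :: (nat \<Rightarrow> int) \<Rightarrow> 'f) a. c * u a"
    by (rule vector_space_functions)
  obtain s where s: "supp u \<union> supp u' \<subseteq> box r s"
    using finite_subset_box[of "supp u \<union> supp u'" r] u u' by (auto simp: tga_iff)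
  \<comment> \<open>With this size the Bernoulli inequality below gives
    \<open>(P / Q) ^ r > 1 / 2\<close>, where \<open>P\<close> and \<open>Q\<close> are the side
    lengths of the small and the large box; two copies of the small box then outnumber the large
    one.\<close>
  define k where "k = 2 * s * r"
  \<comment> \<open>The Boolean selects the factor: \<open>True\<close> stands for left multiples of
    \<open>u'\<close>, \<open>False\<close> for those of \<open>u\<close>.\<close>
  define I where "I = {False, True} \<times> box r k"
  define f where "f = (\<lambda>(\<epsilon>, b). tmul \<tau> (bar b) (if \<epsilon> then u' else u))"
  have fin: "finite (supp u)" "finite (supp u')"
    using u u' by (auto simp: tga_iff)
  have box_less: "card (bar ` box r (k + s) :: ((nat \<Rightarrow> int) \<Rightarrow> 'f) set) < card I"
  proof -
    define P Q where "P = real (2 * k + 1)" and "Q = real (2 * (k + s) + 1)"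
    have pos: "P > 0" "Q > 0"
      unfolding P_def Q_def of_nat_0_less_iff by simp_all
    have Q: "Q = P + 2 * real s" and big: "4 * (real r * real s) < Q"
      by (auto simp: P_def Q_def k_def)
    have "1 + real r * (- (2 * real s / Q)) \<le> (1 + - (2 * real s / Q)) ^ r"
      by (rule Bernoulli_inequality) (use pos Q in \<open>simp add: field_simps\<close>)
    moreover have "1 + - (2 * real s / Q) = P / Q"
      using pos Q by (simp add: field_simps)
    moreover have "real r * (2 * real s / Q) < 1 / 2"
      using pos big by (simp add: field_simps)
    ultimately have "1 / 2 < (P / Q) ^ r"
      by simp
    then have "1 / 2 < P ^ r / Q ^ r"
      by (simp only: power_divide)
    moreover have "Q ^ r > 0"
      using pos by simp
    ultimately have "Q ^ r < 2 * P ^ r"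
      by (simp add: pos_less_divide_eq)
    then have "real ((2 * (k + s) + 1) ^ r) < real (2 * (2 * k + 1) ^ r)"
      unfolding P_def Q_def by (simp only: of_nat_power of_nat_mult of_nat_numeral)
    then have "(2 * (k + s) + 1) ^ r < 2 * (2 * k + 1) ^ r"
      by (simp only: of_nat_less_iff)
    then have "card (box r (k + s)) < card I"
      by (simp add: I_def card_box card_cartesian_product)
    then show ?thesis
      using card_image_le[of "box r (k + s)" bar] by (meson finite_box le_less_trans)
  qed
  have span: "f ` I \<subseteq> fs.span (bar ` box r (k + s))"
  proof safe
    fix \<epsilon> b assume "(\<epsilon>, b) \<in> I"
    then have b: "b \<in> box r k" by (simp add: I_def)
    define w where "w = (if \<epsilon> then u' else u)"
    have w: "finite (supp w)" "supp w \<subseteq> box r s"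
      using s fin by (auto simp: w_def)
    define g where "g = tmul \<tau> (bar b) w"
    have g: "c \<in> box r (k + s)" if "g c \<noteq> 0" for c
    proof -
      have "finite (supp (bar b :: _ \<Rightarrow> 'f))" by simp
      from tmul_supp[OF this w(1) that[unfolded g_def]]
      obtain a a' where "(bar b a :: 'f) \<noteq> 0" "w a' \<noteq> 0" "c = a + a'" .
      then show ?thesis
        using b w box_add[of b r k a' s] by (auto simp: bar_def split: if_splits)
    qed
    have "g = (\<Sum>c\<in>box r (k + s). (\<lambda>x. g c * bar c x))"
    proof
      fix x
      have "(\<Sum>c\<in>box r (k + s). (\<lambda>x. g c * bar c x)) x = (\<Sum>c\<in>box r (k + s). g c * bar c x)"
        by (rule sum_fun_apply)
      also have "\<dots> = (\<Sum>c\<in>box r (k + s). if c = x then g c else 0)"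
        by (rule sum.cong) (auto simp: bar_def)
      also have "\<dots> = g x"
        using g[of x] by (subst sum.delta) auto
      finally show "g x = (\<Sum>c\<in>box r (k + s). (\<lambda>x. g c * bar c x)) x" by simp
    qed
    also have "\<dots> \<in> fs.span (bar ` box r (k + s))"
      by (intro fs.span_sum fs.span_scale fs.span_base) auto
    finally show "f (\<epsilon>, b) \<in> fs.span (bar ` box r (k + s))"
      by (simp add: f_def g_def w_def)
  qed
  obtain c where c: "\<exists>i\<in>I. c i \<noteq> 0" "(\<Sum>i\<in>I. (\<lambda>a. c i * f i a)) = 0"
    using fs.dependent_family[OF _ _ span box_less] by (auto simp: I_def)
  \<comment> \<open>The linear dependence is read as an equation by moving the multiples of
    \<open>u'\<close> to the other side; hence the sign.\<close>
  define V where "V = (\<lambda>\<epsilon> b. if b \<in> box r k then (if \<epsilon> then - c (\<epsilon>, b) else c (\<epsilon>, b)) else 0)"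
  have V: "V \<epsilon> \<in> tga r" for \<epsilon>
    by (rule tga_restrict[OF finite_box box_grp, of _ r k]) (auto simp: V_def split: if_splits)
  have tm: "tmul \<tau> (V \<epsilon>) w x = (\<Sum>b\<in>box r k. V \<epsilon> b * tmul \<tau> (bar b) w x)"
    if w: "finite (supp w)" for \<epsilon> w x
  proof -
    have "tmul \<tau> (V \<epsilon>) w x = (\<Sum>b\<in>box r k. \<tau> b (x - b) * V \<epsilon> b * w (x - b))"
      by (rule tmul_eq[OF w]) (auto simp: V_def split: if_splits)
    moreover have "tmul \<tau> (bar b) w x = (\<Sum>a\<in>{b}. \<tau> a (x - a) * bar b a * w (x - a))" for b
      by (rule tmul_eq[OF w]) auto
    ultimately show ?thesis
      by (simp add: bar_def mult_ac)
  qed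
  have eq: "tmul \<tau> (V False) u = tmul \<tau> (V True) u'"
  proof
    fix x
    have "0 = (\<Sum>i\<in>I. (\<lambda>a. c i * f i a)) x"
      using c by simp
    also have "\<dots> = (\<Sum>i\<in>I. c i * f i x)"
      by (rule sum_fun_apply)
    also have "\<dots> = (\<Sum>\<epsilon>\<in>{False, True}. \<Sum>b\<in>box r k. c (\<epsilon>, b) * f (\<epsilon>, b) x)"
      by (simp add: I_def sum.cartesian_product)
    also have "\<dots> = tmul \<tau> (V False) u x - tmul \<tau> (V True) u' x"
      by (simp add: tm[OF fin(1)] tm[OF fin(2)]) (simp add: f_def V_def sum_negf)
    finally show "tmul \<tau> (V False) u x = tmul \<tau> (V True) u' x"
      by simp
  qed
  have tmul_nz: "tmul \<tau> v w \<noteq> (\<lambda>_. 0)" if "v \<in> tga r" "v \<noteq> (\<lambda>_. 0)" "w \<in> tga r" "w \<noteq> (\<lambda>_. 0)" for v w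
    using LT_exists[OF that(1,2)] LT_exists[OF that(3,4)] LT_tmul LT_nonzero by metis
  have tmul_z: "tmul \<tau> (\<lambda>_. 0) w = (\<lambda>_. 0)" for w
    by (simp add: tmul_def)
  obtain \<epsilon> b where "c (\<epsilon>, b) \<noteq> 0" "b \<in> box r k"
    using c by (auto simp: I_def)
  then have "V \<epsilon> b \<noteq> 0"
    by (auto simp: V_def)
  then have "V False \<noteq> (\<lambda>_. 0) \<or> V True \<noteq> (\<lambda>_. 0)"
    by (cases \<epsilon>) (auto simp: fun_eq_iff)
  \<comment> \<open>One multiplier is nonzero; since the two products agree and there are no zero
    divisors, so is the other.\<close>
  then have "V False \<noteq> (\<lambda>_. 0)" "V True \<noteq> (\<lambda>_. 0)"
    using tmul_nz[OF V _ u, of False] tmul_nz[OF V _ u', of True] eq tmul_z by metis+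
  then show ?thesis
    using V eq by (intro that[of "V False" "V True"]) auto
qed

text \<open>The two products supplied by \<open>Ore\<close> agree, so both multipliers have the same
  leading monomial \<open>b\<close>; multiplication by \<open>bar (- b)\<close> moves it to
  \<open>0\<close>, as a denominator requires.\<close>

lemma Ore_act:
  assumes "LT u 0" "LT u' 0"
  obtains v v' where "LT v 0" "LT v' 0" "\<And>x. act v (act u x) = act v' (act u' x)"
proof -
  have u: "u \<in> tga r" "u' \<in> tga r"
    using assms by (auto simp: LT_def)
  obtain v v' where v: "v \<in> tga r" "v \<noteq> (\<lambda>_. 0)" "v' \<in> tga r" "v' \<noteq> (\<lambda>_. 0)" "tmul \<tau> v u = tmul \<tau> v' u'"
    using Ore[OF u(1) LT_nonzero[OF assms(1)] u(2) LT_nonzero[OF assms(2)]] .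
  obtain b where b: "LT v b"
    using LT_exists[OF v(1,2)] .
  obtain b' where b': "LT v' b'"
    using LT_exists[OF v(3,4)] .
  have "b + 0 = b' + 0"
    using LT_unique[OF LT_tmul[OF b assms(1)], of "b' + 0"] LT_tmul[OF b' assms(2)] v(5) by simp
  then have b': "LT v' b" using b' by simp
  have bg: "b \<in> grp r" using b LT_grp by auto
  then have "LT (tmul \<tau> (bar (- b)) v) 0" "LT (tmul \<tau> (bar (- b)) v') 0"
    using LT_tmul[OF LT_bar, of "- b"] b b' by fastforce+
  moreover have "act (tmul \<tau> (bar (- b)) v) (act u x) = act (tmul \<tau> (bar (- b)) v') (act u' x)" for x
  proof -
    have "act (tmul \<tau> (bar (- b)) v) (act u x) = act (bar (- b)) (act (tmul \<tau> v u) x)"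
      using bg v(1,3) u by (simp add: act_tmul)
    also have "\<dots> = act (bar (- b)) (act (tmul \<tau> v' u') x)"
      by (simp only: v(5))
    also have "\<dots> = act (tmul \<tau> (bar (- b)) v') (act u' x)"
      using bg v(1,3) u by (simp add: act_tmul)
    finally show ?thesis .
  qed
  ultimately show ?thesis
    by (rule that)
qed

end

section \<open>The lattice norm\<close>

context valued_module
begin

text \<open>Left linear independence over F * B. This ring is in general noncommutative, so the
  notion is spelled out with coefficient functions instead of being taken from a vector
  space.\<close>

definition Bindep :: "'m set \<Rightarrow> bool" where
  "Bindep G \<longleftrightarrow> (\<forall>v. (\<forall>e\<in>G. v e \<in> tga r) \<longrightarrow> (\<Sum>e\<in>G. act (v e) e) = 0 \<longrightarrow> (\<forall>e\<in>G. v e = (\<lambda>_. 0)))"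

end

locale lattice_module = valued_module n \<tau> scale act r \<theta>
  for n \<tau> and scale :: "'f::field \<Rightarrow> 'm::ab_group_add \<Rightarrow> 'm" and act r \<theta> +
  fixes G :: "'m set"
  assumes finite_G: "finite G" and G_nonempty: "G \<noteq> {}" and Bindep_G: "Bindep G"
begin

text \<open>\<open>Ge t x\<close> says that \<open>x\<close> has norm at least \<open>t\<close> with respect to the lattice spanned by \<open>G\<close>: quotients by elements of
  leading monomial \<open>0\<close> replace the localisation of \<open>F * B\<close>.\<close>

definition Lt :: "real \<Rightarrow> 'm set" where
  "Lt t = span {T b e | b e. b \<in> grp r \<and> t \<le> \<theta> b \<and> e \<in> G}"

definition Ge :: "real \<Rightarrow> 'm \<Rightarrow> bool" where
  "Ge t x \<longleftrightarrow> (\<exists>u. LT u 0 \<and> act u x \<in> Lt t)"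

lemma Lt_subspace: "subspace (Lt t)"
  by (simp add: Lt_def)

lemma Lt_mono: "t' \<le> t \<Longrightarrow> x \<in> Lt t \<Longrightarrow> x \<in> Lt t'"
  unfolding Lt_def by (erule subsetD[OF span_mono, rotated]) force

lemma T_in_Lt: "b \<in> grp r \<Longrightarrow> e \<in> G \<Longrightarrow> T b e \<in> Lt (\<theta> b)"
  unfolding Lt_def by (rule span_base) auto

lemma T_Lt:
  assumes "b \<in> grp r" "x \<in> Lt t"
  shows "T b x \<in> Lt (t + \<theta> b)"
proof (rule T_span[OF _ _ Lt_subspace])
  show "x \<in> span {T b e | b e. b \<in> grp r \<and> t \<le> \<theta> b \<and> e \<in> G}"
    using assms by (simp add: Lt_def)
  fix x assume "x \<in> {T b e | b e. b \<in> grp r \<and> t \<le> \<theta> b \<and> e \<in> G}"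
  then obtain b' e where *: "x = T b' e" "b' \<in> grp r" "t \<le> \<theta> b'" "e \<in> G"
    by auto
  then have "T (b + b') e \<in> Lt (t + \<theta> b)"
    using T_in_Lt[of "b + b'" e] assms by - (rule Lt_mono[of _ "\<theta> (b + b')"], auto simp: theta_add)
  then show "T b x \<in> Lt (t + \<theta> b)"
    using * assms by (auto simp: T_T intro: subspace_scale[OF Lt_subspace])
qed (use assms in auto)

lemma act_Lt:
  assumes "u \<in> tga r" "\<And>b. u b \<noteq> 0 \<Longrightarrow> s \<le> \<theta> b" "x \<in> Lt t"
  shows "act u x \<in> Lt (t + s)"
proof (rule act_subspace[OF _ Lt_subspace])
  fix a assume "u a \<noteq> 0"
  then show "T a x \<in> Lt (t + s)"
    using T_Lt[of a x t] assms tga_supp[of u r a] by - (rule Lt_mono[of _ "t + \<theta> a"], auto)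
qed (use assms in auto)

lemma LT_act_Lt: "LT u 0 \<Longrightarrow> x \<in> Lt t \<Longrightarrow> act u x \<in> Lt t"
proof -
  assume u: "LT u 0" and x: "x \<in> Lt t"
  have "0 \<le> \<theta> b" if "u b \<noteq> 0" for b
    using u that by (cases "b = 0") (auto simp: LT_def intro: less_imp_le)
  then show ?thesis
    using act_Lt[of u 0 x t] u x by (simp add: LT_def)
qed

lemma LT_0_act_tmul: "LT u 0 \<Longrightarrow> LT v 0 \<Longrightarrow> LT (tmul \<tau> u v) 0 \<and> act (tmul \<tau> u v) x = act u (act v x)"
  using LT_tmul[of u 0 v 0] act_tmul[of u v x] by (simp add: LT_def)

lemma LT_0_bar: "LT (bar 0) 0"
  by (rule LT_bar) simp

lemma Ge_Lt: "x \<in> Lt t \<Longrightarrow> Ge t x"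
  unfolding Ge_def using LT_0_bar LT_act_Lt[OF LT_0_bar, of x t] by (intro exI[of _ "bar 0"] conjI)

lemma Ge_mono: "t' \<le> t \<Longrightarrow> Ge t x \<Longrightarrow> Ge t' x"
  unfolding Ge_def using Lt_mono by blast

text \<open>Sums are the point: \<open>Ore_act\<close> brings two vectors to a common denominator,
  and elements with leading monomial \<open>0\<close> preserve each \<open>Lt t\<close>.\<close>

lemma Ge_subspace: "subspace {x. Ge t x}"
  unfolding subspace_def mem_Collect_eq
proof (intro conjI ballI allI)
  show "Ge t 0"
    by (rule Ge_Lt) (simp add: subspace_0[OF Lt_subspace])
next
  fix x y assume "x \<in> {x. Ge t x}" "y \<in> {x. Ge t x}"
  then obtain u u' where u: "LT u 0" "act u x \<in> Lt t" "LT u' 0" "act u' y \<in> Lt t"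
    by (auto simp: Ge_def)
  obtain v v' where v: "LT v 0" "LT v' 0" "\<And>x. act v (act u x) = act v' (act u' x)"
    by (rule Ore_act[OF u(1,3)]) (rule that)
  have "act (tmul \<tau> v u) (x + y) = act v (act u x) + act v' (act u' y)"
    using u v LT_0_act_tmul[of v u] by (auto simp: LT_def act_add)
  also have "\<dots> \<in> Lt t"
    by (rule subspace_add[OF Lt_subspace LT_act_Lt[OF v(1) u(2)] LT_act_Lt[OF v(2) u(4)]])
  finally show "Ge t (x + y)"
    using LT_0_act_tmul[OF v(1) u(1)] unfolding Ge_def by (intro exI[of _ "tmul \<tau> v u"] conjI) auto
next
  fix c x assume "x \<in> {x. Ge t x}"
  then obtain u where u: "LT u 0" "act u x \<in> Lt t"
    by (auto simp: Ge_def)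
  then have "act u (scale c x) \<in> Lt t"
    by (auto simp: LT_def act_scale intro: subspace_scale[OF Lt_subspace])
  then show "Ge t (scale c x)"
    using u by (auto simp: Ge_def)
qed

lemma Ge_0: "Ge t 0"
  using subspace_0[OF Ge_subspace] by simp

lemma Ge_scale: "Ge t x \<Longrightarrow> Ge t (scale c x)"
  using subspace_scale[OF Ge_subspace] by simp

lemma Ge_add: "Ge t x \<Longrightarrow> Ge t y \<Longrightarrow> Ge t (x + y)"
  using subspace_add[OF Ge_subspace] by simp

lemma Ge_T:
  assumes "b \<in> grp r" "Ge t x"
  shows "Ge (t + \<theta> b) (T b x)"
proof -
  obtain u where u: "LT u 0" "act u x \<in> Lt t"
    using assms by (auto simp: Ge_def)
  then have "act (conj b u) (T b x) \<in> Lt (t + \<theta> b)"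
    using T_Lt[OF assms(1) u(2)] assms T_act[of b u x] by (auto simp: LT_def)
  then show ?thesis
    using LT_conj[OF _ u(1), of b] assms by (auto simp: Ge_def)
qed

lemma Ge_cancel:
  assumes "LT u 0" "Ge t (act u x)"
  shows "Ge t x"
proof -
  obtain v where v: "LT v 0" "act v (act u x) \<in> Lt t"
    using assms(2) by (auto simp: Ge_def)
  then show ?thesis
    unfolding Ge_def using LT_0_act_tmul[OF v(1) assms(1), of x] by (intro exI[of _ "tmul \<tau> v u"]) simp
qed

definition opge :: "(nat \<Rightarrow> int) \<Rightarrow> real \<Rightarrow> bool" where
  "opge a t \<longleftrightarrow> (\<forall>e\<in>G. Ge t (T a e))"

text \<open>A bound on the vectors of \<open>G\<close> controls all vectors: \<open>T a\<close>
  passes each \<open>T b\<close> up to a scalar and turns the denominator \<open>u\<close> into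
  \<open>conj a u\<close>, which \<open>Ge_cancel\<close> removes.\<close>

lemma Ge_T_opge:
  assumes "a \<in> grp n" "opge a t" "Ge s x"
  shows "Ge (s + t) (T a x)"
proof -
  obtain u where u: "LT u 0" "act u x \<in> Lt s"
    using assms by (auto simp: Ge_def)
  have "T a (act u x) \<in> {x. Ge (s + t) x}"
  proof (rule T_span[OF assms(1) _ Ge_subspace u(2)[unfolded Lt_def]])
    fix x assume "x \<in> {T b e | b e. b \<in> grp r \<and> s \<le> \<theta> b \<and> e \<in> G}"
    then obtain b e where *: "x = T b e" "b \<in> grp r" "s \<le> \<theta> b" "e \<in> G"
      by auto
    then have "Ge (t + \<theta> b) (T b (T a e))"
      using assms by (intro Ge_T) (auto simp: opge_def)
    then have "Ge (s + t) (T b (T a e))"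
      by (rule Ge_mono[rotated]) (use *(3) in simp)
    then show "T a x \<in> {x. Ge (s + t) x}"
      using * assms by (simp add: T_commute[of a b] Ge_scale)
  qed
  then have "Ge (s + t) (act (conj a u) (T a x))"
    using T_act[of a u x] assms u by (auto simp: LT_def)
  then show ?thesis
    by (rule Ge_cancel[OF LT_conj[OF assms(1) u(1)]])
qed

lemma opge_mono: "t' \<le> t \<Longrightarrow> opge a t \<Longrightarrow> opge a t'"
  unfolding opge_def using Ge_mono by blast

lemma opge_add:
  assumes "a \<in> grp n" "b \<in> grp n" "opge a s" "opge b t"
  shows "opge (a + b) (s + t)"
proof -
  have "Ge (t + s) (T a (T b e))" if "e \<in> G" for e
    using assms that by (intro Ge_T_opge) (auto simp: opge_def)
  then show ?thesis
    using assms by (auto simp: opge_def T_plus add.commute intro!: Ge_scale)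
qed

lemma opge_grp: "b \<in> grp r \<Longrightarrow> opge b (\<theta> b)"
  by (auto simp: opge_def intro!: Ge_Lt T_in_Lt)

lemma Lt_repr:
  assumes "x \<in> Lt t"
  shows "\<exists>v. (\<forall>e\<in>G. v e \<in> tga r \<and> (\<forall>b. v e b \<noteq> 0 \<longrightarrow> t \<le> \<theta> b)) \<and> x = (\<Sum>e\<in>G. act (v e) e)"
  using assms unfolding Lt_def
proof (induction rule: span_induct_alt)
  case base
  show ?case
    by (intro exI[of _ "\<lambda>_ _. 0"]) (auto simp: act_zero)
next
  case (step c x y)
  then obtain v b e0 where v: "\<forall>e\<in>G. v e \<in> tga r \<and> (\<forall>b. v e b \<noteq> 0 \<longrightarrow> t \<le> \<theta> b)" "y = (\<Sum>e\<in>G. act (v e) e)"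
    and b: "x = T b e0" "b \<in> grp r" "t \<le> \<theta> b" "e0 \<in> G"
    by auto
  define w where "w = (\<lambda>a. c * bar b a + v e0 a)"
  have bar: "bar b \<in> tga n" using b by auto
  have w: "w \<in> tga r" "\<forall>a. w a \<noteq> 0 \<longrightarrow> t \<le> \<theta> a"
    using v b unfolding w_def by (auto intro!: tga_add tga_scale) (auto simp: bar_def split: if_splits)
  have "act w e0 = scale c x + act (v e0) e0"
    unfolding w_def act_plus[OF tga_scale[OF bar] tga_r_n[OF bspec[OF v(1) b(4), THEN conjunct1]]]
      act_times[OF bar] using b by (simp add: T_def)
  then have "(\<Sum>e\<in>G. act ((v(e0 := w)) e) e) = (scale c x + act (v e0) e0) + (\<Sum>e\<in>G - {e0}. act (v e) e)"
    using finite_G b by (subst sum.remove[of _ e0]) (auto intro!: arg_cong2[where f = "(+)"] sum.cong)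
  also have "\<dots> = scale c x + y"
    using finite_G b v by (simp add: sum.remove[of G e0] add.assoc)
  finally show ?case
    using v w by (intro exI[of _ "v(e0 := w)"]) auto
qed

text \<open>Nondegeneracy of the norm, where independence of \<open>G\<close> enters. If
  \<open>e\<close> in \<open>G\<close> had positive norm, some \<open>act u e\<close> with
  \<open>u 0\<close> nonzero would be a combination of \<open>G\<close> involving only positive
  weights; comparing the coefficients of \<open>e\<close> at the monomial \<open>0\<close> is
  contradictory.\<close>

lemma opge_0_le:
  assumes "opge 0 t"
  shows "t \<le> 0"
proof (rule ccontr)
  assume t: "\<not> t \<le> 0"
  obtain e where e: "e \<in> G" using G_nonempty by blast
  have "Ge t (scale (inverse (\<tau> 0 0)) (T 0 e))"
    using assms e by (auto simp: opge_def intro!: Ge_scale)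
  then have "Ge t e"
    using tau_nonzero[of 0 0] by (simp add: T_0)
  then obtain u where u: "LT u 0" "act u e \<in> Lt t"
    by (auto simp: Ge_def)
  then obtain v where v: "\<forall>e\<in>G. v e \<in> tga r \<and> (\<forall>b. v e b \<noteq> 0 \<longrightarrow> t \<le> \<theta> b)" "act u e = (\<Sum>e\<in>G. act (v e) e)"
    using Lt_repr by blast
  \<comment> \<open>The coefficient of \<open>e\<close> in the relation obtained by subtracting the
    lattice representation from \<open>act u e\<close>.\<close>
  define w where "w = (\<lambda>a. u a + (- 1) * v e a)"
  have ut: "u \<in> tga r" using u by (simp add: LT_def)
  have w: "w \<in> tga r"
    unfolding w_def using ut v e by (intro tga_add tga_scale) auto
  have ve: "v e \<in> tga n" using v e by auto
  have "act w e = act u e - act (v e) e"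
    unfolding w_def act_plus[OF tga_r_n[OF ut] tga_scale[OF ve]] act_times[OF ve] by simp
  have neg: "act (\<lambda>a. - 1 * v e' a) e' = - act (v e') e'" if "e' \<in> G" for e'
    using act_times[of "v e'" "- 1" e'] v that by auto
  have "(\<Sum>e'\<in>G. act (((\<lambda>e' a. - 1 * v e' a)(e := w)) e') e') = act w e + (\<Sum>e'\<in>G - {e}. - act (v e') e')"
    using finite_G e by (subst sum.remove[of _ e]) (auto intro!: arg_cong2[where f = "(+)"] sum.cong simp: neg[simplified])
  also have "\<dots> = act u e - (\<Sum>e\<in>G. act (v e) e)"
    using finite_G e \<open>act w e = _\<close> by (simp add: sum.remove[of G e] sum_negf)
  also have "\<dots> = 0" using v by simp
  finally have sum0: "(\<Sum>e'\<in>G. act (((\<lambda>e' a. - 1 * v e' a)(e := w)) e') e') = 0" .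
  have "((\<lambda>e' a. - 1 * v e' a)(e := w)) e' \<in> tga r" if "e' \<in> G" for e'
    using v(1) w that tga_scale[of "v e'" r "- 1"] by auto
  then have "((\<lambda>e' a. - 1 * v e' a)(e := w)) e = (\<lambda>_. 0)"
    using Bindep_G[unfolded Bindep_def, rule_format, OF _ sum0] e by blast
  then have "w 0 = 0"
    by simp
  then have "v e 0 \<noteq> 0"
    using u by (auto simp: w_def LT_def)
  then show False
    using v e t by force
qed

lemma act_in_Lt:
  assumes "v \<in> tga r" "e \<in> G"
  shows "\<exists>t. act v e \<in> Lt t"
proof -
  have "\<exists>t. \<forall>b\<in>supp v. t \<le> \<theta> b"
    using assms by (intro exI[of _ "Min (\<theta> ` supp v)"]) (auto simp: tga_iff)
  then obtain t where t: "\<forall>b\<in>supp v. t \<le> \<theta> b" by blast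
  have "act v e \<in> Lt t"
  proof (rule act_subspace[OF _ Lt_subspace])
    fix b assume "v b \<noteq> 0"
    then show "T b e \<in> Lt t"
      using t assms T_in_Lt[of b e] tga_supp[of v r b] by - (rule Lt_mono[of t "\<theta> b"], auto)
  qed (use assms in auto)
  then show ?thesis ..
qed

lemma sum_act_in_Lt:
  assumes "finite H" "H \<subseteq> G" "\<forall>e\<in>H. v e \<in> tga r"
  shows "\<exists>t. (\<Sum>e\<in>H. act (v e) e) \<in> Lt t"
  using assms
proof (induction H rule: finite_induct)
  case empty
  then show ?case by (auto intro: subspace_0[OF Lt_subspace])
next
  case (insert e H)
  then obtain t where t: "(\<Sum>e\<in>H. act (v e) e) \<in> Lt t" by auto
  obtain t' where t': "act (v e) e \<in> Lt t'"
    using act_in_Lt[of "v e" e] insert by auto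
  have "act (v e) e + (\<Sum>e\<in>H. act (v e) e) \<in> Lt (min t t')"
    by (rule subspace_add[OF Lt_subspace Lt_mono[OF _ t'] Lt_mono[OF _ t]]) simp_all
  then show ?case
    using insert by auto
qed

section \<open>Vectors whose norm is not minus infinity\<close>

definition Fin :: "'m \<Rightarrow> bool" where "Fin x \<longleftrightarrow> (\<exists>t. Ge t x)"

lemma Fin_subspace: "subspace {x. Fin x}"
  unfolding subspace_def mem_Collect_eq
proof (intro conjI ballI allI)
  fix x y assume "x \<in> {x. Fin x}" "y \<in> {x. Fin x}"
  then obtain s t where st: "Ge s x" "Ge t y" by (auto simp: Fin_def)
  have "Ge (min s t) (x + y)"
    by (rule Ge_add[OF Ge_mono[OF _ st(1)] Ge_mono[OF _ st(2)]]) simp_all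
  then show "Fin (x + y)" by (auto simp: Fin_def)
qed (auto simp: Fin_def intro: Ge_0 Ge_scale)

lemma Fin_T: "b \<in> grp r \<Longrightarrow> Fin x \<Longrightarrow> Fin (T b x)"
  by (auto simp: Fin_def dest: Ge_T)

text \<open>Multiplication by \<open>bar (- b)\<close> turns any nonzero \<open>g\<close> into a
  denominator, so dividing by \<open>g\<close> shifts norm bounds only by a finite amount.\<close>

lemma Fin_cancel:
  assumes "g \<in> tga r" "g \<noteq> (\<lambda>_. 0)" "Fin (act g x)"
  shows "Fin x"
proof -
  obtain b where b: "LT g b" "b \<in> grp r"
    using LT_exists[OF assms(1,2)] .
  have "LT (tmul \<tau> (bar (- b)) g) 0"
    using LT_tmul[OF LT_bar b(1), of "- b"] b by simp
  moreover have "Fin (act (tmul \<tau> (bar (- b)) g) x)"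
    using Fin_T[OF _ assms(3), of "- b"] b assms by (simp add: act_tmul T_def)
  ultimately show ?thesis
    by (auto simp: Fin_def dest: Ge_cancel)
qed

end

section \<open>Superadditive functions\<close>

locale superadditive =
  fixes n :: nat and \<rho> :: "(nat \<Rightarrow> int) \<Rightarrow> real"
  assumes super: "a \<in> grp n \<Longrightarrow> b \<in> grp n \<Longrightarrow> \<rho> a + \<rho> b \<le> \<rho> (a + b)"
    and homog: "a \<in> grp n \<Longrightarrow> \<rho> (zmul (int k) a) = real k * \<rho> a"
begin

lemma rho_0: "\<rho> 0 = 0"
  using homog[of 0 0] by simp

lemma rho_uminus: "a \<in> grp n \<Longrightarrow> \<rho> a + \<rho> (- a) \<le> 0"
  using super[of a "- a"] rho_0 by simp

end

text \<open>The directional derivative at \<open>z\<close> of a concave homogeneous function. By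
  superadditivity the differences increase with \<open>t\<close> and are bounded by
  \<open>- \<rho> (- a)\<close>; the limit inherits both properties and is odd at
  \<open>z\<close>.\<close>

lemma (in superadditive) derivative:
  assumes z: "z \<in> grp n"
  obtains \<rho>' where "superadditive n \<rho>'" "\<And>a. a \<in> grp n \<Longrightarrow> \<rho> a \<le> \<rho>' a" "\<rho>' z + \<rho>' (- z) = 0"
    "\<And>a. a \<in> grp n \<Longrightarrow> (\<lambda>t. \<rho> (zmul (int t) z + a) - real t * \<rho> z) \<longlonglongrightarrow> \<rho>' a"
proof -
  define X where "X = (\<lambda>a (t :: nat). \<rho> (zmul (int t) z + a) - real t * \<rho> z)"
  have Suc: "zmul (int (Suc t)) z + a = z + (zmul (int t) z + a)" for t a
    using zmul_add_left[of 1 "int t" z] by (simp add: add.assoc)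
  have inc: "incseq (X a)" if a: "a \<in> grp n" for a
  proof (rule incseq_SucI)
    fix t
    have "\<rho> z + \<rho> (zmul (int t) z + a) \<le> \<rho> (zmul (int (Suc t)) z + a)"
      unfolding Suc using a z by (intro super) auto
    then show "X a t \<le> X a (Suc t)"
      by (simp add: X_def algebra_simps)
  qed
  have bnd: "X a t \<le> - \<rho> (- a)" if a: "a \<in> grp n" for a t
  proof -
    have "\<rho> (zmul (int t) z + a) + \<rho> (- a) \<le> \<rho> (zmul (int t) z + a + - a)"
      using a z by (intro super) auto
    also have "\<dots> = real t * \<rho> z"
      using z by (simp add: homog)
    finally show ?thesis by (simp add: X_def)
  qed
  define \<rho>' where "\<rho>' = (\<lambda>a. lim (X a))"
  have lim: "X a \<longlonglongrightarrow> \<rho>' a" if a: "a \<in> grp n" for a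
  proof -
    obtain L where "X a \<longlonglongrightarrow> L"
      using incseq_convergent[OF inc[OF a], of "- \<rho> (- a)"] bnd[OF a] by blast
    then show ?thesis
      unfolding \<rho>'_def by (simp add: limI)
  qed
  have ge: "\<rho> a \<le> \<rho>' a" if a: "a \<in> grp n" for a
    using incseq_le[OF inc[OF a] lim[OF a], of 0] by (simp add: X_def)
  have super': "\<rho>' a + \<rho>' b \<le> \<rho>' (a + b)" if ab: "a \<in> grp n" "b \<in> grp n" for a b
  proof (rule LIMSEQ_le)
    show "(\<lambda>t. X a t + X b t) \<longlonglongrightarrow> \<rho>' a + \<rho>' b"
      by (intro tendsto_add lim ab)
    \<comment> \<open>Two points with parameter \<open>t\<close> add up to one with parameter
      \<open>2 * t\<close>, so the limit is taken along even parameters.\<close>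
    show "(\<lambda>t. X (a + b) (2 * t)) \<longlonglongrightarrow> \<rho>' (a + b)"
      using LIMSEQ_subseq_LIMSEQ[OF lim[of "a + b"], of "\<lambda>t. 2 * t"] ab
      by (auto simp: strict_mono_def o_def)
    have "X a t + X b t \<le> X (a + b) (2 * t)" for t
    proof -
      have "\<rho> (zmul (int t) z + a) + \<rho> (zmul (int t) z + b) \<le> \<rho> ((zmul (int t) z + a) + (zmul (int t) z + b))"
        using ab z by (intro super) auto
      also have "(zmul (int t) z + a) + (zmul (int t) z + b) = zmul (int (2 * t)) z + (a + b)"
        using zmul_add_left[of "int t" "int t" z] by (simp add: algebra_simps)
      finally have "\<rho> (zmul (int t) z + a) + \<rho> (zmul (int t) z + b) \<le> \<rho> (zmul (int (2 * t)) z + (a + b))" .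
      moreover have "real (2 * t) * \<rho> z = real t * \<rho> z + real t * \<rho> z"
        by simp
      ultimately show ?thesis
        unfolding X_def by linarith
    qed
    then show "\<exists>N. \<forall>t\<ge>N. X a t + X b t \<le> X (a + b) (2 * t)" by blast
  qed
  have homog': "\<rho>' (zmul (int k) a) = real k * \<rho>' a" if a: "a \<in> grp n" for k a
  proof (cases "k = 0")
    case True
    have "X 0 t = 0" for t
      using z by (simp add: X_def homog)
    then have "X 0 = (\<lambda>_. 0)"
      by (rule ext)
    then have "\<rho>' 0 = 0"
      using LIMSEQ_unique[OF lim[OF grp_0], of 0] by (simp only: tendsto_const)
    then show ?thesis
      by (simp only: True zmul_simps of_nat_0 mult_zero_left)
  next
    case False
    \<comment> \<open>Scaling by \<open>k\<close> sends the parameter \<open>t\<close> to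
      \<open>k * t\<close>; this is a subsequence only for positive \<open>k\<close>, hence the case
      split.\<close>
    have "(\<lambda>t. X (zmul (int k) a) (k * t)) \<longlonglongrightarrow> \<rho>' (zmul (int k) a)"
      using LIMSEQ_subseq_LIMSEQ[OF lim[of "zmul (int k) a"], of "\<lambda>t. k * t"] a False
      by (auto simp: strict_mono_def o_def)
    moreover have "X (zmul (int k) a) (k * t) = real k * X a t" for t
    proof -
      have "zmul (int (k * t)) z + zmul (int k) a = zmul (int k) (zmul (int t) z + a)"
        by (simp add: zmul_add_right zmul_zmul)
      then have "X (zmul (int k) a) (k * t) = \<rho> (zmul (int k) (zmul (int t) z + a)) - real (k * t) * \<rho> z"
        by (simp only: X_def)
      also have "\<dots> = real k * \<rho> (zmul (int t) z + a) - real (k * t) * \<rho> z"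
        using z a by (subst homog) auto
      finally show ?thesis
        by (simp add: X_def algebra_simps)
    qed
    moreover have "(\<lambda>t. real k * X a t) \<longlonglongrightarrow> real k * \<rho>' a"
      by (intro tendsto_intros lim a)
    ultimately show ?thesis
      using LIMSEQ_unique by simp
  qed
  have "\<rho>' (- z) \<ge> - \<rho> z"
  proof -
    \<comment> \<open>At \<open>t = 1\<close> the argument \<open>z + (- z)\<close> vanishes, and
      the limit dominates every term of an increasing sequence.\<close>
    have "X (- z) 1 \<le> \<rho>' (- z)"
      using z by (intro incseq_le[OF inc lim]) auto
    then show ?thesis
      using rho_0 by (simp add: X_def)
  qed
  moreover have "\<rho>' 0 = 0"
    using homog'[of 0 0] by simp
  ultimately have "\<rho>' z + \<rho>' (- z) = 0"
    using ge[OF z] super'[of z "- z"] z by simp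
  moreover have "superadditive n \<rho>'"
    by unfold_locales (auto intro: super' homog')
  ultimately show ?thesis
    using ge lim by (intro that[of \<rho>']) (auto simp: X_def)
qed

text \<open>Derivatives along all \<open>gen j\<close> in turn make the function odd on each
  generator, hence additive. The last conclusion survives because finitely many strict inequalities
  between limits already hold at some finite stage.\<close>

lemma (in superadditive) additive_dominating:
  obtains \<phi> where "\<And>a b. a \<in> grp n \<Longrightarrow> b \<in> grp n \<Longrightarrow> \<phi> (a + b) = \<phi> a + \<phi> b"
    "\<And>a. a \<in> grp n \<Longrightarrow> \<rho> a \<le> \<phi> a"
    "\<And>Q. finite Q \<Longrightarrow> Q \<subseteq> grp n \<Longrightarrow> \<forall>q\<in>Q. \<phi> q > 0 \<Longrightarrow> \<exists>z\<in>grp n. \<forall>q\<in>Q. \<rho> z < \<rho> (z + q)"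
proof -
  \<comment> \<open>Any finite set of strict inequalities between values of \<open>\<sigma>\<close>
    becomes true of \<open>\<rho>\<close> after one common translation. This form, unlike mere
    positivity, composes under iterated limits.\<close>
  define S where "S = (\<lambda>\<sigma> :: (nat \<Rightarrow> int) \<Rightarrow> real. \<forall>Q. finite Q \<longrightarrow> Q \<subseteq> grp n \<times> grp n \<longrightarrow> (\<forall>(a, b)\<in>Q. \<sigma> b < \<sigma> a)
    \<longrightarrow> (\<exists>z\<in>grp n. \<forall>(a, b)\<in>Q. \<rho> (z + b) < \<rho> (z + a)))"
  have "\<exists>\<sigma>. superadditive n \<sigma> \<and> (\<forall>a\<in>grp n. \<rho> a \<le> \<sigma> a) \<and> (\<forall>j<J. \<sigma> (gen j) + \<sigma> (- gen j) = 0) \<and> S \<sigma>"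
    if "J \<le> n" for J
    using that
  proof (induction J)
    case 0
    have "S \<rho>"
      unfolding S_def by (auto intro!: bexI[of _ 0])
    then show ?case
      using superadditive_axioms by auto
  next
    case (Suc J)
    from Suc.IH[OF Suc_leD[OF Suc.prems]] obtain \<sigma> where \<sigma>: "superadditive n \<sigma>" "\<forall>a\<in>grp n. \<rho> a \<le> \<sigma> a"
      "\<forall>j<J. \<sigma> (gen j) + \<sigma> (- gen j) = 0" "S \<sigma>"
      by blast
    interpret s: superadditive n \<sigma> by (rule \<sigma>)
    have z: "gen J \<in> grp n" using Suc by auto
    obtain \<sigma>' where \<sigma>': "superadditive n \<sigma>'" "\<And>a. a \<in> grp n \<Longrightarrow> \<sigma> a \<le> \<sigma>' a" "\<sigma>' (gen J) + \<sigma>' (- gen J) = 0"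
      and lim: "\<And>a. a \<in> grp n \<Longrightarrow> (\<lambda>t. \<sigma> (zmul (int t) (gen J) + a) - real t * \<sigma> (gen J)) \<longlonglongrightarrow> \<sigma>' a"
      using s.derivative[OF z] by blast
    interpret s': superadditive n \<sigma>' by (rule \<sigma>')
    have "\<sigma>' (gen j) + \<sigma>' (- gen j) = 0" if "j < Suc J" for j
    proof (cases "j = J")
      \<comment> \<open>Earlier oddness persists: the new function dominates the old one at
        \<open>gen j\<close> and at \<open>- gen j\<close>, and by superadditivity its two values
        there add up to at most zero.\<close>
      case False
      then have "\<sigma> (gen j) + \<sigma> (- gen j) = 0" "gen j \<in> grp n"
        using that \<sigma> Suc by auto
      then show ?thesis
        using \<sigma>'(2)[of "gen j"] \<sigma>'(2)[of "- gen j"] s'.rho_uminus[of "gen j"] by auto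
    qed (use \<sigma>' in simp)
    moreover have "S \<sigma>'"
      unfolding S_def
    proof (intro allI impI)
      fix Q assume Q: "finite Q" "Q \<subseteq> grp n \<times> grp n" "\<forall>(a, b)\<in>Q. \<sigma>' b < \<sigma>' a"
      have "\<forall>\<^sub>F t in sequentially. \<forall>p\<in>Q. \<sigma> (zmul (int t) (gen J) + snd p) < \<sigma> (zmul (int t) (gen J) + fst p)"
      proof (subst eventually_ball_finite_distrib[OF Q(1)], intro ballI)
        fix p assume p: "p \<in> Q"
        then have "\<sigma>' (snd p) < \<sigma>' (fst p)" "fst p \<in> grp n" "snd p \<in> grp n"
          using Q by auto
        then have "\<forall>\<^sub>F t in sequentially. 0 < (\<sigma> (zmul (int t) (gen J) + fst p) - real t * \<sigma> (gen J))
            - (\<sigma> (zmul (int t) (gen J) + snd p) - real t * \<sigma> (gen J))"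
          by (intro order_tendstoD(1)[OF tendsto_diff[OF lim lim]]) auto
        then show "\<forall>\<^sub>F t in sequentially. \<sigma> (zmul (int t) (gen J) + snd p) < \<sigma> (zmul (int t) (gen J) + fst p)"
          by (rule eventually_mono) simp
      qed
      then obtain t where t: "\<forall>p\<in>Q. \<sigma> (zmul (int t) (gen J) + snd p) < \<sigma> (zmul (int t) (gen J) + fst p)"
        by (auto simp: eventually_sequentially)
      define w where "w = zmul (int t) (gen J)"
      have w: "w \<in> grp n" using z by (auto simp: w_def)
      have "\<exists>z\<in>grp n. \<forall>(a, b)\<in>(\<lambda>(a, b). (w + a, w + b)) ` Q. \<rho> (z + b) < \<rho> (z + a)"
        using \<sigma>(4)[unfolded S_def, rule_format, of "(\<lambda>(a, b). (w + a, w + b)) ` Q"] Q t w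
        by (fastforce simp: w_def[symmetric])
      then obtain z where z: "z \<in> grp n" "\<And>a b. (a, b) \<in> Q \<Longrightarrow> \<rho> (z + (w + b)) < \<rho> (z + (w + a))"
        by force
      then show "\<exists>z\<in>grp n. \<forall>(a, b)\<in>Q. \<rho> (z + b) < \<rho> (z + a)"
        using w by (intro bexI[of _ "z + w"]) (auto simp: add.assoc)
    qed
    ultimately show ?case
      using \<sigma>' \<sigma>(2) by (meson order_trans)
  qed
  from this[OF order_refl] obtain \<phi> where \<phi>: "superadditive n \<phi>" "\<forall>a\<in>grp n. \<rho> a \<le> \<phi> a"
    "\<forall>j<n. \<phi> (gen j) + \<phi> (- gen j) = 0" "S \<phi>"
    by blast
  interpret p: superadditive n \<phi> by (rule \<phi>)
  \<comment> \<open>Where \<open>\<phi>\<close> is odd, superadditivity at \<open>a, b\<close> and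
    at \<open>- a, - b\<close> together gives additivity. The set of such elements is a subgroup
    containing all generators.\<close>
  define H where "H = {a \<in> grp n. \<phi> a + \<phi> (- a) = 0}"
  have H_add: "a + b \<in> H" if "a \<in> H" "b \<in> H" for a b
    using that p.super[of a b] p.super[of "- a" "- b"] p.rho_uminus[of "a + b"] by (auto simp: H_def)
  have H_uminus: "- a \<in> H" if "a \<in> H" for a
    using that by (auto simp: H_def add.commute)
  have H_0: "0 \<in> H"
    by (simp add: H_def p.rho_0)
  have H_sum: "sum f I \<in> H" if "\<And>i. i \<in> I \<Longrightarrow> f i \<in> H" for f :: "nat \<Rightarrow> nat \<Rightarrow> int" and I
    using that by (induction I rule: infinite_finite_induct) (auto intro: H_0 H_add)
  have H_zmul: "zmul k a \<in> H" if "a \<in> H" for k a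
  proof -
    have nat: "zmul (int k) a \<in> H" for k
    proof (induction k)
      case (Suc k)
      have "zmul (int (Suc k)) a = a + zmul (int k) a"
        using zmul_add_left[of 1 "int k" a] by simp
      then show ?case
        using Suc that H_add by (simp only:)
    qed (use H_0 in \<open>simp only: zmul_simps of_nat_0\<close>)
    then show ?thesis
      using H_uminus by (cases k rule: int_cases2) (auto simp: zmul_uminus_left)
  qed
  have H_all: "a \<in> H" if a: "a \<in> grp n" for a
  proof -
    have "a = (\<Sum>j<n. zmul (a j) (gen j))"
    proof
      fix i
      have "(\<Sum>j<n. zmul (a j) (gen j)) i = (\<Sum>j<n. zmul (a j) (gen j) i)"
        by (rule sum_fun_apply)
      also have "\<dots> = (\<Sum>j<n. if j = i then a j else 0)"
        by (rule sum.cong) (auto simp: zmul_apply gen_def)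
      also have "\<dots> = a i"
        using a by (subst sum.delta) (auto simp: grp_def)
      finally show "a i = (\<Sum>j<n. zmul (a j) (gen j)) i" by simp
    qed
    also have "\<dots> \<in> H"
      using \<phi>(3) by (intro H_sum H_zmul) (auto simp: H_def)
    finally show ?thesis .
  qed
  have "\<phi> (a + b) = \<phi> a + \<phi> b" if "a \<in> grp n" "b \<in> grp n" for a b
    using p.super[of a b] p.super[of "- a" "- b"] H_all[of a] H_all[of b] H_all[of "a + b"] that
    by (auto simp: H_def)
  moreover have "\<exists>z\<in>grp n. \<forall>q\<in>Q. \<rho> z < \<rho> (z + q)"
    if "finite Q" "Q \<subseteq> grp n" "\<forall>q\<in>Q. \<phi> q > 0" for Q
    \<comment> \<open>The pairs \<open>(q, 0)\<close> encode positivity, as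
      \<open>\<phi> 0 = 0\<close>.\<close>
    using \<phi>(4)[unfolded S_def, rule_format, of "(\<lambda>q. (q, 0)) ` Q"] that p.rho_0 by fastforce
  ultimately show ?thesis
    using \<phi>(2) by (intro that[of \<phi>]) auto
qed

section \<open>Spectral radii\<close>

context lattice_module
begin

text \<open>\<open>opge a t\<close> says that \<open>T a\<close> raises norms by at least \<open>t\<close>, so \<open>rho a\<close> is the logarithmic spectral radius of \<open>T a\<close>.\<close>

definition rho :: "(nat \<Rightarrow> int) \<Rightarrow> real" where
  "rho a = Sup {t / real k | t k. k \<ge> 1 \<and> opge (zmul (int k) a) t}"

lemma opge_0: "opge 0 0"
  using opge_grp[of 0] by (simp only: theta_0 grp_0)

lemma opge_zmul:
  assumes "a \<in> grp n" "opge a t"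
  shows "opge (zmul (int k) a) (real k * t)"
proof (induction k)
  case 0
  show ?case using opge_0 by (simp only: zmul_simps of_nat_0 mult_zero_left)
next
  case (Suc k)
  have "zmul (int (Suc k)) a = a + zmul (int k) a"
    using zmul_add_left[of 1 "int k" a] by simp
  moreover have "real (Suc k) * t = t + real k * t"
    by (simp add: algebra_simps)
  ultimately show ?case
    using opge_add[of a "zmul (int k) a" t "real k * t"] assms Suc by (simp only: grp_zmul)
qed

lemma opge_sum:
  assumes "finite I" "\<And>i. i \<in> I \<Longrightarrow> f i \<in> grp n" "\<And>i. i \<in> I \<Longrightarrow> opge (f i) (t i)"
  shows "opge (sum f I) (sum t I)"
  using assms
proof (induction I rule: finite_induct)
  case empty
  show ?case using opge_0 by (simp only: sum.empty)
next
  case (insert i I)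
  then have "opge (f i + sum f I) (t i + sum t I)"
    by (intro opge_add grp_sum) auto
  then show ?case
    by (simp only: sum.insert[OF insert.hyps])
qed

end

locale bounded_lattice_module = lattice_module n \<tau> scale act r \<theta> G
  for n \<tau> and scale :: "'f::field \<Rightarrow> 'm::ab_group_add \<Rightarrow> 'm" and act r \<theta> G +
  assumes opge_exists: "a \<in> grp n \<Longrightarrow> \<exists>t. opge a t"
begin

text \<open>The supremum needs an upper bound: a bound \<open>t0\<close> for \<open>- a\<close>
  combines with any bound at exponent \<open>k\<close> into one for \<open>T 0\<close>, and
  \<open>opge_0_le\<close> then caps the quotient by \<open>- t0\<close>.\<close>

lemma rho_ge:
  assumes "a \<in> grp n" "k \<ge> 1" "opge (zmul (int k) a) t"
  shows "t / real k \<le> rho a"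
  unfolding rho_def
proof (rule cSup_upper)
  show "t / real k \<in> {t / real k | t k. k \<ge> 1 \<and> opge (zmul (int k) a) t}"
    using assms by auto
  obtain t0 where t0: "opge (- a) t0"
    using opge_exists[of "- a"] assms by auto
  have "t / real k \<le> - t0" if *: "k \<ge> 1" "opge (zmul (int k) a) t" for t k
  proof -
    have "opge (zmul (int k) (- a)) (real k * t0)"
      using assms t0 by (intro opge_zmul) auto
    then have "opge (zmul (int k) a + zmul (int k) (- a)) (t + real k * t0)"
      using assms * by (intro opge_add) auto
    moreover have "zmul (int k) a + zmul (int k) (- a) = 0"
      by (simp flip: zmul_add_right)
    ultimately have "t + real k * t0 \<le> 0"
      using opge_0_le by (simp only:)
    then show ?thesis
      using * by (simp add: field_simps)
  qed
  then show "bdd_above {t / real k | t k. k \<ge> 1 \<and> opge (zmul (int k) a) t}"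
    by (auto simp: bdd_above_def)
qed

lemma rho_approx:
  assumes "a \<in> grp n" "s < rho a"
  obtains k where "k \<ge> 1" "opge (zmul (int k) a) (real k * s)"
proof -
  obtain t where "opge a t"
    using opge_exists assms by auto
  then have "t / real 1 \<in> {t / real k | t k. k \<ge> 1 \<and> opge (zmul (int k) a) t}"
    by (intro CollectI exI[of _ t] exI[of _ 1]) auto
  then have "{t / real k | t k. k \<ge> 1 \<and> opge (zmul (int k) a) t} \<noteq> {}"
    by blast
  from less_cSupD[OF this assms(2)[unfolded rho_def]]
  obtain t k where k: "k \<ge> 1" "opge (zmul (int k) a) t" "s < t / real k"
    by auto
  then have "opge (zmul (int k) a) (real k * s)"
    by (intro opge_mono[OF _ k(2)]) (simp add: field_simps)
  then show ?thesis
    using k that by blast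
qed

lemma rho_0: "rho 0 = 0"
proof (rule antisym)
  show "rho 0 \<le> 0"
  proof (rule ccontr)
    assume "\<not> rho 0 \<le> 0"
    then have "rho 0 / 2 < rho 0" "rho 0 > 0" by auto
    then obtain k where "k \<ge> 1" "opge (zmul (int k) 0) (real k * (rho 0 / 2))"
      using rho_approx[OF grp_0] by blast
    then have "real k * (rho 0 / 2) \<le> 0"
      using opge_0_le by (simp only: zmul_simps)
    then show False
      using \<open>k \<ge> 1\<close> \<open>rho 0 > 0\<close> by (simp add: mult_le_0_iff)
  qed
  show "0 \<le> rho 0"
    using rho_ge[of 0 1 0] opge_0 by simp
qed

text \<open>Near-optimal exponents \<open>k\<close> for \<open>a\<close> and \<open>k'\<close> for
  \<open>b\<close> are raised to the common exponent \<open>k * k'\<close>, where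
  \<open>opge_add\<close> adds the bounds.\<close>

lemma rho_super:
  assumes ab: "a \<in> grp n" "b \<in> grp n"
  shows "rho a + rho b \<le> rho (a + b)"
proof (rule field_le_epsilon)
  fix \<epsilon> :: real assume "\<epsilon> > 0"
  define s s' where "s = rho a - \<epsilon> / 2" and "s' = rho b - \<epsilon> / 2"
  have "s < rho a" "s' < rho b"
    using \<open>\<epsilon> > 0\<close> by (auto simp: s_def s'_def)
  then obtain k k' where k: "k \<ge> 1" "opge (zmul (int k) a) (real k * s)"
    and k': "k' \<ge> 1" "opge (zmul (int k') b) (real k' * s')"
    using rho_approx ab by metis
  have "opge (zmul (int k') (zmul (int k) a)) (real k' * (real k * s))"
    "opge (zmul (int k) (zmul (int k') b)) (real k * (real k' * s'))"
    using k k' ab by (auto intro!: opge_zmul)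
  then have "opge (zmul (int k') (zmul (int k) a) + zmul (int k) (zmul (int k') b))
      (real k' * (real k * s) + real k * (real k' * s'))"
    using ab by (intro opge_add) auto
  moreover have "zmul (int k') (zmul (int k) a) + zmul (int k) (zmul (int k') b) = zmul (int (k * k')) (a + b)"
    by (simp add: zmul_zmul zmul_add_right mult.commute)
  moreover have "real k' * (real k * s) + real k * (real k' * s') = real (k * k') * (s + s')"
    by (simp add: algebra_simps)
  ultimately have "opge (zmul (int (k * k')) (a + b)) (real (k * k') * (s + s'))"
    by (simp only:)
  moreover have "k * k' \<ge> 1"
    using k k' by simp
  ultimately have "real (k * k') * (s + s') / real (k * k') \<le> rho (a + b)"
    using ab by (intro rho_ge) auto
  then have "s + s' \<le> rho (a + b)"
    using \<open>k * k' \<ge> 1\<close> k k' by (simp del: plus_fun_apply)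
  then show "rho a + rho b \<le> rho (a + b) + \<epsilon>"
    unfolding s_def s'_def by linarith
qed

lemma rho_homog:
  assumes a: "a \<in> grp n"
  shows "rho (zmul (int k) a) = real k * rho a"
proof (cases "k = 0")
  case True
  then show ?thesis
    using rho_0 by (simp only: zmul_simps of_nat_0 mult_zero_left)
next
  case False
  then have k: "k \<ge> 1" "real k > 0" by auto
  show ?thesis
  proof (rule antisym)
    show "rho (zmul (int k) a) \<le> real k * rho a"
    proof (rule dense_le)
      fix s assume "s < rho (zmul (int k) a)"
      then obtain j where j: "j \<ge> 1" "opge (zmul (int j) (zmul (int k) a)) (real j * s)"
        using rho_approx[of "zmul (int k) a"] a by blast
      then have "opge (zmul (int (j * k)) a) (real j * s)"
        by (simp add: zmul_zmul)
      then have "real j * s / real (j * k) \<le> rho a"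
        using j k a by (intro rho_ge) auto
      then show "s \<le> real k * rho a"
        using j k by (simp add: field_simps)
    qed
    show "real k * rho a \<le> rho (zmul (int k) a)"
    proof (rule dense_le)
      fix s assume "s < real k * rho a"
      then have "s / real k < rho a"
        using k by (simp add: field_simps)
      then obtain j where j: "j \<ge> 1" "opge (zmul (int j) a) (real j * (s / real k))"
        using rho_approx[OF a] by blast
      have "opge (zmul (int k) (zmul (int j) a)) (real k * (real j * (s / real k)))"
        by (rule opge_zmul[OF grp_zmul[OF a] j(2)])
      moreover have "zmul (int k) (zmul (int j) a) = zmul (int j) (zmul (int k) a)"
        by (simp add: zmul_zmul mult.commute)
      moreover have "real k * (real j * (s / real k)) = real j * s"
        using k by simp
      ultimately have "opge (zmul (int j) (zmul (int k) a)) (real j * s)"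
        by (simp only:)
      then have "real j * s / real j \<le> rho (zmul (int k) a)"
        using j a by (intro rho_ge) auto
      then show "s \<le> rho (zmul (int k) a)"
        using j by simp
    qed
  qed
qed

sublocale superadditive n rho
  by unfold_locales (auto intro: rho_super rho_homog)

text \<open>A single exponent \<open>K\<close> with growth rate \<open>\<kappa>\<close> suffices:
  after dividing \<open>k\<close> by \<open>K\<close>, the remainder costs only a constant
  independent of \<open>k\<close>.\<close>

lemma opge_linear_growth:
  assumes a: "a \<in> grp n" and \<kappa>: "\<kappa> < rho a"
  obtains c where "\<And>k. opge (zmul (int k) a) (real k * \<kappa> - c)"
proof -
  obtain K where K: "K \<ge> 1" "opge (zmul (int K) a) (real K * \<kappa>)"
    using rho_approx[OF a \<kappa>] .
  obtain t where t: "opge a t"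
    using opge_exists a by auto
  have "opge (zmul (int k) a) (real k * \<kappa> - real K * (\<bar>\<kappa>\<bar> + \<bar>t\<bar>))" for k
  proof -
    define d m where "d = k div K" and "m = k mod K"
    have k: "k = d * K + m" "m < K"
      using K by (auto simp: d_def m_def)
    have "opge (zmul (int d) (zmul (int K) a)) (real d * (real K * \<kappa>))" "opge (zmul (int m) a) (real m * t)"
      using K t a by (auto intro!: opge_zmul)
    then have "opge (zmul (int d) (zmul (int K) a) + zmul (int m) a) (real d * (real K * \<kappa>) + real m * t)"
      using a by (intro opge_add) auto
    moreover have "zmul (int d) (zmul (int K) a) + zmul (int m) a = zmul (int k) a"
      unfolding k by (simp add: zmul_zmul zmul_add_left)
    ultimately have 1: "opge (zmul (int k) a) (real d * (real K * \<kappa>) + real m * t)"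
      by (simp only:)
    have "real m * \<kappa> \<le> real K * \<bar>\<kappa>\<bar>" "real m * (- t) \<le> real K * \<bar>t\<bar>"
      using k(2) by (intro order_trans[OF mult_left_mono[OF abs_ge_self] mult_right_mono]
          order_trans[OF mult_left_mono[OF abs_ge_minus_self] mult_right_mono]; simp)+
    then show ?thesis
      by (intro opge_mono[OF _ 1]) (simp add: k(1) algebra_simps)
  qed
  then show ?thesis by (rule that)
qed

text \<open>If every \<open>e\<close> in \<open>G\<close> were a combination of translates \<open>T q e\<close> with \<open>\<phi> q > 0\<close>, then iterating these relations
  would make the powers of a suitable \<open>z\<close> grow faster than \<open>rho z\<close> allows.\<close>

lemma initial_form_proper:
  obtains \<phi> e where "\<And>a b. a \<in> grp n \<Longrightarrow> b \<in> grp n \<Longrightarrow> \<phi> (a + b) = \<phi> a + \<phi> b"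
    "\<And>b. b \<in> grp r \<Longrightarrow> \<phi> b = \<theta> b" "e \<in> G" "e \<notin> span ((\<lambda>a. T a e) ` {a \<in> grp n. \<phi> a > 0})"
proof -
  obtain \<phi> where \<phi>: "\<And>a b. a \<in> grp n \<Longrightarrow> b \<in> grp n \<Longrightarrow> \<phi> (a + b) = \<phi> a + \<phi> b"
    "\<And>a. a \<in> grp n \<Longrightarrow> rho a \<le> \<phi> a"
    "\<And>Q. finite Q \<Longrightarrow> Q \<subseteq> grp n \<Longrightarrow> \<forall>q\<in>Q. \<phi> q > 0 \<Longrightarrow> \<exists>z\<in>grp n. \<forall>q\<in>Q. rho z < rho (z + q)"
    by (rule additive_dominating) (rule that)
  have ge: "\<theta> b \<le> \<phi> b" if b: "b \<in> grp r" for b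
    using rho_ge[of b 1 "\<theta> b"] opge_grp[OF b] \<phi>(2)[of b] b by simp
  have "\<phi> 0 = 0"
    using \<phi>(1)[of 0 0] by simp
  \<comment> \<open>The inequality at \<open>b\<close> and at \<open>- b\<close> forces equality,
    both functions being odd on \<open>grp r\<close>.\<close>
  then have eq: "\<phi> b = \<theta> b" if b: "b \<in> grp r" for b
    using ge[OF b] ge[of "- b"] \<phi>(1)[of b "- b"] b by simp
  have "\<exists>e\<in>G. e \<notin> span ((\<lambda>a. T a e) ` {a \<in> grp n. \<phi> a > 0})"
  proof (rule ccontr)
    assume "\<not> ?thesis"
    then have "\<forall>e\<in>G. \<exists>u. u \<in> tga n \<and> supp u \<subseteq> {a \<in> grp n. \<phi> a > 0} \<and> e = act u e"
      using span_imp_act[of _ _ "{a \<in> grp n. \<phi> a > 0}"] by blast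
    from bchoice[OF this] obtain u where u0: "\<forall>e\<in>G. u e \<in> tga n \<and> supp (u e) \<subseteq> {a \<in> grp n. \<phi> a > 0} \<and> e = act (u e) e" ..
    have u: "u e \<in> tga n" "supp (u e) \<subseteq> {a \<in> grp n. \<phi> a > 0}" "act (u e) e = e" if "e \<in> G" for e
      using bspec[OF u0 that] by auto
    define Q where "Q = (\<Union>e\<in>G. supp (u e))"
    have Q: "finite Q" "Q \<subseteq> grp n" "\<forall>q\<in>Q. \<phi> q > 0"
      using finite_G u by (auto simp: Q_def tga_iff)
    obtain z where z: "z \<in> grp n" "\<And>q. q \<in> Q \<Longrightarrow> rho z < rho (z + q)"
      using \<phi>(3)[OF Q] by blast
    have zq: "z + q \<in> grp n" if "q \<in> Q" for q
      using z Q that by auto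
    \<comment> \<open>The entry \<open>rho z + 1\<close> keeps the minimum meaningful for empty
      \<open>Q\<close>.\<close>
    define \<mu> where "\<mu> = Min (insert (rho z + 1) ((\<lambda>q. rho (z + q)) ` Q))"
    have "rho z < \<mu>" and \<mu>: "\<And>q. q \<in> Q \<Longrightarrow> \<mu> \<le> rho (z + q)"
      using Q z by (auto simp: \<mu>_def)
    then obtain \<kappa> where \<kappa>: "rho z < \<kappa>" "\<And>q. q \<in> Q \<Longrightarrow> \<kappa> < rho (z + q)"
      using dense[of "rho z" \<mu>] by force
    have "\<forall>q\<in>Q. \<exists>c. \<forall>k. opge (zmul (int k) (z + q)) (real k * \<kappa> - c)"
    proof
      fix q assume q: "q \<in> Q"
      obtain c where "\<And>k. opge (zmul (int k) (z + q)) (real k * \<kappa> - c)"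
        using opge_linear_growth[OF zq[OF q] \<kappa>(2)[OF q]] by blast
      then show "\<exists>c. \<forall>k. opge (zmul (int k) (z + q)) (real k * \<kappa> - c)"
        by blast
    qed
    from bchoice[OF this] obtain c where c: "\<forall>q\<in>Q. \<forall>k. opge (zmul (int k) (z + q)) (real k * \<kappa> - c q)" ..
    \<comment> \<open>Sums of \<open>k\<close> exponents of the form \<open>z + q\<close>,
      repetitions allowed. Each summand gains \<open>\<kappa>\<close>, up to one constant for each
      \<open>q\<close>.\<close>
    define X where "X = (\<lambda>k. {\<Sum>q\<in>Q. zmul (int (l q)) (z + q) | l. (\<Sum>q\<in>Q. l q) = (k :: nat)})"
    have X_grp: "x \<in> grp n" if "x \<in> X k" for x k
      using that zq by (auto simp: X_def intro!: grp_sum)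
    have X_opge: "opge x (real k * \<kappa> - sum c Q)" if x: "x \<in> X k" for x k
    proof -
      obtain l where l: "x = (\<Sum>q\<in>Q. zmul (int (l q)) (z + q))" "(\<Sum>q\<in>Q. l q) = k"
        using x by (auto simp: X_def)
      have "opge x (\<Sum>q\<in>Q. real (l q) * \<kappa> - c q)"
        unfolding l(1) using Q zq c by (intro opge_sum) auto
      moreover have "(\<Sum>q\<in>Q. real (l q) * \<kappa> - c q) = real k * \<kappa> - sum c Q"
        by (simp add: sum_subtractf sum_distrib_right flip: l(2))
      ultimately show ?thesis by (simp only:)
    qed
    have X_Suc: "z + x + q \<in> X (Suc k)" if x: "x \<in> X k" and q: "q \<in> Q" for x q k
    proof -
      obtain l where l: "x = (\<Sum>q\<in>Q. zmul (int (l q)) (z + q))" "(\<Sum>q\<in>Q. l q) = k"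
        using x by (auto simp: X_def)
      let ?l = "l(q := Suc (l q))"
      have "(\<Sum>q\<in>Q. ?l q) = Suc (l q) + (\<Sum>q\<in>Q - {q}. l q)"
        using Q q by (subst sum.remove[of _ q]) (auto intro!: sum.cong)
      also have "\<dots> = Suc k"
        using Q q l(2) by (simp add: sum.remove[of Q q])
      finally have 1: "(\<Sum>q\<in>Q. ?l q) = Suc k" .
      have "(\<Sum>q\<in>Q. zmul (int (?l q)) (z + q)) = zmul (int (Suc (l q))) (z + q) + (\<Sum>q\<in>Q - {q}. zmul (int (l q)) (z + q))"
        using Q q by (subst sum.remove[of _ q]) (auto intro!: arg_cong2[where f = "(+)"] sum.cong)
      also have "zmul (int (Suc (l q))) (z + q) = (z + q) + zmul (int (l q)) (z + q)"
        using zmul_add_left[of 1 "int (l q)" "z + q"] by simp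
      also have "(z + q) + zmul (int (l q)) (z + q) + (\<Sum>q\<in>Q - {q}. zmul (int (l q)) (z + q))
          = (z + q) + (\<Sum>q\<in>Q. zmul (int (l q)) (z + q))"
        by (simp only: add.assoc sum.remove[OF Q(1) q])
      finally have "z + x + q = (\<Sum>q\<in>Q. zmul (int (?l q)) (z + q))"
        unfolding l(1) by (simp only: add_ac)
      then show ?thesis
        unfolding X_def using 1 by blast
    qed
    \<comment> \<open>Each further factor \<open>T z\<close> is paired with one more use of
      \<open>e = act (u e) e\<close>, which replaces \<open>z + x\<close> by exponents
      \<open>z + x + q\<close> from \<open>X (Suc k)\<close>.\<close>
    have in_span: "T (zmul (int k) z) e \<in> span ((\<lambda>x. T x e) ` X k)" if e: "e \<in> G" for e k
    proof (induction k)
      case 0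
      have "(\<Sum>q\<in>Q. zmul (int 0) (z + q)) \<in> X 0"
        unfolding X_def by (intro CollectI exI[of _ "\<lambda>_. 0"]) auto
      then have "0 \<in> X 0"
        by (simp only: of_nat_0 zmul_simps sum.neutral_const)
      then show ?case
        unfolding of_nat_0 zmul_simps by (intro span_base imageI)
    next
      case (Suc k)
      have "T z (T (zmul (int k) z) e) \<in> span ((\<lambda>x. T x e) ` X (Suc k))"
      proof (rule T_span[OF z(1) _ subspace_span Suc])
        fix y assume "y \<in> (\<lambda>x. T x e) ` X k"
        then obtain x where x: "y = T x e" "x \<in> X k" by auto
        have xg: "x \<in> grp n" "z + x \<in> grp n"
          using X_grp x z by auto
        have "T (z + x) (act (u e) e) \<in> span ((\<lambda>x. T x e) ` X (Suc k))"
        proof (rule T_span[OF xg(2) _ subspace_span])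
          show "act (u e) e \<in> span ((\<lambda>a. T a e) ` supp (u e))"
            using u e by (intro act_in_span) auto
          fix y assume "y \<in> (\<lambda>a. T a e) ` supp (u e)"
          then obtain q where q: "y = T q e" "q \<in> Q"
            using e by (auto simp: Q_def)
          have "T (z + x + q) e \<in> span ((\<lambda>x. T x e) ` X (Suc k))"
            using X_Suc x q by (intro span_base) auto
          moreover have "q \<in> grp n"
            using q Q by blast
          ultimately show "T (z + x) y \<in> span ((\<lambda>x. T x e) ` X (Suc k))"
            unfolding q(1) using T_T[OF xg(2), of q e] span_scale by (simp only:)
        qed
        then have "T (z + x) e \<in> span ((\<lambda>x. T x e) ` X (Suc k))"
          using u(3)[OF e] by simp
        then show "T z y \<in> span ((\<lambda>x. T x e) ` X (Suc k))"
          unfolding x(1) using T_T[OF z(1) xg(1), of e] span_scale by (simp only:)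
      qed
      moreover have "zmul (int (Suc k)) z = z + zmul (int k) z"
        using zmul_add_left[of 1 "int k" z] by simp
      ultimately show ?case
        using T_plus[OF z(1) grp_zmul[OF z(1)], of "int k" e] span_scale by (simp only:)
    qed
    \<comment> \<open>Hence powers of \<open>T z\<close> gain at the rate \<open>\<kappa>\<close>,
      above \<open>rho z\<close>; a large \<open>k\<close> absorbs the constant and gives the
      contradiction.\<close>
    have "opge (zmul (int k) z) (real k * \<kappa> - sum c Q)" for k
      unfolding opge_def
    proof
      fix e assume e: "e \<in> G"
      have "span ((\<lambda>x. T x e) ` X k) \<subseteq> {x. Ge (real k * \<kappa> - sum c Q) x}"
        using X_opge e by (intro span_minimal Ge_subspace) (auto simp: opge_def)
      then show "Ge (real k * \<kappa> - sum c Q) (T (zmul (int k) z) e)"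
        using in_span[OF e] by blast
    qed
    then have bound: "(real k * \<kappa> - sum c Q) / real k \<le> rho z" if "k \<ge> 1" for k
      using rho_ge z that by blast
    obtain k :: nat where k: "\<bar>sum c Q\<bar> / (\<kappa> - rho z) < real k"
      using reals_Archimedean2 by blast
    then have "real k > 0"
      using \<kappa>(1) by (meson abs_ge_zero diff_gt_0_iff_gt divide_nonneg_pos le_less_trans)
    moreover have "sum c Q < real k * (\<kappa> - rho z)"
      using k \<kappa>(1) by (simp add: field_simps)
    ultimately have "rho z < (real k * \<kappa> - sum c Q) / real k"
      by (simp add: field_simps)
    then show False
      using bound[of k] \<open>real k > 0\<close> by simp
  qed
  then show ?thesis
    using \<phi>(1) eq by (auto intro: that)
qed

end

section \<open>Relations from the Gelfand-Kirillov dimension\<close>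

text \<open>The subgroup generated by B and \<open>gen j\<close>, of rank \<open>r + 1\<close> when
  \<open>r \<le> j\<close>.\<close>

definition line :: "nat \<Rightarrow> nat \<Rightarrow> (nat \<Rightarrow> int) set" where
  "line r j = {b + zmul i (gen j) | b i. b \<in> grp r}"

lemma line_coord: "r \<le> j \<Longrightarrow> b \<in> grp r \<Longrightarrow> (b + zmul i (gen j)) j = i"
  by (simp add: grp_def zmul_apply gen_def)

context twisted_module
begin

text \<open>Subtracting the vector of signs moves every nonzero coordinate one step towards zero, so
  \<open>K\<close> factors from the unit cube reach any exponent of size at most \<open>K\<close>.
  The scalar absorbs cocycle values.\<close>

lemma monomial_in_words:
  assumes "a \<in> box n K"
  shows "\<exists>\<alpha>. \<alpha> \<noteq> 0 \<and> (\<lambda>x. \<alpha> * bar a x) \<in> words \<tau> (insert (tunit \<tau>) (bar ` box n 1)) K"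
  using assms
proof (induction K arbitrary: a)
  case 0
  then have "a = 0"
    by (auto simp: box_def grp_def fun_eq_iff not_less) (meson not_less)
  then show ?case
    unfolding words.simps tunit_eq using nonzero_imp_inverse_nonzero[OF tau_nonzero[OF grp_0 grp_0]] by blast
next
  case (Suc K)
  define s where "s = (\<lambda>i. sgn (a i))"
  have s: "s \<in> box n 1"
    using Suc.prems by (auto simp: s_def box_def grp_def)
  have as: "a - s \<in> box n K"
    using Suc.prems by (auto simp: s_def box_def grp_def sgn_if)
  then obtain \<alpha> where \<alpha>: "\<alpha> \<noteq> 0" "(\<lambda>x. \<alpha> * bar (a - s) x) \<in> words \<tau> (insert (tunit \<tau>) (bar ` box n 1)) K"
    using Suc.IH by blast
  have "tmul \<tau> (bar s) (\<lambda>x. \<alpha> * bar (a - s) x) = (\<lambda>x. \<alpha> * \<tau> s (a - s) * bar a x)"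
    using tmul_monomials[of \<tau> 1 s \<alpha> "a - s"] by simp
  moreover have "tmul \<tau> (bar s) (\<lambda>x. \<alpha> * bar (a - s) x) \<in> words \<tau> (insert (tunit \<tau>) (bar ` box n 1)) (Suc K)"
    using \<alpha> s by auto
  moreover have "\<alpha> * \<tau> s (a - s) \<noteq> 0"
    using \<alpha>(1) tau_nonzero[of s "a - s"] s as box_grp[of n] by auto
  ultimately show ?case
    by metis
qed

lemma finite_words: "finite S \<Longrightarrow> finite (words \<tau> S K)"
proof (induction K)
  case (Suc K)
  have "words \<tau> S (Suc K) = (\<lambda>(s, p). tmul \<tau> s p) ` (S \<times> words \<tau> S K)"
    by auto
  then show ?case using Suc by simp
qed simp

text \<open>The cube of size \<open>K\<close> contains at least \<open>(2 * K + 1) ^ (r + 1)\<close>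
  exponents of \<open>line r j\<close>, whose translates of \<open>w\<close> lie in the space
  counted at length \<open>K\<close>. Were the dimension always at least this number, the growth
  exponent would be at least \<open>r + 1\<close>.\<close>

lemma gkdim_relation:
  assumes gk: "gkdim n \<tau> scale act \<le> ereal (real r)" and j: "r \<le> j" "j < n"
  obtains f where "f \<in> tga n" "f \<noteq> (\<lambda>_. 0)" "supp f \<subseteq> line r j" "act f w = 0"
proof -
  define S where "S = insert (tunit \<tau>) (bar ` box n 1)"
  define X where "X = (\<lambda>K. {act p t | p t. p \<in> words \<tau> S K \<and> t \<in> {w}})"
  define Y where "Y = (\<lambda>K. (\<lambda>(b, i). b + zmul i (gen j)) ` (box r K \<times> {- int K..int K}))"
  have S: "finite S" "S \<subseteq> tga n" "tunit \<tau> \<in> S"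
    unfolding S_def by (auto simp: tunit_eq intro!: tga_scale dest: box_grp[THEN subsetD])
  have finX: "finite (X K)" for K
    using finite_words[OF S(1), of K] by (simp add: X_def)
  have inj: "inj_on (\<lambda>(b, i). b + zmul i (gen j)) (box r K \<times> {- int K..int K})" for K
  proof (rule inj_onI, clarify)
    fix b b' :: "nat \<Rightarrow> int" and i i' :: int
    assume *: "b \<in> box r K" "b' \<in> box r K" "b + zmul i (gen j) = b' + zmul i' (gen j)"
    have "i = i'"
      using line_coord[OF j(1), of b i] line_coord[OF j(1), of b' i'] * by (simp only: box_grp[THEN subsetD])
    then show "b = b' \<and> i = i'"
      using * by simp
  qed
  have cardY: "card (Y K) = (2 * K + 1) ^ Suc r" for K
  proof -
    have "card (Y K) = card (box r K \<times> {- int K..int K})"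
      unfolding Y_def by (rule card_image[OF inj])
    also have "\<dots> = (2 * K + 1) ^ r * card {- int K..int K}"
      by (simp only: card_cartesian_product card_box)
    also have "card {- int K..int K} = 2 * K + 1"
      by simp
    finally show ?thesis by simp
  qed
  have finY: "finite (Y K)" for K
    by (simp add: Y_def)
  have Y_line: "Y K \<subseteq> line r j" for K
    by (auto simp: Y_def line_def box_def)
  have Y_box: "Y K \<subseteq> box n K" for K
  proof
    fix y assume "y \<in> Y K"
    then obtain b i where y: "y = b + zmul i (gen j)" "b \<in> box r K" "\<bar>i\<bar> \<le> int K"
      by (auto simp: Y_def abs_le_iff)
    have "\<bar>y k\<bar> \<le> int K" for k
    proof (cases "k = j")
      case True
      then show ?thesis
        using y j by (simp add: box_def grp_def zmul_apply gen_def)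
    next
      case False
      then have "y k = b k"
        using y by (simp add: zmul_apply gen_def)
      then show ?thesis
        using y by (cases "k < r") (auto simp: box_def grp_def not_less)
    qed
    moreover have "y \<in> grp n"
      using y j grp_mono[of r n b] by (auto simp: box_def)
    ultimately show "y \<in> box n K"
      by (simp add: box_def)
  qed
  have "\<exists>K. dim (X K) < card (Y K)"
  proof (rule ccontr)
    assume "\<not> ?thesis"
    then have dim: "(2 * K + 1) ^ Suc r \<le> dim (X K)" for K
      using cardY by (simp add: not_less)
    have "\<forall>\<^sub>F K in sequentially. ereal (real (Suc r)) \<le> ereal (ln (real (dim (X K))) / ln (real K))"
      unfolding eventually_sequentially
    proof (intro exI allI impI)
      \<comment> \<open>From \<open>2\<close> on, \<open>ln (real K)\<close> is positive and may be
        divided by.\<close>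
      fix K :: nat assume K: "K \<ge> 2"
      have "K ^ Suc r \<le> (2 * K + 1) ^ Suc r"
        by (rule power_mono) auto
      then have "K ^ Suc r \<le> dim (X K)"
        using dim[of K] by linarith
      then have le: "real K ^ Suc r \<le> real (dim (X K))"
        by (metis of_nat_le_iff of_nat_power)
      have "real (Suc r) * ln (real K) = ln (real K ^ Suc r)"
        using K by (simp only: ln_realpow)
      also have "\<dots> \<le> ln (real (dim (X K)))"
        by (rule ln_mono[OF le]) (use K in simp)
      finally have "real (Suc r) \<le> ln (real (dim (X K))) / ln (real K)"
        using K by (subst pos_le_divide_eq) auto
      then show "ereal (real (Suc r)) \<le> ereal (ln (real (dim (X K))) / ln (real K))"
        by simp
    qed
    then have "ereal (real (Suc r)) \<le> limsup (\<lambda>K. ereal (ln (real (dim (X K))) / ln (real K)))"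
      by (intro le_Limsup) auto
    also have "\<dots> \<le> gkdim n \<tau> scale act"
      unfolding gkdim_def X_def by (rule Sup_upper) (use S in blast)
    also have "\<dots> \<le> ereal (real r)" by (rule gk)
    finally show False by simp
  qed
  then obtain K where K: "dim (X K) < card (Y K)" by blast
  obtain B where B: "B \<subseteq> X K" "independent B" "X K \<subseteq> span B" "card B = dim (X K)"
    using basis_exists by blast
  have "T y w \<in> span B" if y: "y \<in> Y K" for y
  proof -
    obtain \<alpha> where \<alpha>: "\<alpha> \<noteq> 0" "(\<lambda>x. \<alpha> * bar y x) \<in> words \<tau> S K"
      using monomial_in_words[OF subsetD[OF Y_box y]] unfolding S_def by (elim exE conjE)
    have bar: "bar y \<in> tga n"
      using subsetD[OF Y_box y] box_grp by blast
    have "act (\<lambda>x. \<alpha> * bar y x) w \<in> X K"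
      unfolding X_def using \<alpha>(2) by blast
    then have "scale \<alpha> (T y w) \<in> span B"
      using subsetD[OF B(3)] unfolding T_def act_times[OF bar, of \<alpha> w] by blast
    then have "scale (inverse \<alpha>) (scale \<alpha> (T y w)) \<in> span B"
      by (rule span_scale)
    then show ?thesis
      using \<alpha> by simp
  qed
  then obtain c where c: "\<exists>y\<in>Y K. c y \<noteq> 0" "(\<Sum>y\<in>Y K. scale (c y) (T y w)) = 0"
    using dependent_family[OF finY finite_subset[OF B(1) finX], of "\<lambda>y. T y w" K] B(4) K by auto
  define f where "f = (\<lambda>y. if y \<in> Y K then c y else 0)"
  have Yg: "Y K \<subseteq> grp n"
    using Y_box by (auto simp: box_def)
  have "f \<in> tga n"
    by (rule tga_restrict[OF finY Yg]) (auto simp: f_def split: if_splits)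
  moreover have "f \<noteq> (\<lambda>_. 0)"
    using c(1) by (auto simp: f_def fun_eq_iff)
  moreover have "supp f \<subseteq> line r j"
    using Y_line by (auto simp: f_def split: if_splits)
  moreover have "act f w = 0"
  proof -
    have "act f w = (\<Sum>y\<in>Y K. scale (f y) (T y w))"
      by (rule act_expand[OF finY Yg]) (auto simp: f_def split: if_splits)
    also have "\<dots> = (\<Sum>y\<in>Y K. scale (c y) (T y w))"
      by (rule sum.cong) (auto simp: f_def)
    finally show ?thesis using c by simp
  qed
  ultimately show ?thesis by (rule that)
qed

end

section \<open>Two-sided recurrences over the integers\<close>

lemma int_window_induct:
  fixes P :: "int \<Rightarrow> bool" and s :: int
  assumes up: "\<And>i. (\<forall>k. i \<le> k \<longrightarrow> k < i + s \<longrightarrow> P k) \<Longrightarrow> P (i + s)"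
    and down: "\<And>i. (\<forall>k. i < k \<longrightarrow> k \<le> i + s \<longrightarrow> P k) \<Longrightarrow> P i"
    and start: "\<And>k. 0 \<le> k \<Longrightarrow> k < s \<Longrightarrow> P k"
    and s: "s \<ge> 1"
  shows "P i"
proof -
  have "\<forall>k. - int N \<le> k \<longrightarrow> k < s + int N \<longrightarrow> P k" for N
  proof (induction N)
    case 0
    then show ?case using start by auto
  next
    case (Suc N)
    have 1: "P (int N + s)"
      by (rule up) (use Suc s in auto)
    have 2: "P (- int (Suc N))"
      by (rule down) (use Suc s in auto)
    show ?case
    proof (intro allI impI)
      fix k assume k: "- int (Suc N) \<le> k" "k < s + int (Suc N)"
      consider "k = - int (Suc N)" | "k = int N + s" | "- int N \<le> k" "k < s + int N"
        using k by fastforce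
      then show "P k"
        using 1 2 Suc by cases auto
    qed
  qed
  from this[of "nat \<bar>i\<bar>"] show ?thesis
    using s by auto
qed

text \<open>\<open>E\<close> holds the exponents of a recurrence solvable for any one of its terms.
  Solving for the top or the bottom term extends a window of \<open>s\<close> consecutive indices by
  one in either direction, because the spread of \<open>E\<close> is below \<open>s\<close>.\<close>

lemma int_relation_induct:
  fixes P :: "int \<Rightarrow> bool" and s :: int
  assumes E: "finite E" "E \<noteq> {}"
    and step: "\<And>k e0. e0 \<in> E \<Longrightarrow> (\<And>e. e \<in> E \<Longrightarrow> e \<noteq> e0 \<Longrightarrow> P (k + e)) \<Longrightarrow> P (k + e0)"
    and s: "s \<ge> 1" "\<And>e e'. e \<in> E \<Longrightarrow> e' \<in> E \<Longrightarrow> e - e' < s"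
    and start: "\<And>k. 0 \<le> k \<Longrightarrow> k < s \<Longrightarrow> P k"
  shows "P i"
proof (rule int_window_induct[OF _ _ start s(1)])
  show "P (i + s)" if IH: "\<forall>k. i \<le> k \<longrightarrow> k < i + s \<longrightarrow> P k" for i
  proof -
    have "P (i + s - Max E + Max E)"
    proof (rule step[OF Max_in[OF E]])
      fix e assume e: "e \<in> E" "e \<noteq> Max E"
      then have "e < Max E"
        using Max_ge[OF E(1) e(1)] by simp
      then show "P (i + s - Max E + e)"
        using s(2)[OF Max_in[OF E] e(1)] by (intro IH[rule_format]) auto
    qed
    then show ?thesis by simp
  qed
  show "P i" if IH: "\<forall>k. i < k \<longrightarrow> k \<le> i + s \<longrightarrow> P k" for i
  proof -
    have "P (i - Min E + Min E)"
    proof (rule step[OF Min_in[OF E]])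
      fix e assume e: "e \<in> E" "e \<noteq> Min E"
      then have "Min E < e"
        using Min_le[OF E(1) e(1)] by simp
      then show "P (i - Min E + e)"
        using s(2)[OF e(1) Min_in[OF E]] by (intro IH[rule_format]) auto
    qed
    then show ?thesis by simp
  qed
qed

section \<open>Finiteness of the norm along the coordinates outside B\<close>

context lattice_module
begin

text \<open>The relation, translated by \<open>a\<close>, is grouped by the exponent of
  \<open>gen j\<close>. All groups but that of \<open>c0\<close> have finite norm by hypothesis, so
  this one has too; it is a nonzero \<open>g\<close> in F * B applied to the desired vector, and
  \<open>Fin_cancel\<close> divides by \<open>g\<close>.\<close>

lemma Fin_extreme:
  assumes j: "r \<le> j" "j < n" and f: "f \<in> tga n" "supp f \<subseteq> line r j" "act f m = 0"
    and a: "a \<in> grp n" and c0: "f c0 \<noteq> 0"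
    and Fin: "\<And>c. f c \<noteq> 0 \<Longrightarrow> c j \<noteq> c0 j \<Longrightarrow> Fin (T (a + zmul (c j) (gen j)) m)"
  shows "Fin (T (a + zmul (c0 j) (gen j)) m)"
proof -
  define x where "x = (gen j :: nat \<Rightarrow> int)"
  define p where "p = a + zmul (c0 j) x"
  have x: "x \<in> grp n" using j by (simp add: x_def)
  have p: "p \<in> grp n" using a x by (simp add: p_def)
  have cb: "c - zmul (c j) x \<in> grp r" if fc: "f c \<noteq> 0" for c
  proof -
    obtain b i where "c = b + zmul i x" "b \<in> grp r"
      using f(2) fc by (auto simp: line_def x_def)
    moreover from this have "c j = i"
      using line_coord[OF j(1), of b i] by (simp only: x_def)
    ultimately show ?thesis by simp
  qed
  have cn: "c \<in> grp n" if "f c \<noteq> 0" for c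
    using f(1) that by (rule tga_supp)
  have shift: "T a (T c m) = scale (\<tau> a c * inverse (\<tau> (c - zmul (c j) x) (a + zmul (c j) x)))
      (T (c - zmul (c j) x) (T (a + zmul (c j) x) m))" if c: "f c \<noteq> 0" for c
  proof -
    have "a + c = (c - zmul (c j) x) + (a + zmul (c j) x)"
      by simp
    then have "T (a + c) m = T ((c - zmul (c j) x) + (a + zmul (c j) x)) m"
      by (simp only:)
    also have "\<dots> = scale (inverse (\<tau> (c - zmul (c j) x) (a + zmul (c j) x)))
        (T (c - zmul (c j) x) (T (a + zmul (c j) x) m))"
      using a x cb[OF c] by (intro T_plus) auto
    finally show ?thesis
      using T_T[OF a cn[OF c], of m] by (simp only: scale_scale)
  qed
  define S1 where "S1 = {c \<in> supp f. c j = c0 j}"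
  define S2 where "S2 = {c \<in> supp f. c j \<noteq> c0 j}"
  have fin: "finite S1" "finite S2"
    using f by (auto simp: S1_def S2_def tga_iff)
  have "0 = T a (act f m)"
    using f a by (simp add: T_zero)
  also have "\<dots> = (\<Sum>c\<in>supp f. scale (f c) (T a (T c m)))"
    unfolding act_expand_supp[OF f(1)] T_sum[OF a] T_scale[OF a] ..
  also have "supp f = S1 \<union> S2"
    by (auto simp: S1_def S2_def)
  also have "(\<Sum>c\<in>S1 \<union> S2. scale (f c) (T a (T c m)))
      = (\<Sum>c\<in>S1. scale (f c) (T a (T c m))) + (\<Sum>c\<in>S2. scale (f c) (T a (T c m)))"
    by (rule sum.union_disjoint) (use fin in \<open>auto simp: S1_def S2_def\<close>)
  finally have "(\<Sum>c\<in>S1. scale (f c) (T a (T c m))) = - (\<Sum>c\<in>S2. scale (f c) (T a (T c m)))"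
    by (simp add: eq_neg_iff_add_eq_0)
  also have "\<dots> \<in> {x. Fin x}"
  proof (intro subspace_neg subspace_sum subspace_scale Fin_subspace)
    fix c assume "c \<in> S2"
    then have c: "f c \<noteq> 0" "c j \<noteq> c0 j" by (auto simp: S2_def)
    have "Fin (T (c - zmul (c j) x) (T (a + zmul (c j) x) m))"
      using Fin_T[OF cb[OF c(1)] Fin[OF c]] by (simp only: x_def)
    then show "T a (T c m) \<in> {x. Fin x}"
      unfolding shift[OF c(1)] using subspace_scale[OF Fin_subspace] by blast
  qed
  finally have F1: "Fin (\<Sum>c\<in>S1. scale (f c) (T a (T c m)))"
    by simp
  define D where "D = (\<lambda>c. c - zmul (c0 j) x) ` S1"
  \<comment> \<open>The values of \<open>\<tau>\<close> come from rewriting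
    \<open>T a (T c m)\<close> as a scalar multiple of a monomial of B acting on
    \<open>T p m\<close>.\<close>
  define g where "g = (\<lambda>b. if b \<in> D then f (b + zmul (c0 j) x) * (\<tau> a (b + zmul (c0 j) x) * inverse (\<tau> b p)) else 0)"
  have "c - zmul (c0 j) x \<in> grp r" if "c \<in> S1" for c
  proof -
    have "f c \<noteq> 0" "c j = c0 j"
      using that by (auto simp: S1_def)
    then show ?thesis
      using cb[of c] by simp
  qed
  then have D: "finite D" "D \<subseteq> grp r"
    using fin by (auto simp: D_def)
  have gD: "b \<in> D" if "g b \<noteq> 0" for b
    using that by (auto simp: g_def split: if_splits)
  have g: "g \<in> tga r"
    by (rule tga_restrict[OF D gD])
  have "act g (T p m) = (\<Sum>b\<in>D. scale (g b) (T b (T p m)))"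
    by (rule act_expand) (use D gD in auto)
  also have "\<dots> = (\<Sum>c\<in>S1. scale (g (c - zmul (c0 j) x)) (T (c - zmul (c0 j) x) (T p m)))"
    unfolding D_def by (subst sum.reindex) (auto simp: inj_on_def)
  also have "\<dots> = (\<Sum>c\<in>S1. scale (f c) (T a (T c m)))"
  proof (rule sum.cong[OF refl])
    fix c assume c: "c \<in> S1"
    then have fc: "f c \<noteq> 0" "c j = c0 j" by (auto simp: S1_def)
    have "g (c - zmul (c0 j) x) = f c * (\<tau> a c * inverse (\<tau> (c - zmul (c0 j) x) p))"
      using c by (auto simp: g_def D_def)
    then show "scale (g (c - zmul (c0 j) x)) (T (c - zmul (c0 j) x) (T p m)) = scale (f c) (T a (T c m))"
      using shift[OF fc(1)] unfolding fc(2) p_def by (simp only: scale_scale)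
  qed
  finally have "Fin (act g (T p m))"
    using F1 by simp
  moreover have "g \<noteq> (\<lambda>_. 0)"
  proof -
    have "c0 - zmul (c0 j) x \<in> D"
      using c0 by (auto simp: D_def S1_def)
    then have "g (c0 - zmul (c0 j) x) = f c0 * (\<tau> a c0 * inverse (\<tau> (c0 - zmul (c0 j) x) p))"
      by (simp add: g_def)
    moreover have "\<tau> a c0 \<noteq> 0" "\<tau> (c0 - zmul (c0 j) x) p \<noteq> 0"
      using tau_nonzero[OF a cn[OF c0]] tau_nonzero[OF grp_r_n[OF cb[OF c0]] p] by auto
    ultimately have "g (c0 - zmul (c0 j) x) \<noteq> 0"
      using c0 by simp
    then show ?thesis by metis
  qed
  ultimately have "Fin (T p m)"
    using g Fin_cancel by blast
  then show ?thesis by (simp only: p_def x_def)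
qed

lemma Fin_line:
  assumes j: "r \<le> j" "j < n" and f: "f \<in> tga n" "supp f \<subseteq> line r j" "act f m = 0"
    and s: "s \<ge> 1" "\<And>c c'. f c \<noteq> 0 \<Longrightarrow> f c' \<noteq> 0 \<Longrightarrow> c j - c' j < s" and f0: "f \<noteq> (\<lambda>_. 0)"
    and a: "a \<in> grp n" and start: "\<And>k. 0 \<le> k \<Longrightarrow> k < s \<Longrightarrow> Fin (T (a + zmul k (gen j)) m)"
  shows "Fin (T (a + zmul i (gen j)) m)"
proof (rule int_relation_induct[where P = "\<lambda>i. Fin (T (a + zmul i (gen j)) m)" and E = "(\<lambda>c. c j) ` supp f",
      OF _ _ _ s(1) _ start])
  show "finite ((\<lambda>c. c j) ` supp f)" "(\<lambda>c. c j) ` supp f \<noteq> {}"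
    using f f0 by (auto simp: tga_iff)
  show "e - e' < s" if "e \<in> (\<lambda>c. c j) ` supp f" "e' \<in> (\<lambda>c. c j) ` supp f" for e e'
    using s(2) that by auto
  fix k e0
  assume "e0 \<in> (\<lambda>c. c j) ` supp f"
    and IH: "\<And>e. e \<in> (\<lambda>c. c j) ` supp f \<Longrightarrow> e \<noteq> e0 \<Longrightarrow> Fin (T (a + zmul (k + e) (gen j)) m)"
  then obtain c0 where c0: "f c0 \<noteq> 0" "e0 = c0 j" by auto
  have shift: "a + zmul k (gen j) + zmul l (gen j) = a + zmul (k + l) (gen j)" for l
    by (simp only: zmul_add_left add.assoc)
  have "a + zmul k (gen j) \<in> grp n"
    using a j by auto
  then have "Fin (T (a + zmul k (gen j) + zmul (c0 j) (gen j)) m)"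
  proof (rule Fin_extreme[OF j f _ c0(1)])
    fix c assume c: "f c \<noteq> 0" "c j \<noteq> c0 j"
    then have "Fin (T (a + zmul (k + c j) (gen j)) m)"
      using c0 by (intro IH) auto
    then show "Fin (T (a + zmul k (gen j) + zmul (c j) (gen j)) m)"
      by (simp only: shift)
  qed
  then show "Fin (T (a + zmul (k + e0) (gen j)) m)"
    by (simp only: shift c0)
qed

lemma opge_existsI:
  assumes "\<And>e. e \<in> G \<Longrightarrow> Fin (T a e)"
  shows "\<exists>t. opge a t"
proof -
  have "\<forall>e\<in>G. \<exists>t. Ge t (T a e)"
    using assms by (simp add: Fin_def)
  from bchoice[OF this] obtain t where t: "\<forall>e\<in>G. Ge (t e) (T a e)" ..
  have "Ge (Min (t ` G)) (T a e)" if "e \<in> G" for e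
    by (rule Ge_mono[of _ "t e"]) (use t that finite_G in auto)
  then show ?thesis
    by (auto simp: opge_def)
qed

end

lemma gen_split: "a \<in> grp n \<Longrightarrow> a = a(j := 0) + zmul (a j) (gen j)"
  by (auto simp: fun_eq_iff zmul_apply gen_def)

context valued_module
begin

text \<open>\<open>G\<close> is a maximal independent set among finitely many translates of
  \<open>m\<close>. The relations along each \<open>gen j\<close> propagate finite norm from these
  to every translate, so all \<open>T a\<close> are bounded and \<open>initial_form_proper\<close>
  applies.\<close>

lemma initial_form_exists:
  assumes free: "\<And>u. u \<in> tga r \<Longrightarrow> u \<noteq> (\<lambda>_. 0) \<Longrightarrow> act u m \<noteq> 0"
    and rel: "\<And>j. r \<le> j \<Longrightarrow> j < n \<Longrightarrow> \<exists>f. f \<in> tga n \<and> f \<noteq> (\<lambda>_. 0) \<and> supp f \<subseteq> line r j \<and> act f m = 0"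
  obtains \<phi> w where "\<And>a b. a \<in> grp n \<Longrightarrow> b \<in> grp n \<Longrightarrow> \<phi> (a + b) = \<phi> a + \<phi> b"
    "\<And>b. b \<in> grp r \<Longrightarrow> \<phi> b = \<theta> b" "w \<notin> span ((\<lambda>a. T a w) ` {a \<in> grp n. \<phi> a > 0})"
proof -
  have "\<exists>F. \<forall>j\<in>{r..<n}. F j \<in> tga n \<and> F j \<noteq> (\<lambda>_. 0) \<and> supp (F j) \<subseteq> line r j \<and> act (F j) m = 0"
    by (rule bchoice) (use rel in auto)
  then obtain F where F0: "\<forall>j\<in>{r..<n}. F j \<in> tga n \<and> F j \<noteq> (\<lambda>_. 0) \<and> supp (F j) \<subseteq> line r j \<and> act (F j) m = 0" ..
  have F: "F j \<in> tga n" "F j \<noteq> (\<lambda>_. 0)" "supp (F j) \<subseteq> line r j" "act (F j) m = 0"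
    if "r \<le> j" "j < n" for j
    using F0[rule_format, of j] that by auto
  have "\<exists>s. s \<ge> 1 \<and> (\<forall>c c'. F j c \<noteq> 0 \<longrightarrow> F j c' \<noteq> 0 \<longrightarrow> c j - c' j < s)" if j: "r \<le> j" "j < n" for j
  proof -
    have fin: "finite (supp (F j))"
      using F(1)[OF j] by (rule tga_finite_supp)
    define s where "s = Max ((\<lambda>(c, c'). \<bar>c j - c' j\<bar>) ` (supp (F j) \<times> supp (F j)) \<union> {0}) + 1"
    have "c j - c' j < s" if "F j c \<noteq> 0" "F j c' \<noteq> 0" for c c'
    proof -
      have "\<bar>c j - c' j\<bar> \<le> Max ((\<lambda>(c, c'). \<bar>c j - c' j\<bar>) ` (supp (F j) \<times> supp (F j)) \<union> {0})"
        using fin that by (intro Max_ge) (auto intro!: image_eqI[where x = "(c, c')"])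
      then show ?thesis
        by (simp add: s_def)
    qed
    moreover have "0 \<le> Max ((\<lambda>(c, c'). \<bar>c j - c' j\<bar>) ` (supp (F j) \<times> supp (F j)) \<union> {0})"
      using fin by (intro Max_ge) auto
    then have "s \<ge> 1" by (simp add: s_def)
    ultimately show ?thesis by blast
  qed
  then have "\<exists>s. \<forall>j\<in>{r..<n}. s j \<ge> 1 \<and> (\<forall>c c'. F j c \<noteq> 0 \<longrightarrow> F j c' \<noteq> 0 \<longrightarrow> c j - c' j < s j)"
    by (intro bchoice) auto
  then obtain s where s0: "\<forall>j\<in>{r..<n}. s j \<ge> 1 \<and> (\<forall>c c'. F j c \<noteq> 0 \<longrightarrow> F j c' \<noteq> 0 \<longrightarrow> c j - c' j < s j)" ..
  have s: "s j \<ge> 1" "\<forall>c c'. F j c \<noteq> 0 \<longrightarrow> F j c' \<noteq> 0 \<longrightarrow> c j - c' j < s j"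
    if "r \<le> j" "j < n" for j
    using s0[rule_format, of j] that by auto
  \<comment> \<open>Coordinates belonging to B are zero; each other coordinate \<open>j\<close> runs
    over a window of length \<open>s j\<close>, which exceeds the spread of
    \<open>F j\<close>.\<close>
  define Bx where "Bx = {a \<in> grp n. (\<forall>i<r. a i = 0) \<and> (\<forall>j. r \<le> j \<longrightarrow> j < n \<longrightarrow> 0 \<le> a j \<and> a j < s j)}"
  have "Bx \<subseteq> box n (\<Sum>j<n. nat \<bar>s j\<bar>)"
  proof
    fix a assume a: "a \<in> Bx"
    have "\<bar>a i\<bar> \<le> int (\<Sum>j<n. nat \<bar>s j\<bar>)" if i: "i < n" for i
    proof -
      have "\<bar>a i\<bar> \<le> int (nat \<bar>s i\<bar>)"
        using a i by (cases "i < r") (force simp: Bx_def not_less)+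
      also have "nat \<bar>s i\<bar> \<le> (\<Sum>j<n. nat \<bar>s j\<bar>)"
        using i by (intro member_le_sum) auto
      finally show ?thesis by simp
    qed
    then show "a \<in> box n (\<Sum>j<n. nat \<bar>s j\<bar>)"
      using a by (auto simp: box_def Bx_def)
  qed
  then have finBx: "finite Bx"
    using finite_subset by blast
  have zero: "0 \<in> Bx"
    using s by (force simp: Bx_def)
  define V where "V = (\<lambda>a. T a m) ` Bx"
  \<comment> \<open>\<open>T 0 m\<close> is the translate with exponent \<open>0\<close> and differs
    from \<open>m\<close> only by a nonzero scalar. Its independence ensures that \<open>G\<close>
    can be chosen nonempty.\<close>
  have "Bindep {T 0 m}"
    unfolding Bindep_def
  proof (intro allI impI)
    fix v assume v: "\<forall>e\<in>{T 0 m}. v e \<in> tga r" "(\<Sum>e\<in>{T 0 m}. act (v e) e) = 0"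
    then have "act (v (T 0 m)) (T 0 m) = 0" "v (T 0 m) \<in> tga r"
      by simp_all
    then have "scale (\<tau> 0 0) (act (v (T 0 m)) m) = 0"
      by (simp add: T_0 act_scale)
    then have "act (v (T 0 m)) m = 0"
      using tau_nonzero[OF grp_0 grp_0] by simp
    then show "\<forall>e\<in>{T 0 m}. v e = (\<lambda>_. 0)"
      using free[OF \<open>v (T 0 m) \<in> tga r\<close>] by blast
  qed
  then have mem: "{T 0 m} \<in> {G. G \<subseteq> V \<and> Bindep G}"
    using zero by (auto simp: V_def)
  have "finite {G. G \<subseteq> V \<and> Bindep G}"
    by (rule finite_subset[of _ "Pow V"]) (use finBx in \<open>auto simp: V_def\<close>)
  from finite_has_maximal2[OF this mem] obtain G where G0: "G \<in> {G. G \<subseteq> V \<and> Bindep G}" "{T 0 m} \<subseteq> G"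
    and G1: "\<forall>H\<in>{G. G \<subseteq> V \<and> Bindep G}. G \<subseteq> H \<longrightarrow> G = H"
    by blast
  have G: "G \<subseteq> V" "Bindep G" "{T 0 m} \<subseteq> G"
    using G0 by auto
  have G_max: "G = H" if "H \<subseteq> V" "Bindep H" "G \<subseteq> H" for H
    using G1 that by blast
  have finG: "finite G"
    by (rule finite_subset[OF G(1)]) (use finBx in \<open>simp add: V_def\<close>)
  interpret lattice_module n \<tau> scale act r \<theta> G
    by unfold_locales (use G finG in auto)
  have FinV: "Fin v" if v: "v \<in> V" for v
  proof (cases "v \<in> G")
    case True
    have "Ge (\<theta> 0) (T 0 v)"
      by (rule Ge_Lt[OF T_in_Lt[OF grp_0 True]])
    then have "Ge (\<theta> 0) (scale (inverse (\<tau> 0 0)) (T 0 v))"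
      by (rule Ge_scale)
    then show ?thesis
      using tau_nonzero[OF grp_0 grp_0] by (auto simp: T_0 Fin_def)
  next
    case False
    \<comment> \<open>Maximality of \<open>G\<close> yields a relation, independence of
      \<open>G\<close> makes its coefficient at \<open>v\<close> nonzero, and so \<open>v\<close> is
      a quotient of a lattice vector.\<close>
    then have "\<not> Bindep (insert v G)"
      using G_max[of "insert v G"] G v by blast
    then obtain y where y: "\<forall>e\<in>insert v G. y e \<in> tga r" "(\<Sum>e\<in>insert v G. act (y e) e) = 0"
      "\<not> (\<forall>e\<in>insert v G. y e = (\<lambda>_. 0))"
      unfolding Bindep_def by blast
    have sum0: "act (y v) v + (\<Sum>e\<in>G. act (y e) e) = 0"
      using y(2) sum.insert[OF finG False, of "\<lambda>e. act (y e) e"] by simp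
    have yv: "y v \<noteq> (\<lambda>_. 0)"
    proof
      assume *: "y v = (\<lambda>_. 0)"
      then have "(\<Sum>e\<in>G. act (y e) e) = 0"
        using sum0 by (simp add: act_zero)
      then have "\<forall>e\<in>G. y e = (\<lambda>_. 0)"
        using G(2)[unfolded Bindep_def, rule_format, of y] y(1) by blast
      then show False
        using y(3) * by blast
    qed
    obtain t where "(\<Sum>e\<in>G. act (y e) e) \<in> Lt t"
      using sum_act_in_Lt[OF finG subset_refl, of y] y(1) by blast
    then have "- (\<Sum>e\<in>G. act (y e) e) \<in> Lt t"
      by (rule subspace_neg[OF Lt_subspace])
    moreover have "act (y v) v = - (\<Sum>e\<in>G. act (y e) e)"
      using sum0 by (simp add: eq_neg_iff_add_eq_0)
    ultimately have "Fin (act (y v) v)"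
      using Ge_Lt by (auto simp: Fin_def)
    then show ?thesis
      using Fin_cancel[of "y v" v] y(1) yv by blast
  qed
  \<comment> \<open>Coordinates from \<open>J\<close> on are confined to their windows, those below
    \<open>J\<close> are arbitrary; \<open>Fin_line\<close> frees the coordinate
    \<open>J\<close>.\<close>
  have Fin_partial: "\<forall>a\<in>grp n. (\<forall>j. J \<le> j \<longrightarrow> j < n \<longrightarrow> 0 \<le> a j \<and> a j < s j) \<longrightarrow> Fin (T a m)" if "r \<le> J" "J \<le> n" for J
    using that
  proof (induction J rule: dec_induct)
    case base
    show ?case
    proof (intro ballI impI)
      fix a assume a: "a \<in> grp n" "\<forall>j. r \<le> j \<longrightarrow> j < n \<longrightarrow> 0 \<le> a j \<and> a j < s j"
      define b c where "b = (\<lambda>i. if i < r then a i else 0)" and "c = (\<lambda>i. if i < r then 0 else a i)"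
      have bc: "a = b + c" "b \<in> grp r" "c \<in> Bx"
        using a by (auto simp: b_def c_def grp_def Bx_def)
      have cn: "c \<in> grp n" using bc by (simp add: Bx_def)
      have "Fin (T c m)"
        using FinV bc by (simp add: V_def)
      then have "Fin (T b (T c m))"
        by (rule Fin_T[OF bc(2)])
      then show "Fin (T a m)"
        using subspace_scale[OF Fin_subspace] T_plus[OF grp_r_n[OF bc(2)] cn, of m] unfolding bc(1) by simp
    qed
  next
    case (step J)
    have J: "r \<le> J" "J < n" using step by auto
    show ?case
    proof (intro ballI impI)
      fix a assume a: "a \<in> grp n" "\<forall>j. Suc J \<le> j \<longrightarrow> j < n \<longrightarrow> 0 \<le> a j \<and> a j < s j"
      define a0 where "a0 = a(J := 0)"
      have a0: "a0 \<in> grp n" using a by (auto simp: a0_def grp_def)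
      have "Fin (T (a0 + zmul (a J) (gen J)) m)"
      proof (rule Fin_line[OF J F(1,3,4)[OF J] s(1)[OF J] _ F(2)[OF J] a0])
        show "c J - c' J < s J" if "F J c \<noteq> 0" "F J c' \<noteq> 0" for c c'
          using s(2)[OF J] that by blast
        fix k :: int assume k: "0 \<le> k" "k < s J"
        have mem: "a0 + zmul k (gen J) \<in> grp n"
          using a0 J by auto
        moreover have "0 \<le> (a0 + zmul k (gen J)) j \<and> (a0 + zmul k (gen J)) j < s j" if "J \<le> j" "j < n" for j
          using that k a(2) by (cases "j = J") (auto simp: a0_def zmul_apply gen_def)
        ultimately show "Fin (T (a0 + zmul k (gen J)) m)"
          using step.IH step.prems by auto
      qed
      then show "Fin (T a m)"
        using gen_split[OF a(1), of J] unfolding a0_def by (simp only:)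
    qed
  qed
  have Fin_all: "Fin (T a m)" if "a \<in> grp n" for a
    using Fin_partial[OF r_le_n order_refl] that by auto
  interpret bounded_lattice_module n \<tau> scale act r \<theta> G
  proof unfold_locales
    fix a assume a: "a \<in> grp n"
    show "\<exists>t. opge a t"
    proof (rule opge_existsI)
      fix e assume "e \<in> G"
      then obtain b where b: "e = T b m" "b \<in> grp n"
        using G by (auto simp: V_def Bx_def)
      show "Fin (T a e)"
        unfolding b(1) T_T[OF a b(2)] using Fin_all[of "a + b"] a b subspace_scale[OF Fin_subspace] by blast
    qed
  qed
  show ?thesis
    by (rule initial_form_proper) (rule that)
qed

end

section \<open>The kernel of the degeneration\<close>

text \<open>The weights are logarithms of distinct primes, which are linearly independent over the
  rationals by unique factorisation.\<close>

lemma log_primes_independent: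
  obtains \<theta> :: "(nat \<Rightarrow> int) \<Rightarrow> real" where "\<And>a b. \<theta> (a + b) = \<theta> a + \<theta> b" "\<And>a. a \<in> grp n \<Longrightarrow> \<theta> a = 0 \<Longrightarrow> a = 0"
proof -
  have inf: "infinite {p :: nat. prime p}"
    by (rule primes_infinite)
  define q where "q = enumerate {p :: nat. prime p}"
  have q: "prime (q i)" for i
    using enumerate_in_set[OF inf, of i] by (simp add: q_def)
  have q_pos: "q i > 0" for i
    using q by (rule prime_gt_0_nat)
  have q_inj: "q i = q j \<Longrightarrow> i = j" for i j
    using strict_mono_enumerate[OF inf] by (simp add: q_def strict_mono_eq)
  define \<theta> where "\<theta> = (\<lambda>a. \<Sum>i<n. real_of_int (a i) * ln (real (q i)))"
  have add: "\<theta> (a + b) = \<theta> a + \<theta> b" for a b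
    by (simp add: \<theta>_def algebra_simps sum.distrib)
  have neg: "\<theta> (- a) = - \<theta> a" for a
    by (simp add: \<theta>_def sum_negf)
  \<comment> \<open>One sign is enough, since the same bound applies to \<open>- a\<close>.\<close>
  have le: "a i \<le> 0" if a: "\<theta> a = 0" and i: "i < n" for a i
  proof (rule ccontr)
    assume pos: "\<not> a i \<le> 0"
    \<comment> \<open>\<open>P\<close> keeps only positive exponents, so
      \<open>exp (\<theta> a)\<close> is \<open>P a / P (- a)\<close>. For
      \<open>\<theta> a = 0\<close> the prime \<open>q i\<close> divides both products, although its
      exponent in \<open>P (- a)\<close> is zero.\<close>
    define P where "P = (\<lambda>a :: nat \<Rightarrow> int. \<Prod>i<n. q i ^ nat (a i))"
    have P_pos: "0 < P a" for a
      unfolding P_def using q_pos by (intro prod_pos) simp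
    have lnP: "ln (real (P a)) = (\<Sum>i<n. real (nat (a i)) * ln (real (q i)))" for a
    proof -
      have "ln (real (P a)) = ln (\<Prod>i<n. real (q i) ^ nat (a i))"
        by (simp add: P_def)
      also have "\<dots> = (\<Sum>i<n. ln (real (q i) ^ nat (a i)))"
        by (rule ln_prod) (use q_pos in auto)
      also have "\<dots> = (\<Sum>i<n. real (nat (a i)) * ln (real (q i)))"
        using q_pos by (intro sum.cong) (simp_all add: ln_realpow)
      finally show ?thesis .
    qed
    have "ln (real (P a)) - ln (real (P (- a))) = \<theta> a"
      unfolding lnP \<theta>_def sum_subtractf[symmetric]
    proof (rule sum.cong[OF refl])
      fix i
      have "real (nat (a i)) - real (nat ((- a) i)) = real_of_int (a i)"
        by simp
      then show "real (nat (a i)) * ln (real (q i)) - real (nat ((- a) i)) * ln (real (q i))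
          = real_of_int (a i) * ln (real (q i))"
        by (simp only: left_diff_distrib[symmetric])
    qed
    then have "ln (real (P a)) = ln (real (P (- a)))"
      using a by simp
    then have "P a = P (- a)"
      using P_pos[of a] P_pos[of "- a"] by simp
    moreover have "q i dvd P a"
      unfolding P_def using i pos by (intro dvd_trans[OF _ dvd_prodI[of _ i]] dvd_power) auto
    ultimately have "q i dvd (\<Prod>k<n. q k ^ nat ((- a) k))"
      by (simp add: P_def)
    then obtain k where k: "k < n" "q i dvd q k ^ nat ((- a) k)"
      using prime_dvd_prod_iff[OF finite_lessThan q[of i]] by (auto simp del: uminus_apply)
    then have "q i dvd q k"
      using prime_dvd_power[OF q[of i]] by simp
    then have "i = k"
      using primes_dvd_imp_eq[OF q q] q_inj by blast
    then have "q i dvd 1"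
      using k pos by simp
    then show False
      using q[of i] by (simp add: prime_nat_iff)
  qed
  have "a = 0" if a: "a \<in> grp n" "\<theta> a = 0" for a
  proof
    fix i
    show "a i = 0 i"
    proof (cases "i < n")
      case True
      then show ?thesis
        using le[OF a(2) True] le[of "- a" i] neg[of a] a(2) by simp
    qed (use a(1) in \<open>simp add: grp_def\<close>)
  qed
  then show ?thesis
    using add by (intro that[of \<theta>])
qed

text \<open>With \<open>r = n\<close> the weights provide leading monomials on the whole algebra,
  and these multiply.\<close>

lemma (in twisted_module) tmul_nonzero:
  assumes "u \<in> tga n" "v \<in> tga n" "u \<noteq> (\<lambda>_. 0)" "v \<noteq> (\<lambda>_. 0)"
  shows "tmul \<tau> u v \<noteq> (\<lambda>_. 0)"
proof -
  obtain \<theta> :: "(nat \<Rightarrow> int) \<Rightarrow> real" where "\<And>a b. \<theta> (a + b) = \<theta> a + \<theta> b" "\<And>a. a \<in> grp n \<Longrightarrow> \<theta> a = 0 \<Longrightarrow> a = 0"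
    by (rule log_primes_independent[of n]) (rule that)
  then interpret valued_module n \<tau> scale act n \<theta>
    by unfold_locales auto
  obtain a where a: "LT u a"
    using LT_exists[OF assms(1,3)] .
  obtain b where b: "LT v b"
    using LT_exists[OF assms(2,4)] .
  show ?thesis
    by (rule LT_nonzero[OF LT_tmul[OF a b]])
qed

locale initial_form = valued_module n \<tau> scale act r \<theta>
  for n \<tau> and scale :: "'f::field \<Rightarrow> 'm::ab_group_add \<Rightarrow> 'm" and act r \<theta> +
  fixes \<phi> :: "(nat \<Rightarrow> int) \<Rightarrow> real" and w :: 'm
  assumes phi_add: "a \<in> grp n \<Longrightarrow> b \<in> grp n \<Longrightarrow> \<phi> (a + b) = \<phi> a + \<phi> b"
    and phi_theta: "b \<in> grp r \<Longrightarrow> \<phi> b = \<theta> b"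
    and w_notin: "w \<notin> span ((\<lambda>a. T a w) ` {a \<in> grp n. \<phi> a > 0})"
begin

text \<open>Working modulo \<open>Y\<close> with exponents of weight zero means working in degree
  zero of the degeneration along \<open>\<phi>\<close>; \<open>w_notin\<close> says that the class
  of \<open>w\<close> there is nonzero.\<close>

definition Y :: "'m set" where "Y = span ((\<lambda>a. T a w) ` {a \<in> grp n. \<phi> a > 0})"

lemma Y_subspace: "subspace Y"
  by (simp add: Y_def)

lemma Y_base: "a \<in> grp n \<Longrightarrow> \<phi> a > 0 \<Longrightarrow> T a w \<in> Y"
  unfolding Y_def by (rule span_base) auto

lemma phi_0: "\<phi> 0 = 0"
  using phi_add[OF grp_0 grp_0] by simp

lemma phi_uminus: "a \<in> grp n \<Longrightarrow> \<phi> (- a) = - \<phi> a"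
  using phi_add[of a "- a"] phi_0 by simp

lemma phi_zmul:
  assumes "a \<in> grp n"
  shows "\<phi> (zmul k a) = of_int k * \<phi> a"
proof -
  have nat: "\<phi> (zmul (int k) a) = of_nat k * \<phi> a" for k
  proof (induction k)
    case (Suc k)
    have "zmul (int (Suc k)) a = a + zmul (int k) a"
      using zmul_add_left[of 1 "int k" a] by simp
    then have "\<phi> (zmul (int (Suc k)) a) = \<phi> a + \<phi> (zmul (int k) a)"
      using phi_add[OF assms grp_zmul[OF assms]] by (simp only:)
    then show ?case
      using Suc by (simp add: algebra_simps)
  qed (use phi_0 in \<open>simp only: zmul_simps of_nat_0 mult_zero_left\<close>)
  show ?thesis
  proof (cases k rule: int_cases2)
    case (nonneg m)
    then show ?thesis using nat[of m] by simp
  next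
    case (nonpos m)
    then show ?thesis
      using nat[of m] phi_uminus[OF grp_zmul[OF assms], of "int m"] by (simp add: zmul_uminus_left)
  qed
qed

lemma T_Y:
  assumes a: "a \<in> grp n" "\<phi> a \<ge> 0" and y: "y \<in> Y"
  shows "T a y \<in> Y"
proof (rule T_span[OF a(1) _ Y_subspace y[unfolded Y_def]])
  fix x assume "x \<in> (\<lambda>a. T a w) ` {a \<in> grp n. \<phi> a > 0}"
  then obtain b where b: "x = T b w" "b \<in> grp n" "\<phi> b > 0" by auto
  have "T (a + b) w \<in> Y"
    using Y_base[of "a + b"] phi_add[OF a(1) b(2)] a b by simp
  then show "T a x \<in> Y"
    unfolding b(1) T_T[OF a(1) b(2)] by (rule subspace_scale[OF Y_subspace])
qed

lemma T_w_notin: "a \<in> grp n \<Longrightarrow> \<phi> a = 0 \<Longrightarrow> T a w \<notin> Y"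
  using T_subspace_iff[OF Y_subspace, of a Y w] T_Y[of "- a"] phi_uminus[of a] Y_subspace w_notin
  by (auto simp: Y_def[symmetric])

lemma act_Y: "f \<in> tga n \<Longrightarrow> (\<And>a. f a \<noteq> 0 \<Longrightarrow> \<phi> a = 0) \<Longrightarrow> y \<in> Y \<Longrightarrow> act f y \<in> Y"
  by (intro act_subspace Y_subspace T_Y) (auto dest: tga_supp)

lemma Y_scale_cancel: "c \<noteq> 0 \<Longrightarrow> scale c x \<in> Y \<Longrightarrow> x \<in> Y"
  using subspace_scale[OF Y_subspace, of "scale c x" "inverse c"] by simp

text \<open>The lowest part of \<open>f\<close>, translated to weight zero, sends \<open>w\<close>
  into \<open>Y\<close>. Were it a single monomial, \<open>w\<close> itself would lie in
  \<open>Y\<close>; a second term gives a nonzero exponent of weight zero. Such exponents in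
  \<open>line r j\<close> form a cyclic group because \<open>\<phi>\<close> is injective on B, so
  this part is a Laurent polynomial in one generator.\<close>

lemma kernel_generator:
  assumes j: "r \<le> j" "j < n" and f: "f \<in> tga n" "f \<noteq> (\<lambda>_. 0)" "supp f \<subseteq> line r j" "act f w = 0"
  obtains b s p where "b \<in> grp r" "s \<noteq> 0" "\<phi> (b + zmul s (gen j)) = 0"
    "p \<in> tga n" "p \<noteq> (\<lambda>_. 0)" "supp p \<subseteq> range (\<lambda>i. zmul i (b + zmul s (gen j)))" "act p w \<in> Y"
proof -
  define x where "x = (gen j :: nat \<Rightarrow> int)"
  have x: "x \<in> grp n" using j by (simp add: x_def)
  have "finite (supp f)" "supp f \<noteq> {}"
    using f by (auto simp: tga_iff)
  then obtain a0 where a0: "a0 \<in> supp f" "\<And>b. b \<in> supp f \<Longrightarrow> \<phi> a0 \<le> \<phi> b"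
    using arg_min_if_finite(1)[of "supp f" \<phi>] arg_min_least[of "supp f" _ \<phi>] by blast
  have fn: "a \<in> grp n" if "f a \<noteq> 0" for a
    using f(1) that by (rule tga_supp)
  have a0n: "a0 \<in> grp n" "- a0 \<in> grp n" using fn a0 by auto
  define S1 where "S1 = {a \<in> supp f. \<phi> a = \<phi> a0}"
  define S2 where "S2 = {a \<in> supp f. \<phi> a \<noteq> \<phi> a0}"
  have fin: "finite S1" "finite S2"
    using f by (auto simp: S1_def S2_def tga_iff)
  have shift: "T (- a0) (T a w) = scale (\<tau> (- a0) a) (T (a - a0) w)" if "f a \<noteq> 0" for a
    using T_T[OF a0n(2) fn[OF that], of w] by simp
  have phi_diff: "\<phi> (a - a0) = \<phi> a - \<phi> a0" if "f a \<noteq> 0" for a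
    using phi_add[OF fn[OF that] a0n(2)] phi_uminus[OF a0n(1)] by simp
  have "0 = T (- a0) (act f w)"
    using f(4) T_zero[OF a0n(2)] by simp
  also have "\<dots> = (\<Sum>a\<in>supp f. scale (f a) (T (- a0) (T a w)))"
    unfolding act_expand_supp[OF f(1)] T_sum[OF a0n(2)] T_scale[OF a0n(2)] ..
  also have "supp f = S1 \<union> S2"
    by (auto simp: S1_def S2_def)
  also have "(\<Sum>a\<in>S1 \<union> S2. scale (f a) (T (- a0) (T a w)))
      = (\<Sum>a\<in>S1. scale (f a) (T (- a0) (T a w))) + (\<Sum>a\<in>S2. scale (f a) (T (- a0) (T a w)))"
    by (rule sum.union_disjoint) (use fin in \<open>auto simp: S1_def S2_def\<close>)
  finally have "(\<Sum>a\<in>S1. scale (f a) (T (- a0) (T a w))) = - (\<Sum>a\<in>S2. scale (f a) (T (- a0) (T a w)))"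
    by (simp add: eq_neg_iff_add_eq_0)
  also have "\<dots> \<in> Y"
  proof (intro subspace_neg subspace_sum subspace_scale Y_subspace)
    fix a assume "a \<in> S2"
    then have a: "f a \<noteq> 0" "\<phi> a > \<phi> a0"
      using a0(2)[of a] by (auto simp: S2_def)
    then have "T (a - a0) w \<in> Y"
      using phi_diff[OF a(1)] fn a0n by (intro Y_base) auto
    then show "T (- a0) (T a w) \<in> Y"
      unfolding shift[OF a(1)] by (rule subspace_scale[OF Y_subspace])
  qed
  finally have F1: "(\<Sum>a\<in>S1. scale (f a) (T (- a0) (T a w))) \<in> Y" .
  define D where "D = (\<lambda>a. a - a0) ` S1"
  define p where "p = (\<lambda>a. if a \<in> D then f (a + a0) * \<tau> (- a0) (a + a0) else 0)"
  have D: "finite D" "D \<subseteq> grp n"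
    using fin fn a0n by (auto simp: D_def S1_def)
  have pD: "a \<in> D" if "p a \<noteq> 0" for a
    using that by (auto simp: p_def split: if_splits)
  have p: "p \<in> tga n"
    by (rule tga_restrict[OF D pD])
  have "act p w = (\<Sum>a\<in>D. scale (p a) (T a w))"
    by (rule act_expand[OF D pD])
  also have "\<dots> = (\<Sum>a\<in>S1. scale (p (a - a0)) (T (a - a0) w))"
    unfolding D_def by (subst sum.reindex) (auto simp: inj_on_def)
  also have "\<dots> = (\<Sum>a\<in>S1. scale (f a) (T (- a0) (T a w)))"
  proof (rule sum.cong[OF refl])
    fix a assume a: "a \<in> S1"
    then have fa: "f a \<noteq> 0" by (auto simp: S1_def)
    have "p (a - a0) = f a * \<tau> (- a0) a"
      using a by (auto simp: p_def D_def)
    then show "scale (p (a - a0)) (T (a - a0) w) = scale (f a) (T (- a0) (T a w))"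
      using shift[OF fa] by (simp only: scale_scale)
  qed
  finally have pY: "act p w \<in> Y"
    using F1 by (simp only:)
  have "0 \<in> D"
    using a0 by (auto simp: D_def S1_def intro!: image_eqI[where x = a0])
  then have p0: "p 0 \<noteq> 0"
    using a0 tau_nonzero[OF a0n(2,1)] by (simp add: p_def)
  have D_form: "\<exists>b i. b \<in> grp r \<and> a = b + zmul i x \<and> \<phi> a = 0" if "a \<in> D" for a
  proof -
    obtain c where c: "c \<in> S1" "a = c - a0"
      using \<open>a \<in> D\<close> by (auto simp: D_def)
    then have "c \<in> line r j" "a0 \<in> line r j" "f c \<noteq> 0" "\<phi> c = \<phi> a0"
      using f(3) a0(1) by (auto simp: S1_def)
    then obtain b i b' i' where "c = b + zmul i x" "b \<in> grp r" "a0 = b' + zmul i' x" "b' \<in> grp r"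
      by (auto simp: line_def x_def)
    then have "b - b' \<in> grp r" "a = (b - b') + zmul (i - i') x"
      using c by (auto simp: zmul_diff_left)
    moreover have "\<phi> a = 0"
      using phi_diff[OF \<open>f c \<noteq> 0\<close>] \<open>\<phi> c = \<phi> a0\<close> c(2) by simp
    ultimately show ?thesis by blast
  qed
  have "\<exists>a\<in>D. a \<noteq> 0"
  proof (rule ccontr)
    assume "\<not> ?thesis"
    then have "p a \<noteq> 0 \<Longrightarrow> a \<in> {0}" for a
      using pD by blast
    then have "act p w = (\<Sum>a\<in>{0}. scale (p a) (T a w))"
      by (intro act_expand) auto
    then have "scale (p 0) (T 0 w) \<in> Y"
      using pY by simp
    then show False
      using Y_scale_cancel[OF p0] T_w_notin[OF grp_0 phi_0] by blast
  qed
  then obtain a1 where a1: "a1 \<in> D" "a1 \<noteq> 0" by blast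
  obtain b1 i1 where b1: "b1 \<in> grp r" "a1 = b1 + zmul i1 x" "\<phi> a1 = 0"
    using D_form[OF a1(1)] by blast
  have i1: "i1 \<noteq> 0"
  proof
    assume "i1 = 0"
    then have "a1 = b1" using b1 by simp
    then show False
      using b1 a1 theta_inj[of b1] phi_theta[of b1] by simp
  qed
  \<comment> \<open>The least positive exponent of \<open>gen j\<close> that occurs with weight zero
    yields the generator.\<close>
  define Pr where "Pr = (\<lambda>k :: nat. k > 0 \<and> (\<exists>b\<in>grp r. \<phi> (b + zmul (int k) x) = 0))"
  have "Pr (nat \<bar>i1\<bar>)"
  proof (cases "i1 > 0")
    case True
    then show ?thesis using b1 by (auto simp: Pr_def)
  next
    case False
    have "- b1 + zmul (int (nat \<bar>i1\<bar>)) x = - a1"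
      using False by (simp add: b1(2) zmul_uminus_left)
    moreover have "\<phi> (- a1) = 0"
      using phi_uminus[of a1] b1 x by auto
    ultimately have "\<phi> (- b1 + zmul (int (nat \<bar>i1\<bar>)) x) = 0"
      by (simp only:)
    then show ?thesis
      using False i1 b1 unfolding Pr_def by (intro conjI bexI[of _ "- b1"]) auto
  qed
  then have "Pr (LEAST k. Pr k)"
    by (rule LeastI)
  then obtain b where s: "(LEAST k. Pr k) > 0" and b: "b \<in> grp r" "\<phi> (b + zmul (int (LEAST k. Pr k)) x) = 0"
    by (auto simp: Pr_def)
  define s where "s = (LEAST k. Pr k)"
  define c where "c = b + zmul (int s) x"
  have c: "c \<in> grp n" "\<phi> c = 0"
    using b x by (auto simp: c_def s_def)
  have "a \<in> range (\<lambda>i. zmul i c)" if "a \<in> D" for a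
  proof -
    obtain b' i where b': "b' \<in> grp r" "a = b' + zmul i x" "\<phi> a = 0"
      using D_form[OF \<open>a \<in> D\<close>] by blast
    \<comment> \<open>A nonzero remainder would contradict minimality of \<open>s\<close>; once it
      is zero, injectivity on B leaves exactly a multiple of \<open>c\<close>.\<close>
    define d m where "d = i div int s" and "m = i mod int s"
    have i: "i = d * int s + m" "0 \<le> m" "m < int s"
      using s by (auto simp: d_def m_def s_def)
    have e: "a - zmul d c = (b' - zmul d b) + zmul m x"
      unfolding b'(2) c_def i(1) by (simp add: zmul_add_left zmul_add_right zmul_zmul algebra_simps)
    have an: "a \<in> grp n" using b' x by auto
    have "\<phi> (a - zmul d c) = 0"
      using phi_add[OF an, of "- zmul d c"] phi_uminus[of "zmul d c"] phi_zmul[OF c(1), of d] c b' by simp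
    then have phi_e: "\<phi> ((b' - zmul d b) + zmul m x) = 0"
      by (simp only: e)
    have "m = 0"
    proof (rule ccontr)
      assume "m \<noteq> 0"
      then have "Pr (nat m)"
        using i phi_e b' b by (auto simp: Pr_def intro!: bexI[of _ "b' - zmul d b"])
      then have "s \<le> nat m"
        unfolding s_def by (rule Least_le)
      then show False using i by simp
    qed
    then have "a - zmul d c = b' - zmul d b"
      using e by simp
    moreover have "b' - zmul d b = 0"
      using theta_inj[of "b' - zmul d b"] phi_theta[of "b' - zmul d b"] phi_e \<open>m = 0\<close> b b' by simp
    ultimately have "a = zmul d c" by simp
    then show ?thesis by blast
  qed
  then have "supp p \<subseteq> range (\<lambda>i. zmul i c)"
    using pD by blast
  moreover have "p \<noteq> (\<lambda>_. 0)"
    using p0 by metis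
  ultimately show ?thesis
    using that[of b "int s" p] b s p pY c unfolding s_def[symmetric] c_def x_def by auto
qed

end

lemma (in twisted_module) act_commute:
  assumes f: "f \<in> tga n" and g: "g \<in> tga n" and lam: "\<And>a b. f a \<noteq> 0 \<Longrightarrow> g b \<noteq> 0 \<Longrightarrow> lam a b = 1"
  shows "act f (act g x) = act g (act f x)"
proof -
  have "T a (act g x) = act g (T a x)" if a: "f a \<noteq> 0" for a
  proof -
    have "conj a g = g"
      using lam[OF a] by (force simp: conj_def)
    then show ?thesis
      using T_act[OF tga_supp[OF f a] g, of x] by simp
  qed
  then have "(\<Sum>a\<in>supp f. scale (f a) (T a (act g x))) = (\<Sum>a\<in>supp f. scale (f a) (act g (T a x)))"
    by (intro sum.cong) auto
  then show ?thesis
    using g by (simp add: act_expand_supp[OF f] act_sum_right act_scale)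
qed

context initial_form
begin

text \<open>Laurent polynomials in \<open>c\<close> sending all \<open>c'\<close>-translates of
  \<open>w\<close> into \<open>Y\<close> are stable under conjugation by \<open>c'\<close>. One with
  fewest terms is an eigenvector, so the commutator with \<open>c'\<close> agrees on two different
  powers of \<open>c\<close>.\<close>

lemma commutator_root_of_unity:
  assumes c: "c \<in> grp n" "\<phi> c = 0" and p: "p \<in> tga n" "p \<noteq> (\<lambda>_. 0)" "supp p \<subseteq> range (\<lambda>i. zmul i c)" "act p w \<in> Y"
    and c': "c' \<in> grp n" "\<phi> c' = 0" "c' \<noteq> 0"
    and p': "p' \<in> tga n" "p' \<noteq> (\<lambda>_. 0)" "supp p' \<subseteq> range (\<lambda>i. zmul i c')" "act p' w \<in> Y"
  shows "\<exists>D. D \<noteq> 0 \<and> lam c' c powi D = 1"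
proof -
  define v where "v = (\<lambda>i. T (zmul i c') w)"
  define L :: "((nat \<Rightarrow> int) \<Rightarrow> 'f) set" where "L = {f \<in> tga n. f \<noteq> (\<lambda>_. 0) \<and> supp f \<subseteq> range (\<lambda>i. zmul i c)}"
  have phi_c: "\<phi> (zmul i c) = 0" "\<phi> (zmul i c') = 0" for i
    using phi_zmul[OF c(1), of i] phi_zmul[OF c'(1), of i] c c' by auto
  have L_supp: "\<exists>i. a = zmul i c" if "f \<in> L" "f a \<noteq> 0" for f a
    using that unfolding L_def by blast
  have L_act: "act f y \<in> Y" if "f \<in> L" "y \<in> Y" for f y
    using that phi_c L_supp[OF that(1)] by (intro act_Y) (auto simp: L_def)
  have lam_c: "lam (zmul i c) (zmul k c) = 1" for i k
    by (simp only: lam_zmul_left[OF c(1) grp_zmul[OF c(1)]] lam_zmul_right[OF c(1) c(1)] lam_self[OF c(1)] power_int_1_left)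
  have T_v: "T (zmul k c') (v i) = scale (\<tau> (zmul k c') (zmul i c')) (v (k + i))" for k i
    unfolding v_def zmul_add_left by (rule T_T) (use c' in auto)
  have tau_c': "\<tau> (zmul k c') (zmul i c') \<noteq> 0" for k i
    using c' by (intro tau_nonzero) auto
  \<comment> \<open>The conjugate of \<open>p\<close> by the power \<open>N\<close> of
    \<open>c'\<close> sends \<open>v N\<close> into \<open>Y\<close>. Multiplying by it keeps the
    earlier indices, and the factors commute, being Laurent polynomials in \<open>c\<close>.\<close>
  have window: "\<exists>f\<in>L. \<forall>i<N. act f (v (int i)) \<in> Y" for N
  proof (induction N)
    case 0
    have "(bar 0 :: _ \<Rightarrow> 'f) 0 \<noteq> 0"
      by (simp add: bar_def)
    then have "(bar 0 :: _ \<Rightarrow> 'f) \<noteq> (\<lambda>_. 0)"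
      by metis
    moreover have "0 \<in> range (\<lambda>i. zmul i c)"
      using zmul_simps(1)[of c, symmetric] by (rule range_eqI)
    ultimately have "bar 0 \<in> L"
      unfolding L_def by (simp only: mem_Collect_eq bar_in_tga grp_0 supp_bar) simp
    then show ?case by blast
  next
    case (Suc N)
    then obtain f where f: "f \<in> L" "\<And>i. i < N \<Longrightarrow> act f (v (int i)) \<in> Y" by blast
    define g where "g = conj (zmul (int N) c') p"
    have g: "g \<in> tga n" "g a \<noteq> 0 \<longleftrightarrow> p a \<noteq> 0" for a
      using p conj_tga conj_supp[OF grp_zmul[OF c'(1)] p(1)] by (auto simp: g_def)
    then have gL: "g \<in> L"
      using p by (auto simp: L_def fun_eq_iff)
    have fn: "f \<in> tga n" using f by (simp add: L_def)
    have "tmul \<tau> g f \<in> L"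
    proof -
      have "tmul \<tau> g f \<in> tga n" "tmul \<tau> g f \<noteq> (\<lambda>_. 0)"
        using f gL by (auto simp: L_def intro: tmul_in_tga tmul_nonzero[THEN notE])
      moreover have "supp (tmul \<tau> g f) \<subseteq> range (\<lambda>i. zmul i c)"
      proof
        fix a assume "a \<in> supp (tmul \<tau> g f)"
        then have "tmul \<tau> g f a \<noteq> 0" by simp
        from tmul_supp[OF tga_finite_supp[OF g(1)] tga_finite_supp[OF fn] this]
        obtain b b' where b: "g b \<noteq> 0" "f b' \<noteq> 0" "a = b + b'" .
        obtain i i' where "b = zmul i c" "b' = zmul i' c"
          using L_supp[OF gL b(1)] L_supp[OF f(1) b(2)] by blast
        then have "a = zmul (i + i') c"
          using b by (simp only: zmul_add_left)
        then show "a \<in> range (\<lambda>i. zmul i c)" by blast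
      qed
      ultimately show ?thesis by (simp add: L_def)
    qed
    moreover have "act (tmul \<tau> g f) (v (int i)) \<in> Y" if i: "i < Suc N" for i
    proof (cases "i = N")
      case False
      then have "act f (v (int i)) \<in> Y"
        using f i by auto
      then show ?thesis
        unfolding act_tmul[OF g(1) fn] by (rule L_act[OF gL])
    next
      case True
      have "act g (v (int N)) = T (zmul (int N) c') (act p w)"
        unfolding v_def g_def using T_act[OF grp_zmul[OF c'(1)] p(1)] by simp
      also have "\<dots> \<in> Y"
        using p c' phi_c by (intro T_Y) auto
      finally have "act f (act g (v (int N))) \<in> Y"
        by (rule L_act[OF f(1)])
      moreover have "act g (act f (v (int N))) = act f (act g (v (int N)))"
      proof (rule act_commute[OF g(1) fn])
        fix a b assume ab: "g a \<noteq> 0" "f b \<noteq> 0"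
        obtain i k where "a = zmul i c" "b = zmul k c"
          using L_supp[OF gL ab(1)] L_supp[OF f(1) ab(2)] by blast
        then show "lam a b = 1" using lam_c by simp
      qed
      ultimately show ?thesis
        unfolding act_tmul[OF g(1) fn] True by simp
    qed
    ultimately show ?case by blast
  qed
  define E where "E = {i. p' (zmul i c') \<noteq> 0}"
  have inj: "zmul i c' = zmul k c' \<longleftrightarrow> i = k" for i k
    using zmul_eq_0_iff[of "i - k" c'] c'(3) by (simp add: zmul_diff_left)
  have supp_p': "supp p' = (\<lambda>i. zmul i c') ` E"
    using p'(3) by (auto simp: E_def)
  have inj_E: "inj_on (\<lambda>i. zmul i c') E"
    by (auto simp: inj_on_def inj)
  have E: "finite E" "E \<noteq> {}"
    using finite_imageD[OF _ inj_E] supp_p' p' by (auto simp: tga_iff)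
  define s where "s = Max E - Min E + 1"
  have s: "s \<ge> 1" "\<And>e e'. e \<in> E \<Longrightarrow> e' \<in> E \<Longrightarrow> e - e' < s"
  proof -
    show "s \<ge> 1"
      using Min_le[OF E(1) Max_in[OF E]] by (simp add: s_def)
    show "e - e' < s" if "e \<in> E" "e' \<in> E" for e e'
      using Max_ge[OF E(1) that(1)] Min_le[OF E(1) that(2)] by (simp add: s_def)
  qed
  obtain f0 where f0: "f0 \<in> L" "\<And>i. i < nat s \<Longrightarrow> act f0 (v (int i)) \<in> Y"
    using window[of "nat s"] by blast
  \<comment> \<open>The recurrence given by \<open>p'\<close> carries the finite window to all
    integers: once its other terms lie in \<open>Y\<close>, so does the term at
    \<open>e0\<close>.\<close>
  have f0_all: "act f0 (v i) \<in> Y" for i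
  proof (rule int_relation_induct[OF E _ s, where P = "\<lambda>i. act f0 (v i) \<in> Y"])
    show "act f0 (v k) \<in> Y" if "0 \<le> k" "k < s" for k
      using f0(2)[of "nat k"] that by simp
    fix k e0 assume e0: "e0 \<in> E" and IH: "\<And>e. e \<in> E \<Longrightarrow> e \<noteq> e0 \<Longrightarrow> act f0 (v (k + e)) \<in> Y"
    have f0n: "f0 \<in> tga n" using f0 by (simp add: L_def)
    have kn: "zmul k c' \<in> grp n" using c' by auto
    define h where "h = (\<lambda>e. scale (p' (zmul e c') * \<tau> (zmul k c') (zmul e c')) (act f0 (v (k + e))))"
    have "act f0 (T (zmul k c') (act p' w)) \<in> Y"
      using T_Y[OF kn _ p'(4)] phi_c by (intro L_act[OF f0(1)]) auto
    also have "act f0 (T (zmul k c') (act p' w)) = (\<Sum>a\<in>supp p'. scale (p' a) (act f0 (T (zmul k c') (T a w))))"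
      unfolding act_expand_supp[OF p'(1)] T_sum[OF kn] T_scale[OF kn] act_sum_right[OF f0n] act_scale[OF f0n] ..
    also have "\<dots> = (\<Sum>e\<in>E. scale (p' (zmul e c')) (act f0 (T (zmul k c') (v e))))"
      unfolding supp_p' by (subst sum.reindex[OF inj_E]) (simp add: v_def)
    also have "\<dots> = (\<Sum>e\<in>E. h e)"
      by (simp add: T_v act_scale[OF f0n] h_def)
    also have "\<dots> = h e0 + (\<Sum>e\<in>E - {e0}. h e)"
      by (rule sum.remove[OF E(1) e0])
    finally have "h e0 + (\<Sum>e\<in>E - {e0}. h e) \<in> Y" .
    moreover have rest: "(\<Sum>e\<in>E - {e0}. h e) \<in> Y"
      unfolding h_def using IH by (intro subspace_sum subspace_scale Y_subspace) auto
    ultimately have "h e0 + (\<Sum>e\<in>E - {e0}. h e) - (\<Sum>e\<in>E - {e0}. h e) \<in> Y"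
      by (rule subspace_diff[OF Y_subspace])
    then have "h e0 \<in> Y" by simp
    then show "act f0 (v (k + e0)) \<in> Y"
      unfolding h_def by (rule Y_scale_cancel[rotated]) (use e0 tau_c' in \<open>auto simp: E_def\<close>)
  qed
  define K where "K = {f \<in> L. \<forall>i. act f (v i) \<in> Y}"
  have "\<exists>f. f \<in> K \<and> (\<forall>g. g \<in> K \<longrightarrow> card (supp f) \<le> card (supp g))"
    using f0(1) f0_all by (intro ex_has_least_nat[of _ f0]) (auto simp: K_def)
  then obtain f where f: "f \<in> K" "\<And>g. g \<in> K \<Longrightarrow> card (supp f) \<le> card (supp g)"
    by blast
  have fn: "f \<in> tga n" and f_supp: "supp f \<subseteq> range (\<lambda>i. zmul i c)" and fv: "\<And>i. act f (v i) \<in> Y"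
    using f(1) by (auto simp: K_def L_def)
  have "f \<noteq> (\<lambda>_. 0)"
    using f(1) by (simp add: K_def L_def)
  then obtain a0 where a0: "f a0 \<noteq> 0"
    by (meson ext)
  \<comment> \<open>The eigenvalue is read off at \<open>a0\<close>, so the term there cancels. The
    smaller support contradicts minimality unless \<open>g\<close> vanishes.\<close>
  define g where "g = (\<lambda>a. conj c' f a + (- lam c' a0) * f a)"
  have cfn: "conj c' f \<in> tga n" using fn by (rule conj_tga)
  have gn: "g \<in> tga n"
    unfolding g_def by (rule tga_add[OF cfn tga_scale[OF fn]])
  have g_supp: "supp g \<subseteq> supp f - {a0}"
    by (auto simp: g_def conj_def)
  have "act g (v i) \<in> Y" for i
  proof -
    \<comment> \<open>The index \<open>i - 1\<close> compensates for \<open>T c'\<close> raising it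
      by one.\<close>
    have "T c' (act f (v (i - 1))) \<in> Y"
      using c' fv by (intro T_Y) auto
    then have "act (conj c' f) (T c' (v (i - 1))) \<in> Y"
      by (simp only: T_act[OF c'(1) fn])
    moreover have "T c' (v (i - 1)) = scale (\<tau> c' (zmul (i - 1) c')) (v i)"
      using T_v[of 1 "i - 1"] by simp
    ultimately have "scale (\<tau> c' (zmul (i - 1) c')) (act (conj c' f) (v i)) \<in> Y"
      by (simp add: act_scale[OF cfn])
    then have "act (conj c' f) (v i) \<in> Y"
      using Y_scale_cancel tau_c'[of 1 "i - 1"] by simp
    then show ?thesis
      unfolding g_def act_plus[OF cfn tga_scale[OF fn]] act_times[OF fn]
      by (intro subspace_add subspace_scale Y_subspace fv)
  qed
  then have "g = (\<lambda>_. 0)"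
  proof (rule_tac ccontr)
    assume "\<And>i. act g (v i) \<in> Y" "g \<noteq> (\<lambda>_. 0)"
    then have "g \<in> K"
      using gn g_supp f_supp by (auto simp: K_def L_def)
    then have "card (supp f) \<le> card (supp g)"
      by (rule f(2))
    also have "\<dots> < card (supp f)"
      using g_supp a0 tga_finite_supp[OF fn] by (intro psubset_card_mono) auto
    finally show False by simp
  qed
  then have g0: "g a = 0" for a
    by (rule fun_cong)
  have eq: "lam c' a = lam c' a0" if "f a \<noteq> 0" for a
    using that g0[of a] by (simp add: g_def conj_def flip: left_diff_distrib)
  \<comment> \<open>A one-term \<open>f\<close> would put the translate \<open>T a0 w\<close>, of
    weight zero, into \<open>Y\<close>.\<close>
  have "\<exists>a. f a \<noteq> 0 \<and> a \<noteq> a0"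
  proof (rule ccontr)
    assume "\<not> ?thesis"
    then have "f a \<noteq> 0 \<Longrightarrow> a \<in> {a0}" for a by blast
    then have "act f (v 0) = (\<Sum>a\<in>{a0}. scale (f a) (T a (v 0)))"
      using tga_supp[OF fn a0] by (intro act_expand) auto
    then have "scale (f a0) (T a0 (T 0 w)) \<in> Y"
      using fv[of 0] by (simp add: v_def)
    then have "T a0 (T 0 w) \<in> Y"
      using Y_scale_cancel a0 by blast
    then have "T a0 w \<in> Y"
      using Y_scale_cancel[OF tau_nonzero[OF tga_supp[OF fn a0] grp_0]] T_T[OF tga_supp[OF fn a0] grp_0, of w]
      by simp
    moreover have "\<phi> a0 = 0"
      using f_supp a0 phi_c by blast
    ultimately show False
      using T_w_notin[OF tga_supp[OF fn a0]] by blast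
  qed
  then obtain a where a: "f a \<noteq> 0" "a \<noteq> a0" by blast
  then obtain i k where ik: "a = zmul i c" "a0 = zmul k c"
    using f_supp a0 by blast
  have "lam c' c powi i = lam c' c powi k"
    using eq[OF a(1)] unfolding ik lam_zmul_right[OF c'(1) c(1)] .
  then have "lam c' c powi (i - k) = 1"
    using lam_nonzero[OF c'(1) c(1)] by (simp add: power_int_diff)
  moreover have "i - k \<noteq> 0"
    using a ik by auto
  ultimately show ?thesis by blast
qed

end

section \<open>Inverses and integer powers of basis elements\<close>

context twisted_module
begin

lemma tau_0_left: "a \<in> grp n \<Longrightarrow> \<tau> 0 a = \<tau> 0 0"
  using tau_cocycle[of 0 0 a] tau_nonzero[of 0 a] by simp

lemma tau_0_right: "a \<in> grp n \<Longrightarrow> \<tau> a 0 = \<tau> 0 0"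
  using tau_cocycle[of a 0 0] tau_nonzero[of a 0] by simp

text \<open>The cocycle identity for \<open>a, - a, a\<close>, in which the factors with argument
  \<open>0\<close> both reduce to \<open>\<tau> 0 0\<close>. It makes the right inverse of
  \<open>bar a\<close> a left inverse as well.\<close>

lemma tau_uminus_commute:
  assumes a: "a \<in> grp n"
  shows "\<tau> (- a) a = \<tau> a (- a)"
proof -
  have "\<tau> a (- a) * \<tau> 0 0 = \<tau> 0 0 * \<tau> (- a) a"
    using tau_cocycle[OF a grp_uminus[OF a] a]
    by (simp only: right_minus left_minus tau_0_left[OF a] tau_0_right[OF a])
  then show ?thesis
    using tau_nonzero[OF grp_0 grp_0] by simp
qed

text \<open>As \<open>tinv\<close> is a definite description, uniqueness is needed too: comparing
  the coefficients of \<open>tmul \<tau> (bar a) v\<close> with those of the unit determines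
  \<open>v\<close>. The factor \<open>\<tau> 0 0\<close> reflects the coefficient of
  \<open>tunit \<tau>\<close>.\<close>

lemma tinv_bar:
  assumes a: "a \<in> grp n"
  shows "tinv n \<tau> (bar a) = (\<lambda>x. inverse (\<tau> 0 0 * \<tau> a (- a)) * bar (- a) x)"
  unfolding tinv_def
proof (rule the_equality)
  let ?\<gamma> = "inverse (\<tau> 0 0 * \<tau> a (- a))"
  have nz: "\<tau> 0 0 \<noteq> 0" "\<tau> a (- a) \<noteq> 0"
    using a tau_nonzero by auto
  have "tmul \<tau> (bar a) (\<lambda>x. ?\<gamma> * bar (- a) x) = (\<lambda>x. ?\<gamma> * \<tau> a (- a) * bar 0 x)"
    using tmul_monomials[of \<tau> 1 a ?\<gamma> "- a"] by simp
  moreover have "tmul \<tau> (\<lambda>x. ?\<gamma> * bar (- a) x) (bar a) = (\<lambda>x. ?\<gamma> * \<tau> a (- a) * bar 0 x)"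
    using tmul_monomials[of \<tau> ?\<gamma> "- a" 1 a] tau_uminus_commute[OF a] by simp
  moreover have "?\<gamma> * \<tau> a (- a) = inverse (\<tau> 0 0)"
    using nz by simp
  ultimately show "(\<lambda>x. ?\<gamma> * bar (- a) x) \<in> tga n \<and> tmul \<tau> (bar a) (\<lambda>x. ?\<gamma> * bar (- a) x) = tunit \<tau>
      \<and> tmul \<tau> (\<lambda>x. ?\<gamma> * bar (- a) x) (bar a) = tunit \<tau>"
    using a by (simp only: tunit_eq tga_scale bar_in_tga grp_uminus simp_thms)
  fix v assume v: "v \<in> tga n \<and> tmul \<tau> (bar a) v = tunit \<tau> \<and> tmul \<tau> v (bar a) = tunit \<tau>"
  show "v = (\<lambda>x. ?\<gamma> * bar (- a) x)"
  proof
    fix b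
    have coeff: "\<tau> a b * v b = inverse (\<tau> 0 0) * bar 0 (a + b)"
    proof -
      have "tmul \<tau> (bar a) v (a + b) = (\<Sum>a'\<in>{a}. \<tau> a' (a + b - a') * bar a a' * v (a + b - a'))"
        by (rule tmul_eq) (use v in \<open>auto simp: tga_iff\<close>)
      then have "tunit \<tau> (a + b) = \<tau> a b * v b"
        using v by (simp add: bar_def)
      then show ?thesis
        by (simp add: tunit_eq)
    qed
    show "v b = ?\<gamma> * bar (- a) b"
    proof (cases "b = - a")
      case True
      then have "\<tau> a (- a) * v b = inverse (\<tau> 0 0)"
        using coeff by (simp add: bar_def)
      then show ?thesis
        using nz True by (simp add: bar_def field_simps)
    next
      case False
      then have "a + b \<noteq> 0"
        by (simp add: eq_neg_iff_add_eq_0 add.commute)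
      then have "\<tau> a b * v b = 0"
        using coeff by (simp add: bar_def)
      then have "v b = 0"
        using tau_nonzero[OF a, of b] tga_supp[of v n b] v by auto
      then show ?thesis
        using False by (simp add: bar_def)
    qed
  qed
qed

lemma tpow_nat_monomial:
  assumes a: "a \<in> grp n" and \<beta>: "\<beta> \<noteq> 0"
  shows "\<exists>\<alpha>. \<alpha> \<noteq> 0 \<and> tpow_nat \<tau> (\<lambda>x. \<beta> * bar a x) k = (\<lambda>x. \<alpha> * bar (zmul (int k) a) x)"
proof (induction k)
  case 0
  show ?case
    unfolding tpow_nat.simps tunit_eq of_nat_0 zmul_simps
    using nonzero_imp_inverse_nonzero[OF tau_nonzero[OF grp_0 grp_0]] by blast
next
  case (Suc k)
  then obtain \<alpha> where \<alpha>: "\<alpha> \<noteq> 0" "tpow_nat \<tau> (\<lambda>x. \<beta> * bar a x) k = (\<lambda>x. \<alpha> * bar (zmul (int k) a) x)"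
    by blast
  have "zmul (int (Suc k)) a = a + zmul (int k) a"
    using zmul_add_left[of 1 "int k" a] by simp
  then have "tpow_nat \<tau> (\<lambda>x. \<beta> * bar a x) (Suc k) = (\<lambda>x. \<beta> * \<alpha> * \<tau> a (zmul (int k) a) * bar (zmul (int (Suc k)) a) x)"
    unfolding tpow_nat.simps \<alpha>(2) tmul_monomials by (simp only:)
  moreover have "\<beta> * \<alpha> * \<tau> a (zmul (int k) a) \<noteq> 0"
    using \<alpha> \<beta> tau_nonzero[OF a grp_zmul[OF a]] by simp
  ultimately show ?case by blast
qed

text \<open>Scalars cancel when two monomials are tested for commutation, so only the exponent of
  the power is recorded.\<close>

lemma tpow_bar:
  assumes a: "a \<in> grp n"
  obtains \<alpha> where "\<alpha> \<noteq> 0" "tpow n \<tau> (bar a) s = (\<lambda>x. \<alpha> * bar (zmul s a) x)"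
proof (cases "0 \<le> s")
  case True
  have "tpow_nat \<tau> (\<lambda>x. 1 * bar a x) (nat s) = tpow n \<tau> (bar a) s"
    using True by (simp add: tpow_def)
  then show ?thesis
    using tpow_nat_monomial[OF a one_neq_zero, of "nat s"] True that by auto
next
  case False
  let ?\<gamma> = "inverse (\<tau> 0 0 * \<tau> a (- a))"
  have \<gamma>: "?\<gamma> \<noteq> 0"
    using a tau_nonzero by simp
  have "tpow n \<tau> (bar a) s = tpow_nat \<tau> (\<lambda>x. ?\<gamma> * bar (- a) x) (nat (- s))"
    using False by (simp add: tpow_def tinv_bar[OF a])
  moreover have "zmul (int (nat (- s))) (- a) = zmul s a"
    using False by (auto simp: zmul_def fun_eq_iff)
  ultimately show ?thesis
    using tpow_nat_monomial[OF grp_uminus[OF a] \<gamma>, of "nat (- s)"] that by auto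
qed

end

theorem theorem4p4:
  fixes n r :: nat
    and \<tau> :: "(nat \<Rightarrow> int) \<Rightarrow> (nat \<Rightarrow> int) \<Rightarrow> 'f::field"
    and scale :: "'f \<Rightarrow> 'm::ab_group_add \<Rightarrow> 'm"
    and act :: "((nat \<Rightarrow> int) \<Rightarrow> 'f) \<Rightarrow> 'm \<Rightarrow> 'm"
  assumes "cocycle n \<tau>"
    and "tga_module n \<tau> scale act"
    and "fin_gen n act"
    and "gkdim n \<tau> scale act = ereal (real r)"
    and "0 < r" and "r < n"
    and "\<not> torsion_over r act"
  shows "\<exists>l :: nat \<Rightarrow> (nat \<Rightarrow> int). \<exists>s :: nat \<Rightarrow> int.
           (\<forall>j\<in>{r..<n}. l j \<in> grp r \<and> s j \<noteq> 0) \<and>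
           (\<forall>j\<in>{r..<n}. \<forall>k\<in>{r..<n}.
              tmul \<tau> (tmul \<tau> (bar (l j)) (tpow n \<tau> (bar (gen j)) (s j)))
                     (tmul \<tau> (bar (l k)) (tpow n \<tau> (bar (gen k)) (s k)))
            = tmul \<tau> (tmul \<tau> (bar (l k)) (tpow n \<tau> (bar (gen k)) (s k)))
                     (tmul \<tau> (bar (l j)) (tpow n \<tau> (bar (gen j)) (s j))))"
proof -
  interpret twisted_module n \<tau> scale act
    using assms by unfold_locales
  obtain \<theta> :: "(nat \<Rightarrow> int) \<Rightarrow> real" where "\<And>a b. \<theta> (a + b) = \<theta> a + \<theta> b" "\<And>a. a \<in> grp r \<Longrightarrow> \<theta> a = 0 \<Longrightarrow> a = 0"
    by (rule log_primes_independent[of r]) (rule that)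
  then interpret valued_module n \<tau> scale act r \<theta>
    using assms(6) by unfold_locales auto
  have gk: "gkdim n \<tau> scale act \<le> ereal (real r)"
    using assms(4) by simp
  \<comment> \<open>The relation is stated for every vector: first for \<open>m\<close>, to build
    the lattice, and later for the vector \<open>w\<close> that survives the degeneration.\<close>
  have rel: "\<exists>f. f \<in> tga n \<and> f \<noteq> (\<lambda>_. 0) \<and> supp f \<subseteq> line r j \<and> act f x = 0" if "r \<le> j" "j < n" for j x
    using gkdim_relation[OF gk \<open>r \<le> j\<close> \<open>j < n\<close>, of x] by blast
  obtain m where m: "\<And>u. u \<in> tga r \<Longrightarrow> u \<noteq> (\<lambda>_. 0) \<Longrightarrow> act u m \<noteq> 0"
    using assms(7) by (auto simp: torsion_over_def)
  obtain \<phi> w where "\<And>a b. a \<in> grp n \<Longrightarrow> b \<in> grp n \<Longrightarrow> \<phi> (a + b) = \<phi> a + \<phi> b"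
    "\<And>b. b \<in> grp r \<Longrightarrow> \<phi> b = \<theta> b" "w \<notin> span ((\<lambda>a. T a w) ` {a \<in> grp n. \<phi> a > 0})"
    by (rule initial_form_exists[OF m rel]) (assumption | rule that)+
  then interpret initial_form n \<tau> scale act r \<theta> \<phi> w
    by unfold_locales auto
  \<comment> \<open>A triple for each \<open>j\<close>: the part in B, the exponent of
    \<open>gen j\<close>, and the Laurent polynomial sending \<open>w\<close> into
    \<open>Y\<close>.\<close>
  define R where "R = (\<lambda>j (b, s, p). b \<in> grp r \<and> s \<noteq> 0 \<and> \<phi> (b + zmul s (gen j)) = 0
    \<and> p \<in> tga n \<and> p \<noteq> (\<lambda>_. 0) \<and> supp p \<subseteq> range (\<lambda>i. zmul i (b + zmul s (gen j))) \<and> act p w \<in> Y)"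
  have "\<exists>q. R j q" if j: "j \<in> {r..<n}" for j
  proof -
    have j': "r \<le> j" "j < n" using j by auto
    obtain f where f: "f \<in> tga n" "f \<noteq> (\<lambda>_. 0)" "supp f \<subseteq> line r j" "act f w = 0"
      using rel[OF j', of w] by blast
    obtain b s p where "b \<in> grp r" "s \<noteq> 0" "\<phi> (b + zmul s (gen j)) = 0"
      "p \<in> tga n" "p \<noteq> (\<lambda>_. 0)" "supp p \<subseteq> range (\<lambda>i. zmul i (b + zmul s (gen j)))" "act p w \<in> Y"
      using kernel_generator[OF j' f] .
    then have "R j (b, s, p)" by (simp add: R_def)
    then show ?thesis ..
  qed
  then have "\<exists>q. \<forall>j\<in>{r..<n}. R j (q j)"
    by (intro bchoice) blast
  then obtain q where q: "\<forall>j\<in>{r..<n}. R j (q j)" ..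
  define b where "b = (\<lambda>j. fst (q j))"
  define s where "s = (\<lambda>j. fst (snd (q j)))"
  define p where "p = (\<lambda>j. snd (snd (q j)))"
  define c where "c = (\<lambda>j. b j + zmul (s j) (gen j))"
  have bsp: "b j \<in> grp r" "s j \<noteq> 0" "\<phi> (c j) = 0"
    "p j \<in> tga n" "p j \<noteq> (\<lambda>_. 0)" "supp (p j) \<subseteq> range (\<lambda>i. zmul i (c j))" "act (p j) w \<in> Y"
    if "j \<in> {r..<n}" for j
    using bspec[OF q that] by (auto simp: R_def b_def s_def p_def c_def split: prod.splits)
  have c: "c j \<in> grp n" "c j \<noteq> 0" if j: "j \<in> {r..<n}" for j
  proof -
    show "c j \<in> grp n" using bsp[OF j] j by (auto simp: c_def)
    have "c j j = s j"
      using line_coord[of r j "b j" "s j"] bsp(1)[OF j] j by (auto simp: c_def)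
    then show "c j \<noteq> 0"
      using bsp(2)[OF j] by auto
  qed
  have "\<forall>jk\<in>{r..<n} \<times> {r..<n}. \<exists>D. D \<noteq> 0 \<and> lam (c (fst jk)) (c (snd jk)) powi D = 1"
  proof
    fix jk assume "jk \<in> {r..<n} \<times> {r..<n}"
    then have jk: "fst jk \<in> {r..<n}" "snd jk \<in> {r..<n}" by auto
    show "\<exists>D. D \<noteq> 0 \<and> lam (c (fst jk)) (c (snd jk)) powi D = 1"
      by (rule commutator_root_of_unity[OF c(1)[OF jk(2)] bsp(3-7)[OF jk(2)]
            c(1)[OF jk(1)] bsp(3)[OF jk(1)] c(2)[OF jk(1)] bsp(4-7)[OF jk(1)]])
  qed
  from bchoice[OF this] obtain D
    where D: "\<forall>jk\<in>{r..<n} \<times> {r..<n}. D jk \<noteq> 0 \<and> lam (c (fst jk)) (c (snd jk)) powi D jk = 1" ..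
  \<comment> \<open>A common exponent: every pairwise commutator becomes trivial when raised to
    \<open>N\<close>.\<close>
  define N where "N = (\<Prod>jk\<in>{r..<n} \<times> {r..<n}. D jk)"
  have N0: "N \<noteq> 0"
    unfolding N_def using D by (subst prod_zero_iff) auto
  have N: "lam (c j) (c k) powi N = 1" if jk: "j \<in> {r..<n}" "k \<in> {r..<n}" for j k
  proof -
    have "D (j, k) dvd N"
      unfolding N_def using jk by (intro dvd_prodI) auto
    then obtain M where M: "N = D (j, k) * M" by (rule dvdE)
    then show ?thesis
      using D jk by (auto simp: power_int_mult)
  qed
  \<comment> \<open>By bimultiplicativity the commutator of \<open>d j\<close> and
    \<open>d k\<close> is that of \<open>c j\<close> and \<open>c k\<close> raised to
    \<open>N\<close> twice, hence \<open>1\<close>.\<close>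
  define d where "d = (\<lambda>j. zmul N (c j))"
  have lam_d: "lam (d j) (d k) = 1" if jk: "j \<in> {r..<n}" "k \<in> {r..<n}" for j k
    unfolding d_def lam_zmul_left[OF c(1)[OF jk(1)] grp_zmul[OF c(1)[OF jk(2)]]]
      lam_zmul_right[OF c(1)[OF jk(1)] c(1)[OF jk(2)]] N[OF jk] by simp
  have mono: "\<exists>\<alpha>. tmul \<tau> (bar (zmul N (b j))) (tpow n \<tau> (bar (gen j)) (N * s j)) = (\<lambda>x. \<alpha> * bar (d j) x)"
    if j: "j \<in> {r..<n}" for j
  proof -
    have "gen j \<in> grp n" using j by simp
    then obtain \<alpha> where \<alpha>: "tpow n \<tau> (bar (gen j)) (N * s j) = (\<lambda>x. \<alpha> * bar (zmul (N * s j) (gen j)) x)"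
      by (rule tpow_bar)
    have "zmul N (b j) + zmul (N * s j) (gen j) = d j"
      by (simp add: d_def c_def zmul_add_right zmul_zmul)
    then show ?thesis
      using tmul_monomials[of \<tau> 1 "zmul N (b j)" \<alpha> "zmul (N * s j) (gen j)"] unfolding \<alpha> by auto
  qed
  show ?thesis
  \<comment> \<open>The power \<open>N\<close> of \<open>c j\<close> multiplies both its part in B
    and its exponent of \<open>gen j\<close> by \<open>N\<close>, which gives the witnesses.\<close>
  proof (intro exI[of _ "\<lambda>j. zmul N (b j)"] exI[of _ "\<lambda>j. N * s j"] conjI ballI)
    fix j assume j: "j \<in> {r..<n}"
    show "zmul N (b j) \<in> grp r" "N * s j \<noteq> 0"
      using bsp[OF j] N0 by auto
    fix k assume k: "k \<in> {r..<n}"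
    obtain \<alpha> where \<alpha>: "tmul \<tau> (bar (zmul N (b j))) (tpow n \<tau> (bar (gen j)) (N * s j)) = (\<lambda>x. \<alpha> * bar (d j) x)"
      using mono[OF j] by blast
    obtain \<beta> where \<beta>: "tmul \<tau> (bar (zmul N (b k))) (tpow n \<tau> (bar (gen k)) (N * s k)) = (\<lambda>x. \<beta> * bar (d k) x)"
      using mono[OF k] by blast
    have dn: "d j \<in> grp n" "d k \<in> grp n"
      using c j k by (auto simp: d_def)
    have "\<tau> (d j) (d k) = \<tau> (d k) (d j)"
      using lam_d[OF j k] tau_nonzero[OF dn(2,1)] by (simp add: lam_def)
    then show "tmul \<tau> (tmul \<tau> (bar (zmul N (b j))) (tpow n \<tau> (bar (gen j)) (N * s j)))
        (tmul \<tau> (bar (zmul N (b k))) (tpow n \<tau> (bar (gen k)) (N * s k)))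
      = tmul \<tau> (tmul \<tau> (bar (zmul N (b k))) (tpow n \<tau> (bar (gen k)) (N * s k)))
        (tmul \<tau> (bar (zmul N (b j))) (tpow n \<tau> (bar (gen j)) (N * s j)))"
      unfolding \<alpha> \<beta> tmul_monomials by (simp add: add.commute mult.commute)
  qed
qed

end
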